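(* Let $M$ be a closed orientable 3-manifold and let $\xi$ be a transversally orientable contact structure on $M$ such that there is a contact structure $\eta$ on $M$ transverse to $\xi$. Then for any smooth function $f : M \to \mathbb{R}$ there is a Riemannian metric on $M$ such that $f$ is the sectional curvature of $\xi$, i.e. $K(\xi) = f$ on $M$.
   Context: A (plane) distribution on a 3-manifold $M$ is a rank-two smooth subbundle $\xi$ of $TM$. It is a contact structure if for any linearly independent (local) sections $S, T$ of $\xi$ and any point $p$ the Lie bracket $[S,T]$ at $p$ does not belong to $\xi_p$. It is transversally orientable (transversally oriented) if there is a globally defined 1-form $\alpha$ with $\xi = \ker \alpha$; equivalently, if there is a globally defined vector field transverse to $\xi$. Two plane distributions $\xi,\eta$ are transverse if $\xi_p \neq \eta_p$ (equivalently $\xi_p+\eta_p = T_pM$) for every $p \in M$. Given a Riemannian metric on $M$, the sectional curvature of $\xi$ is the function $K(\xi)$ on $M$ assigning to $p \in M$ the sectional curvature of the plane $\xi_p \subset T_pM$. *)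

theory Defs
  imports "HOL-Analysis.Analysis"
begin

section \<open>Smooth maps between Euclidean spaces\<close>

fun Ck_on :: "nat \<Rightarrow> 'a::euclidean_space set \<Rightarrow> ('a \<Rightarrow> 'b::real_normed_vector) \<Rightarrow> bool" where
  "Ck_on 0 S f \<longleftrightarrow> continuous_on S f"
| "Ck_on (Suc k) S f \<longleftrightarrow> (\<forall>x\<in>S. f differentiable at x) \<and>
     (\<forall>v. Ck_on k S (\<lambda>x. frechet_derivative f (at x) v))"

definition smooth_on :: "'a::euclidean_space set \<Rightarrow> ('a \<Rightarrow> 'b::real_normed_vector) \<Rightarrow> bool" where
  "smooth_on S f \<longleftrightarrow> open S \<and> (\<forall>k. Ck_on k S f)"


section \<open>Vector fields and Riemannian metrics on open subsets of a Euclidean space\<close>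

definition bracket :: "('e::euclidean_space \<Rightarrow> 'e) \<Rightarrow> ('e \<Rightarrow> 'e) \<Rightarrow> 'e \<Rightarrow> 'e" where
  "bracket X Y x = frechet_derivative Y (at x) (X x) - frechet_derivative X (at x) (Y x)"

definition inner_product :: "('e::real_vector \<Rightarrow> 'e \<Rightarrow> real) \<Rightarrow> bool" where
  "inner_product B \<longleftrightarrow> bilinear B \<and> (\<forall>u v. B u v = B v u) \<and> (\<forall>v. v \<noteq> 0 \<longrightarrow> B v v > 0)"

text \<open>A metric assigns to each point an inner product. The Christoffel map below is
  the coordinate formula
  \<open>2 g\<^sub>k\<^sub>l \<Gamma>\<^sup>k\<^sub>i\<^sub>j = \<partial>\<^sub>i g\<^sub>j\<^sub>l + \<partial>\<^sub>j g\<^sub>i\<^sub>l - \<partial>\<^sub>l g\<^sub>i\<^sub>j\<close>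
  with the indices \<open>i, j, l\<close> replaced by arbitrary constant vectors \<open>u, v, z\<close>.\<close>

definition christoffel ::
    "('e::euclidean_space \<Rightarrow> 'e \<Rightarrow> 'e \<Rightarrow> real) \<Rightarrow> 'e \<Rightarrow> 'e \<Rightarrow> 'e \<Rightarrow> 'e" where
  "christoffel G x u v = (THE w. \<forall>z. 2 * G x w z =
       frechet_derivative (\<lambda>y. G y v z) (at x) u
     + frechet_derivative (\<lambda>y. G y u z) (at x) v
     - frechet_derivative (\<lambda>y. G y u v) (at x) z)"

text \<open>The Levi-Civita connection \<open>\<nabla>\<^sub>X Y\<close>; see \<open>levi_civita_torsion_free\<close>
  and \<open>levi_civita_metric\<close> below.\<close>

definition levi_civita ::
    "('e::euclidean_space \<Rightarrow> 'e \<Rightarrow> 'e \<Rightarrow> real) \<Rightarrow> ('e \<Rightarrow> 'e) \<Rightarrow> ('e \<Rightarrow> 'e) \<Rightarrow> 'e \<Rightarrow> 'e" where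
  "levi_civita G X Y x = frechet_derivative Y (at x) (X x) + christoffel G x (X x) (Y x)"

definition riemann ::
    "('e::euclidean_space \<Rightarrow> 'e \<Rightarrow> 'e \<Rightarrow> real) \<Rightarrow>
     ('e \<Rightarrow> 'e) \<Rightarrow> ('e \<Rightarrow> 'e) \<Rightarrow> ('e \<Rightarrow> 'e) \<Rightarrow> 'e \<Rightarrow> 'e" where
  "riemann G X Y Z x = levi_civita G X (levi_civita G Y Z) x
     - levi_civita G Y (levi_civita G X Z) x - levi_civita G (bracket X Y) Z x"

text \<open>Curvature is tensorial, so its value on tangent vectors \<open>u, v\<close> at \<open>x\<close>
  may be computed from any extension to vector fields; the constant ones are used.\<close>

definition sec_curv ::
    "('e::euclidean_space \<Rightarrow> 'e \<Rightarrow> 'e \<Rightarrow> real) \<Rightarrow> 'e \<Rightarrow> 'e \<Rightarrow> 'e \<Rightarrow> real" where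
  "sec_curv G x u v = G x (riemann G (\<lambda>_. u) (\<lambda>_. v) (\<lambda>_. v) x) u
     / (G x u u * G x v v - (G x u v)\<^sup>2)"


section \<open>Smooth 3-manifolds\<close>

text \<open>The underlying topological space is the whole type. A chart is a pair of its
  domain and its coordinate map, the values of the latter outside of the domain being irrelevant.
  A smooth structure is given by an atlas, which need not be maximal.\<close>

type_synonym 'a chart = "'a set \<times> ('a \<Rightarrow> real^3)"
type_synonym 'a atlas = "'a chart set"

definition is_chart :: "'a::topological_space chart \<Rightarrow> bool" where
  "is_chart c \<longleftrightarrow> open (fst c) \<and> open (snd c ` fst c) \<and>
     homeomorphism (fst c) (snd c ` fst c) (snd c) (inv_into (fst c) (snd c))"

definition transition :: "'a chart \<Rightarrow> 'a chart \<Rightarrow> real^3 \<Rightarrow> real^3" where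
  "transition c d = snd d \<circ> inv_into (fst c) (snd c)"

definition smooth_atlas :: "'a::topological_space atlas \<Rightarrow> bool" where
  "smooth_atlas A \<longleftrightarrow> (\<forall>c\<in>A. is_chart c) \<and> (\<Union>c\<in>A. fst c) = UNIV \<and>
     (\<forall>c\<in>A. \<forall>d\<in>A. smooth_on (snd c ` (fst c \<inter> fst d)) (transition c d))"

definition orientable :: "'a::topological_space atlas \<Rightarrow> bool" where
  "orientable A \<longleftrightarrow> (\<exists>B. smooth_atlas B \<and> smooth_atlas (A \<union> B) \<and>
     (\<forall>c\<in>B. \<forall>d\<in>B. \<forall>x\<in>snd c ` (fst c \<inter> fst d).
        det (matrix (frechet_derivative (transition c d) (at x))) > 0))"

definition smooth_function :: "'a atlas \<Rightarrow> ('a \<Rightarrow> real) \<Rightarrow> bool" where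
  "smooth_function A f \<longleftrightarrow>
     (\<forall>c\<in>A. smooth_on (snd c ` fst c) (f \<circ> inv_into (fst c) (snd c)))"


section \<open>Tangent vectors, vector fields, 1-forms and metrics\<close>

text \<open>The tangent space at every point \<open>p\<close> is the vector space \<open>\<real>\<^sup>3\<close>, identified
  with the geometric tangent space by means of one chart around \<open>p\<close>, chosen once and for all.
  This choice is discontinuous in \<open>p\<close>: continuity and smoothness of vector
  fields, forms and metrics only make sense after passing to the coordinates of a fixed chart.\<close>

definition chart_at :: "'a atlas \<Rightarrow> 'a \<Rightarrow> 'a chart" where
  "chart_at A p = (SOME c. c \<in> A \<and> p \<in> fst c)"

definition to_chart :: "'a atlas \<Rightarrow> 'a chart \<Rightarrow> 'a \<Rightarrow> real^3 \<Rightarrow> real^3" where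
  "to_chart A c p = frechet_derivative (transition (chart_at A p) c) (at (snd (chart_at A p) p))"

definition from_chart :: "'a atlas \<Rightarrow> 'a chart \<Rightarrow> 'a \<Rightarrow> real^3 \<Rightarrow> real^3" where
  "from_chart A c p = frechet_derivative (transition c (chart_at A p)) (at (snd c p))"

definition field_in_chart :: "'a atlas \<Rightarrow> 'a chart \<Rightarrow> ('a \<Rightarrow> real^3) \<Rightarrow> real^3 \<Rightarrow> real^3" where
  "field_in_chart A c X x = (let p = inv_into (fst c) (snd c) x in to_chart A c p (X p))"

definition smooth_field_on :: "'a atlas \<Rightarrow> 'a set \<Rightarrow> ('a \<Rightarrow> real^3) \<Rightarrow> bool" where
  "smooth_field_on A W X \<longleftrightarrow>
     (\<forall>c\<in>A. smooth_on (snd c ` (fst c \<inter> W)) (field_in_chart A c X))"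

definition lie_bracket ::
    "'a atlas \<Rightarrow> ('a \<Rightarrow> real^3) \<Rightarrow> ('a \<Rightarrow> real^3) \<Rightarrow> 'a \<Rightarrow> real^3" where
  "lie_bracket A X Y p = (let c = chart_at A p in
     bracket (field_in_chart A c X) (field_in_chart A c Y) (snd c p))"

definition smooth_1form :: "'a atlas \<Rightarrow> ('a \<Rightarrow> real^3 \<Rightarrow> real) \<Rightarrow> bool" where
  "smooth_1form A \<alpha> \<longleftrightarrow> (\<forall>p. linear (\<alpha> p)) \<and>
     (\<forall>c\<in>A. \<forall>u. smooth_on (snd c ` fst c)
        (\<lambda>x. let p = inv_into (fst c) (snd c) x in \<alpha> p (from_chart A c p u)))"

definition metric_in_chart ::
    "'a atlas \<Rightarrow> 'a chart \<Rightarrow> ('a \<Rightarrow> real^3 \<Rightarrow> real^3 \<Rightarrow> real) \<Rightarrow> real^3 \<Rightarrow> real^3 \<Rightarrow> real^3 \<Rightarrow> real" where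
  "metric_in_chart A c g x u v = (let p = inv_into (fst c) (snd c) x in
     g p (from_chart A c p u) (from_chart A c p v))"

definition riemannian_metric :: "'a atlas \<Rightarrow> ('a \<Rightarrow> real^3 \<Rightarrow> real^3 \<Rightarrow> real) \<Rightarrow> bool" where
  "riemannian_metric A g \<longleftrightarrow> (\<forall>p. inner_product (g p)) \<and>
     (\<forall>c\<in>A. \<forall>u v. smooth_on (snd c ` fst c) (\<lambda>x. metric_in_chart A c g x u v))"


section \<open>Plane distributions\<close>

definition basis_of_plane :: "(real^3) set \<Rightarrow> real^3 \<Rightarrow> real^3 \<Rightarrow> bool" where
  "basis_of_plane P u v \<longleftrightarrow> u \<noteq> v \<and> independent {u, v} \<and> span {u, v} = P"

definition plane_distribution ::
    "'a::topological_space atlas \<Rightarrow> ('a \<Rightarrow> (real^3) set) \<Rightarrow> bool" where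
  "plane_distribution A \<xi> \<longleftrightarrow> (\<forall>p. subspace (\<xi> p) \<and> dim (\<xi> p) = 2) \<and>
     (\<forall>p. \<exists>W S T. open W \<and> p \<in> W \<and> smooth_field_on A W S \<and> smooth_field_on A W T \<and>
        (\<forall>q\<in>W. basis_of_plane (\<xi> q) (S q) (T q)))"

definition section_on ::
    "'a::topological_space atlas \<Rightarrow> ('a \<Rightarrow> (real^3) set) \<Rightarrow> 'a set \<Rightarrow> ('a \<Rightarrow> real^3) \<Rightarrow> bool" where
  "section_on A \<xi> W S \<longleftrightarrow> smooth_field_on A W S \<and> (\<forall>q\<in>W. S q \<in> \<xi> q)"

definition contact_structure ::
    "'a::topological_space atlas \<Rightarrow> ('a \<Rightarrow> (real^3) set) \<Rightarrow> bool" where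
  "contact_structure A \<xi> \<longleftrightarrow> plane_distribution A \<xi> \<and>
     (\<forall>W S T. open W \<longrightarrow> section_on A \<xi> W S \<longrightarrow> section_on A \<xi> W T \<longrightarrow>
        (\<forall>q\<in>W. S q \<noteq> T q \<and> independent {S q, T q}) \<longrightarrow>
        (\<forall>p\<in>W. lie_bracket A S T p \<notin> \<xi> p))"

definition transversally_orientable :: "'a atlas \<Rightarrow> ('a \<Rightarrow> (real^3) set) \<Rightarrow> bool" where
  "transversally_orientable A \<xi> \<longleftrightarrow>
     (\<exists>\<alpha>. smooth_1form A \<alpha> \<and> (\<forall>p. \<xi> p = {v. \<alpha> p v = 0}))"

definition transverse :: "('a \<Rightarrow> (real^3) set) \<Rightarrow> ('a \<Rightarrow> (real^3) set) \<Rightarrow> bool" where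
  "transverse \<xi> \<eta> \<longleftrightarrow> (\<forall>p. \<xi> p \<noteq> \<eta> p)"

text \<open>The coordinates given by \<open>chart_at A p\<close> identify the tangent space at \<open>p\<close> with
  itself identically, so vectors of \<open>\<xi> p\<close> need no conversion. The value does not depend on the basis.\<close>

definition sectional_curvature ::
    "'a atlas \<Rightarrow> ('a \<Rightarrow> real^3 \<Rightarrow> real^3 \<Rightarrow> real) \<Rightarrow> ('a \<Rightarrow> (real^3) set) \<Rightarrow> 'a \<Rightarrow> real" where
  "sectional_curvature A g \<xi> p = (let c = chart_at A p in
     THE k. \<forall>u v. basis_of_plane (\<xi> p) u v \<longrightarrow>
       k = sec_curv (metric_in_chart A c g) (snd c p) u v)"


section \<open>The connection is the Levi-Civita connection\<close>

lemma inner_product_riesz: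
  fixes B :: "'e::euclidean_space \<Rightarrow> 'e \<Rightarrow> real"
  assumes B: "inner_product B" and L: "linear L"
  shows "\<exists>!w. \<forall>z. B w z = L z"
proof -
  have bil: "bilinear B" and pos: "\<And>v. v \<noteq> 0 \<Longrightarrow> B v v > 0"
    using B by (auto simp: inner_product_def)
  have lin1: "linear (\<lambda>w. B w z)" and lin2: "linear (B w)" for w z
    using bil by (auto simp: bilinear_def)
  define F where "F w = (\<Sum>b\<in>Basis. B w b *\<^sub>R b)" for w
  have F: "F w \<bullet> z = B w z" for w z
  proof -
    have "B w z = B w (\<Sum>b\<in>Basis. (z \<bullet> b) *\<^sub>R b)"
      by (simp add: euclidean_representation)
    also have "\<dots> = (\<Sum>b\<in>Basis. (z \<bullet> b) * B w b)"
      by (simp add: linear_sum[OF lin2] linear_scale[OF lin2])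
    finally show ?thesis
      by (simp add: F_def inner_sum_left inner_commute[of z] mult.commute)
  qed
  have linF: "linear F"
    unfolding F_def
    by (intro linear_compose_sum ballI linearI)
      (auto simp: linear_add[OF lin1] linear_scale[OF lin1] algebra_simps)
  have "inj F"
    unfolding linear_injective_0[OF linF]
  proof (intro allI impI)
    fix w assume "F w = 0"
    then have "B w w = 0" using F[of w w] by simp
    then show "w = 0" using pos[of w] by force
  qed
  have "surj F"
    by (rule linear_injective_imp_surjective[OF linF \<open>inj F\<close>]) (rule refl)
  define l where "l = (\<Sum>b\<in>Basis. L b *\<^sub>R b)"
  have l: "l \<bullet> z = L z" for z
  proof -
    have "L z = L (\<Sum>b\<in>Basis. (z \<bullet> b) *\<^sub>R b)"
      by (simp add: euclidean_representation)
    also have "\<dots> = (\<Sum>b\<in>Basis. (z \<bullet> b) * L b)"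
      by (simp add: linear_sum[OF L] linear_scale[OF L])
    finally show ?thesis
      by (simp add: l_def inner_sum_left inner_commute[of z] mult.commute)
  qed
  obtain w where w: "F w = l" using \<open>surj F\<close> by (metis surjD)
  show ?thesis
  proof (rule ex1I[of _ w])
    show "\<forall>z. B w z = L z" using F w l by metis
    fix w' assume "\<forall>z. B w' z = L z"
    then have "F w' \<bullet> z = F w \<bullet> z" for z using F w l by metis
    then have "F w' = F w" by (metis vector_eq_rdot)
    then show "w' = w" using \<open>inj F\<close> by (simp add: inj_eq)
  qed
qed

context
  fixes G :: "'e::euclidean_space \<Rightarrow> 'e \<Rightarrow> 'e \<Rightarrow> real" and V :: "'e set" and x :: 'e
  assumes V: "open V" "x \<in> V"
    and G: "\<And>y. y \<in> V \<Longrightarrow> inner_product (G y)"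
    and diff: "\<And>u v. (\<lambda>y. G y u v) differentiable at x"
begin

lemma metric_sym: "y \<in> V \<Longrightarrow> G y u v = G y v u"
  using G by (auto simp: inner_product_def)

lemma metric_deriv:
  "((\<lambda>y. G y u v) has_derivative frechet_derivative (\<lambda>y. G y u v) (at x)) (at x)"
  using diff frechet_derivative_works by blast

lemma metric_deriv_unique:
  assumes "(F has_derivative F') (at x)" "\<And>y. y \<in> V \<Longrightarrow> F y = G y u v"
  shows "frechet_derivative (\<lambda>y. G y u v) (at x) = F'"
  using has_derivative_transform_within_open[OF assms(1) V assms(2)]
  by (simp add: frechet_derivative_at[symmetric])

lemma metric_deriv_sym:
  "frechet_derivative (\<lambda>y. G y u v) (at x) = frechet_derivative (\<lambda>y. G y v u) (at x)"
  by (rule metric_deriv_unique[OF metric_deriv]) (rule metric_sym)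

lemma metric_deriv_linear:
  "linear (\<lambda>z. frechet_derivative (\<lambda>y. G y v z) (at x) u)"
proof (rule linearI)
  have lin: "linear (G y v)" if "y \<in> V" for y
    using G[OF that] by (simp add: inner_product_def bilinear_def)
  fix z z' and r :: real
  have "frechet_derivative (\<lambda>y. G y v (z + z')) (at x) =
      (\<lambda>u. frechet_derivative (\<lambda>y. G y v z) (at x) u + frechet_derivative (\<lambda>y. G y v z') (at x) u)"
    by (rule metric_deriv_unique[OF has_derivative_add[OF metric_deriv metric_deriv]])
      (simp add: linear_add[OF lin])
  then show "frechet_derivative (\<lambda>y. G y v (z + z')) (at x) u =
      frechet_derivative (\<lambda>y. G y v z) (at x) u + frechet_derivative (\<lambda>y. G y v z') (at x) u"
    by simp
  have "frechet_derivative (\<lambda>y. G y v (r *\<^sub>R z)) (at x) =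
      (\<lambda>u. r *\<^sub>R frechet_derivative (\<lambda>y. G y v z) (at x) u)"
    by (rule metric_deriv_unique[OF has_derivative_scaleR_right[OF metric_deriv]])
      (simp add: linear_scale[OF lin])
  then show "frechet_derivative (\<lambda>y. G y v (r *\<^sub>R z)) (at x) u =
      r *\<^sub>R frechet_derivative (\<lambda>y. G y v z) (at x) u"
    by simp
qed

lemma christoffel_eq:
  "2 * G x (christoffel G x u v) z =
       frechet_derivative (\<lambda>y. G y v z) (at x) u
     + frechet_derivative (\<lambda>y. G y u z) (at x) v
     - frechet_derivative (\<lambda>y. G y u v) (at x) z"
proof -
  let ?L = "\<lambda>z. frechet_derivative (\<lambda>y. G y v z) (at x) u
     + frechet_derivative (\<lambda>y. G y u z) (at x) v
     - frechet_derivative (\<lambda>y. G y u v) (at x) z"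
  have "linear (frechet_derivative (\<lambda>y. G y u v) (at x))"
    using metric_deriv has_derivative_linear by blast
  then have "linear ?L"
    by (intro linear_compose_sub linear_compose_add metric_deriv_linear)
  then have "linear (\<lambda>z. (1/2) *\<^sub>R ?L z)"
    by (rule linear_compose_scale_right)
  from inner_product_riesz[OF G[OF V(2)] this]
  have "\<exists>!w. \<forall>z. 2 * G x w z = ?L z" by (simp add: field_simps)
  from theI'[OF this] show ?thesis unfolding christoffel_def by blast
qed

lemma christoffel_sym: "christoffel G x u v = christoffel G x v u"
  unfolding christoffel_def
  by (simp add: metric_deriv_sym[of u v] add.commute)

lemma levi_civita_torsion_free:
  "levi_civita G X Y x - levi_civita G Y X x = bracket X Y x"
  by (simp add: levi_civita_def bracket_def christoffel_sym[of "X x"])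

lemma levi_civita_metric:
  assumes X: "X differentiable at x" and Y: "Y differentiable at x"
  shows "((\<lambda>y. G y (X y) (Y y)) has_derivative
    (\<lambda>u. G x (levi_civita G (\<lambda>_. u) X x) (Y x) + G x (X x) (levi_civita G (\<lambda>_. u) Y x))) (at x)"
proof -
  let ?D = "\<lambda>a b. frechet_derivative (\<lambda>y. G y a b) (at x)"
  let ?X = "frechet_derivative X (at x)" and ?Y = "frechet_derivative Y (at x)"
  have dX: "(X has_derivative ?X) (at x)" and dY: "(Y has_derivative ?Y) (at x)"
    using X Y frechet_derivative_works by blast+
  have lin1: "linear (\<lambda>w. G y w z)" and lin2: "linear (G y w)" if "y \<in> V" for y w z
    using G[OF that] by (auto simp: inner_product_def bilinear_def)
  have expand: "G y a b = (\<Sum>i\<in>Basis. \<Sum>j\<in>Basis. (a \<bullet> i) * ((b \<bullet> j) * G y i j))"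
    if "y \<in> V" for y a b
  proof -
    have "G y a b = G y (\<Sum>i\<in>Basis. (a \<bullet> i) *\<^sub>R i) (\<Sum>j\<in>Basis. (b \<bullet> j) *\<^sub>R j)"
      by (simp add: euclidean_representation)
    also have "\<dots> = (\<Sum>i\<in>Basis. (a \<bullet> i) * G y i (\<Sum>j\<in>Basis. (b \<bullet> j) *\<^sub>R j))"
      by (simp only: linear_sum[OF lin1[OF that]] linear_scale[OF lin1[OF that]] real_scaleR_def)
    also have "\<dots> = (\<Sum>i\<in>Basis. (a \<bullet> i) * (\<Sum>j\<in>Basis. (b \<bullet> j) * G y i j))"
      by (simp only: linear_sum[OF lin2[OF that]] linear_scale[OF lin2[OF that]] real_scaleR_def)
    finally show ?thesis by (simp add: sum_distrib_left)
  qed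
  have Dexpand: "?D a b u = (\<Sum>i\<in>Basis. \<Sum>j\<in>Basis. (a \<bullet> i) * ((b \<bullet> j) * ?D i j u))" for a b u
  proof -
    have "?D a b = (\<lambda>u. \<Sum>i\<in>Basis. \<Sum>j\<in>Basis. (a \<bullet> i) * ((b \<bullet> j) * ?D i j u))"
      by (rule metric_deriv_unique[where F = "\<lambda>y. \<Sum>i\<in>Basis. \<Sum>j\<in>Basis. (a \<bullet> i) * ((b \<bullet> j) * G y i j)"])
        (auto intro!: has_derivative_sum has_derivative_mult_right metric_deriv simp: expand)
    then show ?thesis by simp
  qed
  have "((\<lambda>y. \<Sum>i\<in>Basis. \<Sum>j\<in>Basis. (X y \<bullet> i) * ((Y y \<bullet> j) * G y i j)) has_derivative
     (\<lambda>u. \<Sum>i\<in>Basis. \<Sum>j\<in>Basis. (X x \<bullet> i) * ((Y x \<bullet> j) * ?D i j u + (?Y u \<bullet> j) * G x i j)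
        + (?X u \<bullet> i) * ((Y x \<bullet> j) * G x i j))) (at x)"
    by (intro has_derivative_sum has_derivative_mult has_derivative_inner_left dX dY metric_deriv)
  moreover have "(\<Sum>i\<in>Basis. \<Sum>j\<in>Basis. (X x \<bullet> i) * ((Y x \<bullet> j) * ?D i j u + (?Y u \<bullet> j) * G x i j)
        + (?X u \<bullet> i) * ((Y x \<bullet> j) * G x i j)) =
      ?D (X x) (Y x) u + G x (X x) (?Y u) + G x (?X u) (Y x)" for u
    unfolding Dexpand[of "X x"] expand[OF V(2), of "X x"] expand[OF V(2), of "?X u"]
    by (simp add: sum.distrib algebra_simps)
  moreover have "?D (X x) (Y x) u + G x (X x) (?Y u) + G x (?X u) (Y x) =
      G x (levi_civita G (\<lambda>_. u) X x) (Y x) + G x (X x) (levi_civita G (\<lambda>_. u) Y x)" for u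
  proof -
    have "2 * (G x (christoffel G x u (X x)) (Y x) + G x (christoffel G x u (Y x)) (X x))
        = 2 * ?D (X x) (Y x) u"
      unfolding distrib_left christoffel_eq
      using metric_deriv_sym[of "X x" "Y x"] by simp
    then show ?thesis
      using metric_sym[OF V(2), of "christoffel G x u (Y x)" "X x"]
      by (simp add: levi_civita_def linear_add[OF lin1[OF V(2)]] linear_add[OF lin2[OF V(2)]])
  qed
  ultimately have
    "((\<lambda>y. \<Sum>i\<in>Basis. \<Sum>j\<in>Basis. (X y \<bullet> i) * ((Y y \<bullet> j) * G y i j)) has_derivative
    (\<lambda>u. G x (levi_civita G (\<lambda>_. u) X x) (Y x) + G x (X x) (levi_civita G (\<lambda>_. u) Y x))) (at x)"
    by simp
  then show ?thesis
    by (rule has_derivative_transform_within_open[OF _ V]) (simp add: expand)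
qed

end

end

theory Submission
  imports Defs
begin

text \<open>Near each point choose a frame with \<open>X \<in> \<xi> \<inter> \<eta>\<close>, \<open>Y \<in> \<xi>\<close>, \<open>Z \<in> \<eta>\<close> and let \<open>e, b, \<alpha>\<close> be
  the dual coframe, so that \<open>\<alpha>\<close> vanishes on \<open>\<xi>\<close> and \<open>b\<close> on \<open>\<eta>\<close>. For the metric
  \<open>e\<^sup>2 + b\<^sup>2/s\<^sup>2 + \<alpha>\<^sup>2/t\<^sup>2\<close>, with \<open>s\<close> a constant and \<open>t\<close> a positive function, Cartan's structure equations give
  \<open>K(\<xi>) = K\<^sub>0 + t\<^sup>2 Q - C/t\<^sup>2\<close>, where \<open>K\<^sub>0, Q, C\<close> depend on \<open>s\<close> but not on \<open>t\<close>,
  and no derivative of \<open>t\<close> occurs. Here \<open>C > 0\<close> because \<open>\<xi>\<close> is contact. The dominant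
  term of \<open>Q\<close> as \<open>s\<close> tends to \<open>0\<close> is \<open>db(X,Z)\<^sup>2/(4 s\<^sup>2)\<close>, which is positive because \<open>\<eta>\<close> is contact, so by
  compactness \<open>Q > 0\<close> for some \<open>s\<close>. Then \<open>K(\<xi>) = f\<close> is a quadratic equation for \<open>t\<^sup>2\<close> with exactly one
  positive root, which depends smoothly on the point.\<close>

section \<open>Calculus of smooth maps\<close>

text \<open>The line field \<xi> \<inter> \<eta> need not be orientable, so in general there is no
  global frame, and every global object has to be insensitive to the choice of local ones. The
  metric contains only squares of the dual forms. The coefficients \<open>Q\<close> and
  \<open>C\<close> are recovered, as global smooth functions, from the curvatures of the three
  metrics with t = 1, 2, 1/2. A derivative of t could enter only through the exterior derivative of
  the third form on a pair of frame vectors that includes the third one, and the curvature of the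
  plane of the first two contains no such term. A variable s, by contrast, would leave derivatives
  behind; hence s is a constant, and compactness has to supply a uniform one. Sectional curvature is
  defined in a chart that jumps from point to point. That the chart does not matter is derived from
  the fact that exterior differentiation commutes with pullbacks: Cartan's formula is made of
  structure functions and their derivatives along frame vectors.\<close>

lemma Ck_on_cong:
  assumes "open S" "\<And>x. x \<in> S \<Longrightarrow> f x = g x" "Ck_on k S f"
  shows "Ck_on k S g"
  using assms(2,3)
proof (induction k arbitrary: f g)
  case 0
  then show ?case by (simp cong: continuous_on_cong)
next
  case (Suc k)
  have fg: "frechet_derivative g (at x) = frechet_derivative f (at x)" if "x \<in> S" "f differentiable at x" for x
    using frechet_derivative_transform_within_open[OF that(2) assms(1) that(1)] Suc.prems(1) by metis
  have "g differentiable at x" if "x \<in> S" for x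
  proof -
    have "(f has_derivative frechet_derivative f (at x)) (at x)"
      using Suc.prems(2) that frechet_derivative_works by auto
    from has_derivative_transform_within_open[OF this assms(1) that]
    have "(g has_derivative frechet_derivative f (at x)) (at x)" using Suc.prems(1) by blast
    then show ?thesis using differentiable_def by blast
  qed
  moreover have "Ck_on k S (\<lambda>x. frechet_derivative g (at x) v)" for v
    by (rule Suc.IH[where f = "\<lambda>x. frechet_derivative f (at x) v"]) (use Suc.prems fg in auto)
  ultimately show ?case by simp
qed

lemma Ck_on_subset: "Ck_on k S f \<Longrightarrow> T \<subseteq> S \<Longrightarrow> Ck_on k T f"
  by (induction k arbitrary: f) (auto intro: continuous_on_subset)

lemma Ck_on_Suc_imp_continuous_on: "Ck_on (Suc k) S f \<Longrightarrow> continuous_on S f"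
  by (metis Ck_on.simps(2) continuous_at_imp_continuous_on differentiable_imp_continuous_within)

lemma Ck_on_Suc_imp_Ck_on: "Ck_on (Suc k) S f \<Longrightarrow> Ck_on k S f"
proof (induction k arbitrary: f)
  case 0
  then show ?case unfolding Ck_on.simps(1) by (rule Ck_on_Suc_imp_continuous_on)
next
  case (Suc k)
  then show ?case by (subst Ck_on.simps(2)) auto
qed

lemma Ck_on_local:
  assumes "\<And>x. x \<in> S \<Longrightarrow> \<exists>U. open U \<and> x \<in> U \<and> Ck_on k U f"
  shows "Ck_on k S f"
  using assms
proof (induction k arbitrary: f)
  case 0
  then show ?case
    by (metis Ck_on.simps(1) continuous_at_imp_continuous_on continuous_on_eq_continuous_at)
next
  case (Suc k)
  have "\<exists>U. open U \<and> x \<in> U \<and> Ck_on k U (\<lambda>x. frechet_derivative f (at x) v)" if "x \<in> S" for x v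
    using Suc.prems[OF that] by auto
  then show ?case using Suc by fastforce
qed

text \<open>Inductions on the order can thus use whatever derivative the differentiation rules
  produce, without first identifying it with \<open>frechet_derivative\<close>.\<close>

lemma Ck_on_SucI:
  assumes "open S" "\<And>x. x \<in> S \<Longrightarrow> (f has_derivative D x) (at x)"
    "\<And>v. Ck_on k S (\<lambda>x. D x v)"
  shows "Ck_on (Suc k) S f"
proof -
  have "frechet_derivative f (at x) = D x" if "x \<in> S" for x
    using assms(2)[OF that] frechet_derivative_at by metis
  then have "Ck_on k S (\<lambda>x. frechet_derivative f (at x) v)" for v
    by (intro Ck_on_cong[OF assms(1) _ assms(3)[of v]]) simp
  then show ?thesis using assms(2) by (auto simp: differentiable_def)
qed

lemma Ck_on_SucD:
  "Ck_on (Suc k) S f \<Longrightarrow> x \<in> S \<Longrightarrow> (f has_derivative frechet_derivative f (at x)) (at x)"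
  "Ck_on (Suc k) S f \<Longrightarrow> Ck_on k S (\<lambda>x. frechet_derivative f (at x) v)"
  using frechet_derivative_works by auto

lemma Ck_on_const: "open S \<Longrightarrow> Ck_on k S (\<lambda>x. c)"
  by (induction k arbitrary: c) auto

lemma Ck_on_add:
  assumes "open S" "Ck_on k S f" "Ck_on k S g"
  shows "Ck_on k S (\<lambda>x. f x + g x)"
  using assms(2,3)
proof (induction k arbitrary: f g)
  case (Suc k)
  show ?case
    by (rule Ck_on_SucI[OF assms(1) has_derivative_add[OF Ck_on_SucD(1)[OF Suc.prems(1)] Ck_on_SucD(1)[OF Suc.prems(2)]]])
      (assumption | intro Suc.IH Ck_on_SucD(2)[OF Suc.prems(1)] Ck_on_SucD(2)[OF Suc.prems(2)])+
qed (simp add: continuous_on_add)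

text \<open>The product rule gives two terms of the same bilinear shape, each with one
  undifferentiated factor, whose order is lowered by \<open>Ck_on_Suc_imp_Ck_on\<close>.
  Multiplication, scaling, inner and cross products are instances.\<close>

lemma Ck_on_bounded_bilinear:
  assumes B: "bounded_bilinear B" and S: "open S" and "Ck_on k S f" "Ck_on k S g"
  shows "Ck_on k S (\<lambda>x. B (f x) (g x))"
  using assms(3,4)
proof (induction k arbitrary: f g)
  case 0
  then show ?case using bounded_bilinear.continuous_on[OF B] by auto
next
  case (Suc k)
  show ?case
    by (rule Ck_on_SucI[OF S bounded_bilinear.FDERIV[OF B Ck_on_SucD(1)[OF Suc.prems(1)] Ck_on_SucD(1)[OF Suc.prems(2)]]])
      (assumption | intro Ck_on_add[OF S] Suc.IH Ck_on_SucD(2)[OF Suc.prems(1)] Ck_on_SucD(2)[OF Suc.prems(2)]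
        Ck_on_Suc_imp_Ck_on[OF Suc.prems(1)] Ck_on_Suc_imp_Ck_on[OF Suc.prems(2)])+
qed

lemma Ck_on_sum:
  assumes "open S" "\<And>i. i \<in> I \<Longrightarrow> Ck_on k S (f i)"
  shows "Ck_on k S (\<lambda>x. \<Sum>i\<in>I. f i x)"
  using assms(2)
  by (induction I rule: infinite_finite_induct) (auto intro: Ck_on_const Ck_on_add assms(1))

lemma frechet_derivative_expand:
  assumes "g differentiable at x"
  shows "frechet_derivative g (at x) v = (\<Sum>b\<in>Basis. (v \<bullet> b) *\<^sub>R frechet_derivative g (at x) b)"
proof -
  have l: "linear (frechet_derivative g (at x))"
    using assms linear_frechet_derivative by blast
  have "frechet_derivative g (at x) v = frechet_derivative g (at x) (\<Sum>b\<in>Basis. (v \<bullet> b) *\<^sub>R b)"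
    by (simp add: euclidean_representation)
  then show ?thesis by (simp add: linear_sum[OF l] linear_scale[OF l])
qed

lemma Ck_on_compose:
  fixes f :: "'a::euclidean_space \<Rightarrow> 'b::euclidean_space" and g :: "'b \<Rightarrow> 'c::real_normed_vector"
  assumes S: "open S" and "Ck_on k S f" "Ck_on k T g" "f ` S \<subseteq> T"
  shows "Ck_on k S (\<lambda>x. g (f x))"
  using assms(2-4)
proof (induction k arbitrary: g)
  case 0
  then show ?case using continuous_on_compose2 by auto
next
  case (Suc k)
  let ?f = "\<lambda>x. frechet_derivative f (at x)" and ?g = "\<lambda>y. frechet_derivative g (at y)"
  have d: "((\<lambda>x. g (f x)) has_derivative (\<lambda>v. ?g (f x) (?f x v))) (at x)" if "x \<in> S" for x
    using has_derivative_compose[OF Ck_on_SucD(1)[OF Suc.prems(1) that], of g] Ck_on_SucD(1)[OF Suc.prems(2)]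
      that Suc.prems(3) by (auto simp: o_def)
  \<comment> \<open>The direction \<open>?f x v\<close> moves with \<open>x\<close>, while the
    induction hypothesis concerns derivatives of \<open>g\<close> in fixed directions; hence the
    expansion in the basis.\<close>
  have c: "Ck_on k S (\<lambda>x. \<Sum>b\<in>Basis. (?f x v \<bullet> b) *\<^sub>R ?g (f x) b)" for v
    by (intro Ck_on_sum Ck_on_bounded_bilinear[OF bounded_bilinear_scaleR]
          Ck_on_bounded_bilinear[OF bounded_bilinear_inner] Ck_on_const S
          Suc.IH Ck_on_SucD(2)[OF Suc.prems(1)] Ck_on_SucD(2)[OF Suc.prems(2)]
          Ck_on_Suc_imp_Ck_on[OF Suc.prems(1)] Suc.prems(3))
  have e: "(\<Sum>b\<in>Basis. (?f x v \<bullet> b) *\<^sub>R ?g (f x) b) = ?g (f x) (?f x v)" if "x \<in> S" for x v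
    using Suc.prems(2,3) that by (subst frechet_derivative_expand[symmetric]) auto
  have "Ck_on k S (\<lambda>x. ?g (f x) (?f x v))" for v
    by (rule Ck_on_cong[OF S e c])
  with S d show ?case by (rule Ck_on_SucI)
qed

lemma smooth_on_open: "smooth_on S f \<Longrightarrow> open S"
  by (simp add: smooth_on_def)

lemma smooth_on_cong: "smooth_on S f \<Longrightarrow> (\<And>x. x \<in> S \<Longrightarrow> f x = g x) \<Longrightarrow> smooth_on S g"
  unfolding smooth_on_def using Ck_on_cong by blast

lemma smooth_on_subset: "smooth_on S f \<Longrightarrow> open T \<Longrightarrow> T \<subseteq> S \<Longrightarrow> smooth_on T f"
  unfolding smooth_on_def using Ck_on_subset by blast

lemma smooth_on_local:
  assumes "\<And>x. x \<in> S \<Longrightarrow> \<exists>U. x \<in> U \<and> U \<subseteq> S \<and> smooth_on U f"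
  shows "smooth_on S f"
  unfolding smooth_on_def
proof (intro conjI allI)
  show "open S" using assms unfolding smooth_on_def by (subst open_subopen) blast
  show "Ck_on k S f" for k
  proof (rule Ck_on_local)
    fix x assume "x \<in> S"
    then obtain U where "x \<in> U" "smooth_on U f" using assms by auto
    then show "\<exists>U. open U \<and> x \<in> U \<and> Ck_on k U f" unfolding smooth_on_def by auto
  qed
qed

lemma smooth_on_differentiable: "smooth_on S f \<Longrightarrow> x \<in> S \<Longrightarrow> f differentiable at x"
  unfolding smooth_on_def by (metis Ck_on.simps(2))

lemma smooth_on_has_derivative:
  "smooth_on S f \<Longrightarrow> x \<in> S \<Longrightarrow> (f has_derivative frechet_derivative f (at x)) (at x)"
  using smooth_on_differentiable frechet_derivative_works by blast

lemma smooth_on_continuous_on: "smooth_on S f \<Longrightarrow> continuous_on S f"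
  unfolding smooth_on_def by (metis Ck_on.simps(1))

lemma smooth_on_const: "open S \<Longrightarrow> smooth_on S (\<lambda>x. c)"
  by (simp add: smooth_on_def Ck_on_const)

lemma smooth_on_bounded_bilinear:
  "bounded_bilinear B \<Longrightarrow> smooth_on S f \<Longrightarrow> smooth_on S g \<Longrightarrow> smooth_on S (\<lambda>x. B (f x) (g x))"
  by (simp add: smooth_on_def Ck_on_bounded_bilinear)

lemmas smooth_on_mult = smooth_on_bounded_bilinear[OF bounded_bilinear_mult]
  and smooth_on_scaleR = smooth_on_bounded_bilinear[OF bounded_bilinear_scaleR]
  and smooth_on_inner = smooth_on_bounded_bilinear[OF bounded_bilinear_inner]

lemma smooth_on_add: "smooth_on S f \<Longrightarrow> smooth_on S g \<Longrightarrow> smooth_on S (\<lambda>x. f x + g x)"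
  by (simp add: smooth_on_def Ck_on_add)

lemma smooth_on_sum:
  "open S \<Longrightarrow> (\<And>i. i \<in> I \<Longrightarrow> smooth_on S (f i)) \<Longrightarrow> smooth_on S (\<lambda>x. \<Sum>i\<in>I. f i x)"
  by (simp add: smooth_on_def Ck_on_sum)

lemma smooth_on_compose:
  fixes f :: "'a::euclidean_space \<Rightarrow> 'b::euclidean_space" and g :: "'b \<Rightarrow> 'c::real_normed_vector"
  shows "smooth_on S f \<Longrightarrow> smooth_on T g \<Longrightarrow> f ` S \<subseteq> T \<Longrightarrow> smooth_on S (\<lambda>x. g (f x))"
  unfolding smooth_on_def using Ck_on_compose by blast

lemma smooth_on_uminus:
  fixes f :: "'a::euclidean_space \<Rightarrow> 'b::real_normed_vector"
  assumes "smooth_on S f" shows "smooth_on S (\<lambda>x. - f x)"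
  using smooth_on_scaleR[OF smooth_on_const[OF smooth_on_open[OF assms], of "-1"] assms] by simp

lemma smooth_on_diff:
  fixes f :: "'a::euclidean_space \<Rightarrow> 'b::real_normed_vector"
  shows "smooth_on S f \<Longrightarrow> smooth_on S g \<Longrightarrow> smooth_on S (\<lambda>x. f x - g x)"
  using smooth_on_add[OF _ smooth_on_uminus] by fastforce

lemma smooth_on_frechet_derivative_const:
  "smooth_on S f \<Longrightarrow> smooth_on S (\<lambda>x. frechet_derivative f (at x) v)"
  unfolding smooth_on_def by (metis Ck_on.simps(2))

lemma smooth_on_frechet_derivative:
  assumes "smooth_on S f" "smooth_on S v"
  shows "smooth_on S (\<lambda>x. frechet_derivative f (at x) (v x))"
proof (rule smooth_on_cong)
  show "smooth_on S (\<lambda>x. \<Sum>b\<in>Basis. (v x \<bullet> b) *\<^sub>R frechet_derivative f (at x) b)"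
    using assms by (intro smooth_on_sum smooth_on_scaleR smooth_on_inner smooth_on_const
      smooth_on_frechet_derivative_const) (auto simp: smooth_on_open)
qed (subst frechet_derivative_expand[OF smooth_on_differentiable[OF assms(1)]], simp_all)

lemma smooth_on_fderiv:
  assumes "smooth_on T f" "smooth_on S g" "smooth_on S v" "g ` S \<subseteq> T"
  shows "smooth_on S (\<lambda>x. frechet_derivative f (at (g x)) (v x))"
proof (rule smooth_on_cong)
  show "smooth_on S (\<lambda>x. \<Sum>b\<in>Basis. (v x \<bullet> b) *\<^sub>R frechet_derivative f (at (g x)) b)"
    using assms by (intro smooth_on_sum smooth_on_scaleR smooth_on_inner smooth_on_const
      smooth_on_compose[OF assms(2)] smooth_on_frechet_derivative_const) (auto simp: smooth_on_open)
qed (use assms(4) in \<open>subst frechet_derivative_expand[OF smooth_on_differentiable[OF assms(1)]], auto\<close>)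

text \<open>The derivative of \<open>inverse\<close> is a product of constants and copies of
  \<open>inverse\<close>, so the induction closes on itself.\<close>

lemma smooth_on_inverse_real: "smooth_on {x::real. x \<noteq> 0} inverse"
proof -
  have o: "open {x::real. x \<noteq> 0}" by (simp add: open_Collect_neq)
  have "Ck_on k {x::real. x \<noteq> 0} inverse" for k
  proof (induction k)
    case 0
    then show ?case by (auto intro!: continuous_on_inverse)
  next
    case (Suc k)
    show ?case
    proof (rule Ck_on_SucI[OF o])
      show "(inverse has_derivative (\<lambda>v. (-1) * (inverse x * (v * inverse x)))) (at x)"
        if "x \<in> {x::real. x \<noteq> 0}" for x
        using has_derivative_inverse'[of x UNIV] that by (simp add: mult.assoc)
      show "Ck_on k {x::real. x \<noteq> 0} (\<lambda>x. (-1) * (inverse x * (v * inverse x)))" for v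
        by (intro Ck_on_bounded_bilinear[OF bounded_bilinear_mult] Ck_on_const o Suc)
    qed
  qed
  then show ?thesis using o by (simp add: smooth_on_def)
qed

lemma smooth_on_inverse:
  fixes f :: "'a::euclidean_space \<Rightarrow> real"
  assumes "smooth_on S f" "\<And>x. x \<in> S \<Longrightarrow> f x \<noteq> 0"
  shows "smooth_on S (\<lambda>x. inverse (f x))"
  by (rule smooth_on_compose[OF assms(1) smooth_on_inverse_real]) (use assms(2) in auto)

lemma smooth_on_divide:
  fixes f :: "'a::euclidean_space \<Rightarrow> real"
  assumes "smooth_on S f" "smooth_on S g" "\<And>x. x \<in> S \<Longrightarrow> g x \<noteq> 0"
  shows "smooth_on S (\<lambda>x. f x / g x)"
  using smooth_on_mult[OF assms(1) smooth_on_inverse[OF assms(2,3)]] by (simp add: divide_inverse)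

lemma smooth_on_sqrt_real: "smooth_on {0::real<..} sqrt"
proof -
  have o: "open {0::real<..}" by simp
  have "Ck_on k {0::real<..} sqrt" for k
  proof (induction k)
    case 0
    then show ?case by (auto intro!: continuous_on_real_sqrt)
  next
    case (Suc k)
    show ?case
    proof (rule Ck_on_SucI[OF o])
      show "(sqrt has_derivative (\<lambda>v. (v / 2) * inverse (sqrt x))) (at x)"
        if "x \<in> {0<..}" for x
        using DERIV_real_sqrt[of x] that
        by (auto simp: has_field_derivative_def field_simps elim!: has_derivative_eq_rhs)
      have "Ck_on k {0::real<..} (\<lambda>x. inverse (sqrt x))"
        using smooth_on_inverse_real[unfolded smooth_on_def]
        by (intro Ck_on_compose[OF o Suc, where T = "{x. x \<noteq> 0}"]) auto
      then show "Ck_on k {0::real<..} (\<lambda>x. (v / 2) * inverse (sqrt x))" for v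
        by (intro Ck_on_bounded_bilinear[OF bounded_bilinear_mult] Ck_on_const o)
    qed
  qed
  then show ?thesis using o by (simp add: smooth_on_def)
qed

lemma smooth_on_sqrt:
  fixes f :: "'a::euclidean_space \<Rightarrow> real"
  assumes "smooth_on S f" "\<And>x. x \<in> S \<Longrightarrow> f x > 0"
  shows "smooth_on S (\<lambda>x. sqrt (f x))"
  by (rule smooth_on_compose[OF assms(1) smooth_on_sqrt_real]) (use assms(2) in auto)

lemma smooth_on_cross3:
  "smooth_on S f \<Longrightarrow> smooth_on S g \<Longrightarrow> smooth_on S (\<lambda>x. cross3 (f x) (g x))"
  by (rule smooth_on_bounded_bilinear) (simp add: bilinear_conv_bounded_bilinear[symmetric] bilinear_cross)

section \<open>A smooth function that is positive exactly on the positive half-line\<close>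

definition bump :: "real \<Rightarrow> real" where
  "bump x = (if x \<le> 0 then 0 else exp (- inverse x))"

text \<open>With y = 1/x this is the decay of a polynomial times \<open>exp (- y)\<close> at
  infinity.\<close>

lemma poly_times_bump_tendsto_0:
  fixes p :: "real poly"
  shows "((\<lambda>x. poly p (inverse x) * exp (- inverse x)) \<longlongrightarrow> 0) (at_right 0)"
proof -
  have "((\<lambda>y. poly p y * exp (- y)) \<longlongrightarrow> 0) at_top"
  proof -
    have "((\<lambda>y. \<Sum>i\<le>degree p. coeff p i * (y ^ i * exp (- y))) \<longlongrightarrow> (\<Sum>i\<le>degree p. coeff p i * 0)) at_top"
      using tendsto_power_div_exp_0
      by (intro tendsto_sum tendsto_mult tendsto_const) (auto simp: exp_minus divide_inverse)
    then show ?thesis by (simp add: poly_altdef sum_distrib_right mult.assoc)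
  qed
  from filterlim_compose[OF this filterlim_inverse_at_top_right] show ?thesis .
qed

text \<open>Functions p(1/x) \<open>bump\<close> x are closed under differentiation: for y = 1/x one
  has dy/dx = -y^2, so p(y) exp(-y) has derivative y^2 (p(y) - p'(y)) exp(-y). At the origin both
  sides vanish.\<close>

lemma poly_times_bump_has_derivative:
  fixes p :: "real poly"
  defines "D \<equiv> \<lambda>p. [:0, 0, 1:] * (p - pderiv p)"
  shows "((\<lambda>x. poly p (inverse x) * bump x) has_real_derivative poly (D p) (inverse x) * bump x) (at x)"
proof -
  consider "x > 0" | "x < 0" | "x = 0" by linarith
  then show ?thesis
  proof cases
    case 1
    have "((\<lambda>x. poly p (inverse x) * exp (- inverse x)) has_real_derivative poly (D p) (inverse x) * bump x) (at x)"
      using 1 unfolding D_def bump_def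
      by (auto intro!: derivative_eq_intros DERIV_chain2[OF poly_DERIV] simp: field_simps)
    then show ?thesis
      by (rule has_field_derivative_transform_within_open[where S = "{0<..}"]) (use 1 in \<open>auto simp: bump_def\<close>)
  next
    case 2
    have "((\<lambda>x. 0) has_real_derivative poly (D p) (inverse x) * bump x) (at x)"
      using 2 by (simp add: bump_def)
    then show ?thesis
      by (rule has_field_derivative_transform_within_open[where S = "{..<0}"]) (use 2 in \<open>auto simp: bump_def\<close>)
  next
    case 3
    have "((\<lambda>y. poly p (inverse y) * bump y / y) \<longlongrightarrow> 0) (at 0)"
      unfolding filterlim_at_split
    proof
      show "((\<lambda>y. poly p (inverse y) * bump y / y) \<longlongrightarrow> 0) (at_left 0)"
        by (rule tendsto_eventually) (auto simp: eventually_at_filter bump_def)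
      show "((\<lambda>y. poly p (inverse y) * bump y / y) \<longlongrightarrow> 0) (at_right 0)"
        \<comment> \<open>Division by y is multiplication by 1/y, the variable of the polynomial,
          which is what \<open>pCons 0\<close> does.\<close>
        using poly_times_bump_tendsto_0[of "pCons 0 p"]
        by (rule Lim_transform_eventually) (auto simp: eventually_at_filter bump_def field_simps)
    qed
    then show ?thesis using 3 by (simp add: has_field_derivative_iff bump_def)
  qed
qed

text \<open>The induction runs over all polynomials at once, and the constant \<open>c\<close>
  absorbs the direction of differentiation. The case p = 1, c = 1 is \<open>bump\<close>.\<close>

lemma smooth_on_bump: "smooth_on UNIV bump"
proof -
  have "Ck_on k UNIV (\<lambda>x. c * (poly p (inverse x) * bump x))" for k p c
  proof (induction k arbitrary: p c)
    case 0
    have "isCont (\<lambda>x. c * (poly p (inverse x) * bump x)) x" for x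
      by (intro continuous_intros DERIV_isCont[OF poly_times_bump_has_derivative])
    then show ?case by (simp add: continuous_on_eq_continuous_at)
  next
    case (Suc k)
    have "((\<lambda>x. c * (poly p (inverse x) * bump x)) has_derivative
      (\<lambda>v. (c * v) * (poly ([:0, 0, 1:] * (p - pderiv p)) (inverse x) * bump x))) (at x)" for x
      using DERIV_cmult[OF poly_times_bump_has_derivative[of p x], of c]
      unfolding has_field_derivative_def by (rule has_derivative_eq_rhs) (simp add: fun_eq_iff)
    then show ?case by (rule Ck_on_SucI[OF open_UNIV]) (rule Suc)
  qed
  from this[of _ 1 "[:1:]"] show ?thesis by (simp add: smooth_on_def)
qed

lemma bump_pos: "bump x > 0 \<longleftrightarrow> x > 0" and bump_nonneg: "bump x \<ge> 0"
  by (auto simp: bump_def)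

section \<open>Symmetry of second derivatives\<close>

lemma second_difference_mean_value:
  fixes f :: "'a::euclidean_space \<Rightarrow> real"
  assumes f: "smooth_on S f" and h: "h > 0"
    and sub: "\<And>s t. 0 \<le> s \<Longrightarrow> s \<le> h \<Longrightarrow> 0 \<le> t \<Longrightarrow> t \<le> h \<Longrightarrow> x + s *\<^sub>R u + t *\<^sub>R v \<in> S"
  shows "\<exists>s t. 0 < s \<and> s < h \<and> 0 < t \<and> t < h \<and>
    f (x + h *\<^sub>R u + h *\<^sub>R v) - f (x + h *\<^sub>R u) - f (x + h *\<^sub>R v) + f x =
    h * h * frechet_derivative (\<lambda>y. frechet_derivative f (at y) u) (at (x + s *\<^sub>R u + t *\<^sub>R v)) v"
proof -
  let ?fu = "\<lambda>y. frechet_derivative f (at y) u"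
  have line: "((\<lambda>s. F (a + s *\<^sub>R w)) has_real_derivative frechet_derivative F (at (a + s *\<^sub>R w)) w) (at s)"
    if "smooth_on S F" "a + s *\<^sub>R w \<in> S" for F :: "'a \<Rightarrow> real" and a w s
  proof -
    have l: "linear (frechet_derivative F (at (a + s *\<^sub>R w)))"
      using smooth_on_differentiable[OF that] linear_frechet_derivative by blast
    have "((\<lambda>s. F (a + s *\<^sub>R w)) has_derivative (\<lambda>t. frechet_derivative F (at (a + s *\<^sub>R w)) (t *\<^sub>R w))) (at s)"
      by (rule has_derivative_compose[where f = "\<lambda>s. a + s *\<^sub>R w" and g = F, OF _ smooth_on_has_derivative[OF that]])
        (auto intro!: derivative_eq_intros)
    then show ?thesis unfolding has_field_derivative_def
      by (rule has_derivative_eq_rhs) (simp add: linear_scale[OF l] fun_eq_iff)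
  qed
  have fu: "smooth_on S ?fu" by (rule smooth_on_frechet_derivative_const[OF f])
  \<comment> \<open>The mean value theorem is applied in direction \<open>u\<close> to the
    difference of \<open>f\<close> and its translate by \<open>h *\<^sub>R v\<close>, and afterwards
    in direction \<open>v\<close> to the resulting difference of first derivatives.\<close>
  have "\<exists>s. 0 < s \<and> s < h \<and> (f ((x + h *\<^sub>R v) + h *\<^sub>R u) - f (x + h *\<^sub>R u)) - (f ((x + h *\<^sub>R v) + 0 *\<^sub>R u) - f (x + 0 *\<^sub>R u))
     = (h - 0) * (?fu ((x + h *\<^sub>R v) + s *\<^sub>R u) - ?fu (x + s *\<^sub>R u))"
    using sub[of _ h] sub[of _ 0] h
    by (intro MVT2 DERIV_diff line[OF f]) (auto simp: add_ac)
  then obtain s where s: "0 < s" "s < h" and es: "(f ((x + h *\<^sub>R v) + h *\<^sub>R u) - f (x + h *\<^sub>R u)) - (f ((x + h *\<^sub>R v)) - f x)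
     = h * (?fu ((x + h *\<^sub>R v) + s *\<^sub>R u) - ?fu (x + s *\<^sub>R u))" by auto
  have "\<exists>t. 0 < t \<and> t < h \<and> ?fu ((x + s *\<^sub>R u) + h *\<^sub>R v) - ?fu ((x + s *\<^sub>R u) + 0 *\<^sub>R v)
    = (h - 0) * frechet_derivative ?fu (at ((x + s *\<^sub>R u) + t *\<^sub>R v)) v"
    using sub[of s] h s
    by (intro MVT2 line[OF fu]) auto
  then obtain t where t: "0 < t" "t < h" and et: "?fu ((x + s *\<^sub>R u) + h *\<^sub>R v) - ?fu (x + s *\<^sub>R u)
    = h * frechet_derivative ?fu (at ((x + s *\<^sub>R u) + t *\<^sub>R v)) v" by auto
  have "x + h *\<^sub>R v + s *\<^sub>R u = x + s *\<^sub>R u + h *\<^sub>R v" "x + h *\<^sub>R v + h *\<^sub>R u = x + h *\<^sub>R u + h *\<^sub>R v"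
    by (simp_all add: add_ac)
  then have "f (x + h *\<^sub>R u + h *\<^sub>R v) - f (x + h *\<^sub>R u) - f (x + h *\<^sub>R v) + f x =
    h * h * frechet_derivative ?fu (at (x + s *\<^sub>R u + t *\<^sub>R v)) v"
    using es et by (simp add: algebra_simps)
  then show ?thesis using s t by blast
qed

text \<open>The second difference over the parallelogram spanned by h u and h v is unchanged when u
  and v are swapped. So the two mixed derivatives take a common value at two points arbitrarily
  close to \<open>x\<close>, and continuity gives equality at \<open>x\<close>.\<close>

lemma second_derivative_symmetric_real:
  fixes f :: "'a::euclidean_space \<Rightarrow> real"
  assumes f: "smooth_on S f" and x: "x \<in> S"
  shows "frechet_derivative (\<lambda>y. frechet_derivative f (at y) u) (at x) v =
    frechet_derivative (\<lambda>y. frechet_derivative f (at y) v) (at x) u"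
proof (rule ccontr)
  let ?D = "\<lambda>u v y. frechet_derivative (\<lambda>y. frechet_derivative f (at y) u) (at y) v"
  assume ne: "\<not> ?D u v x = ?D v u x"
  \<comment> \<open>With half the gap as tolerance, a number cannot be within \<open>e\<close> of
    both values.\<close>
  define e where "e = \<bar>?D u v x - ?D v u x\<bar> / 2"
  have e: "e > 0" using ne by (simp add: e_def)
  have cont: "isCont (?D u v) x" for u v
    using smooth_on_continuous_on[OF smooth_on_frechet_derivative_const[OF smooth_on_frechet_derivative_const[OF f]]]
      smooth_on_open[OF f] x continuous_on_eq_continuous_at by blast
  have near: "\<exists>d>0. \<forall>y. dist y x < d \<longrightarrow> \<bar>?D u v y - ?D u v x\<bar> < e" for u v
    using cont[of u v] e unfolding continuous_at_eps_delta dist_real_def by blast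
  obtain d1 where d1: "d1 > 0" "\<And>y. dist y x < d1 \<Longrightarrow> \<bar>?D u v y - ?D u v x\<bar> < e"
    using near[of u v] by blast
  obtain d2 where d2: "d2 > 0" "\<And>y. dist y x < d2 \<Longrightarrow> \<bar>?D v u y - ?D v u x\<bar> < e"
    using near[of v u] by blast
  obtain d3 where d3: "d3 > 0" "ball x d3 \<subseteq> S"
    using smooth_on_open[OF f] x open_contains_ball by blast
  define d where "d = min d1 (min d2 d3)"
  \<comment> \<open>This size keeps the parallelogram inside the ball of radius \<open>d\<close>;
    the summand 1 covers the case u = v = 0, and the division by 2 makes the bound strict.\<close>
  define h where "h = d / (norm u + norm v + 1) / 2"
  have d: "d > 0" using d1 d2 d3 by (simp add: d_def)
  have nn: "norm u + norm v + 1 > 0" by (smt (verit) norm_ge_zero)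
  have h: "h > 0" using d nn by (simp add: h_def)
  have close: "dist (x + s *\<^sub>R u + t *\<^sub>R v) x < d" if "0 \<le> s" "s \<le> h" "0 \<le> t" "t \<le> h" for s t
  proof -
    have "dist (x + s *\<^sub>R u + t *\<^sub>R v) x = norm (s *\<^sub>R u + t *\<^sub>R v)" by (simp add: dist_norm)
    also have "\<dots> \<le> s * norm u + t * norm v"
      using norm_triangle_ineq[of "s *\<^sub>R u" "t *\<^sub>R v"] that by simp
    also have "\<dots> \<le> h * norm u + h * norm v"
      using that by (intro add_mono mult_right_mono) auto
    also have "\<dots> \<le> h * (norm u + norm v + 1)" using h by (simp add: algebra_simps)
    also have "\<dots> = d / 2" using nn unfolding h_def by (metis divide_divide_eq_right nonzero_mult_div_cancel_right order_less_irrefl times_divide_eq_left mult.commute)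
    also have "\<dots> < d" using d by simp
    finally show ?thesis .
  qed
  have inS: "y \<in> S" if "dist y x < d" for y
    using d3(2) that by (auto simp: d_def dist_commute)
  obtain s t where st: "0 < s" "s < h" "0 < t" "t < h" and e1:
    "f (x + h *\<^sub>R u + h *\<^sub>R v) - f (x + h *\<^sub>R u) - f (x + h *\<^sub>R v) + f x = h * h * ?D u v (x + s *\<^sub>R u + t *\<^sub>R v)"
    using second_difference_mean_value[OF f h, of x u v] inS close by blast
  have comm: "x + t *\<^sub>R v + s *\<^sub>R u = x + s *\<^sub>R u + t *\<^sub>R v" for s t by (simp add: add_ac)
  have "\<exists>s t. 0 < s \<and> s < h \<and> 0 < t \<and> t < h \<and>
    f (x + h *\<^sub>R v + h *\<^sub>R u) - f (x + h *\<^sub>R v) - f (x + h *\<^sub>R u) + f x = h * h * ?D v u (x + s *\<^sub>R v + t *\<^sub>R u)"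
    by (rule second_difference_mean_value[OF f h, of x v u]) (simp add: comm inS close)
  then obtain s' t' where st': "0 < s'" "s' < h" "0 < t'" "t' < h" and e2:
    "f (x + h *\<^sub>R v + h *\<^sub>R u) - f (x + h *\<^sub>R v) - f (x + h *\<^sub>R u) + f x = h * h * ?D v u (x + t' *\<^sub>R u + s' *\<^sub>R v)"
    unfolding comm by blast
  have "h * h * ?D u v (x + s *\<^sub>R u + t *\<^sub>R v) = h * h * ?D v u (x + t' *\<^sub>R u + s' *\<^sub>R v)"
    unfolding e1[symmetric] e2[symmetric] comm[of h h] by simp
  then have eq: "?D u v (x + s *\<^sub>R u + t *\<^sub>R v) = ?D v u (x + t' *\<^sub>R u + s' *\<^sub>R v)" using h by simp
  have "\<bar>?D u v (x + s *\<^sub>R u + t *\<^sub>R v) - ?D u v x\<bar> < e"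
    using close[of s t] st by (intro d1(2)) (simp add: d_def)
  moreover have "\<bar>?D v u (x + t' *\<^sub>R u + s' *\<^sub>R v) - ?D v u x\<bar> < e"
    using close[of t' s'] st' by (intro d2(2)) (simp add: d_def)
  moreover have "\<bar>a - p\<bar> < e \<Longrightarrow> \<bar>b - q\<bar> < e \<Longrightarrow> a = b \<Longrightarrow> e = \<bar>p - q\<bar> / 2 \<Longrightarrow> False" for a b p q :: real
    by (smt (verit) field_sum_of_halves)
  ultimately show False using eq e_def by metis
qed

lemma second_derivative_symmetric:
  fixes f :: "'a::euclidean_space \<Rightarrow> 'b::euclidean_space"
  assumes f: "smooth_on S f" and x: "x \<in> S"
  shows "frechet_derivative (\<lambda>y. frechet_derivative f (at y) u) (at x) v =
    frechet_derivative (\<lambda>y. frechet_derivative f (at y) v) (at x) u"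
proof (rule vector_eq_rdot[THEN iffD1], rule allI)
  fix z
  have fz: "smooth_on S (\<lambda>y. f y \<bullet> z)"
    by (intro smooth_on_inner f smooth_on_const smooth_on_open[OF f])
  have d: "frechet_derivative (\<lambda>y. F y \<bullet> z) (at y) w = frechet_derivative F (at y) w \<bullet> z"
    if "smooth_on S F" "y \<in> S" for F :: "'a \<Rightarrow> 'b" and y w
    using has_derivative_inner_left[OF smooth_on_has_derivative[OF that], of z]
    by (simp add: frechet_derivative_at[symmetric])
  have dd: "frechet_derivative (\<lambda>y. frechet_derivative (\<lambda>y. f y \<bullet> z) (at y) u) (at x) v =
    frechet_derivative (\<lambda>y. frechet_derivative f (at y) u) (at x) v \<bullet> z" for u v
    using frechet_derivative_transform_within_open[OF smooth_on_differentiable[OF smooth_on_frechet_derivative_const[OF fz, of u] x]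
        smooth_on_open[OF f] x, of "\<lambda>y. frechet_derivative f (at y) u \<bullet> z"]
    by (simp add: d f x smooth_on_frechet_derivative_const)
  show "frechet_derivative (\<lambda>y. frechet_derivative f (at y) u) (at x) v \<bullet> z =
    frechet_derivative (\<lambda>y. frechet_derivative f (at y) v) (at x) u \<bullet> z"
    using second_derivative_symmetric_real[OF fz x, of u v] by (simp only: dd)
qed

section \<open>Curvature in an orthonormal coframe\<close>

text \<open>A 1-form is stored as the vector field \<open>a\<close> that represents it through the
  Euclidean inner product. The formula is its exterior derivative on the constant fields
  \<open>u\<close> and \<open>v\<close>, whose bracket vanishes.\<close>

definition ext_deriv :: "('e::euclidean_space \<Rightarrow> 'e) \<Rightarrow> 'e \<Rightarrow> 'e \<Rightarrow> 'e \<Rightarrow> real" where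
  "ext_deriv a x u v = frechet_derivative a (at x) u \<bullet> v - frechet_derivative a (at x) v \<bullet> u"

definition struc :: "('i \<Rightarrow> 'e::euclidean_space \<Rightarrow> 'e) \<Rightarrow> ('i \<Rightarrow> 'e \<Rightarrow> 'e) \<Rightarrow> 'i \<Rightarrow> 'i \<Rightarrow> 'i \<Rightarrow> 'e \<Rightarrow> real" where
  "struc \<theta> \<epsilon> i j k x = ext_deriv (\<theta> i) x (\<epsilon> j x) (\<epsilon> k x)"

text \<open>The \<open>\<theta> i\<close>-component of the covariant derivative of
  \<open>\<epsilon> k\<close> along \<open>\<epsilon> j\<close>: Koszul's formula in an orthonormal
  frame, where the components of brackets are the negatives of the structure functions.\<close>

definition conn :: "('i \<Rightarrow> 'e::euclidean_space \<Rightarrow> 'e) \<Rightarrow> ('i \<Rightarrow> 'e \<Rightarrow> 'e) \<Rightarrow> 'i \<Rightarrow> 'i \<Rightarrow> 'i \<Rightarrow> 'e \<Rightarrow> real" where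
  "conn \<theta> \<epsilon> i j k x = (- struc \<theta> \<epsilon> i j k x + struc \<theta> \<epsilon> k j i x + struc \<theta> \<epsilon> j k i x) / 2"

definition coframe_metric :: "('i::finite \<Rightarrow> 'e::euclidean_space \<Rightarrow> 'e) \<Rightarrow> 'e \<Rightarrow> 'e \<Rightarrow> 'e \<Rightarrow> real" where
  "coframe_metric \<theta> x u v = (\<Sum>i\<in>UNIV. (\<theta> i x \<bullet> u) * (\<theta> i x \<bullet> v))"

text \<open>The sectional curvature of the plane spanned by the first two vectors of an orthonormal
  frame, by Cartan's structure equations.\<close>

definition frame_curv :: "(3 \<Rightarrow> 'e::euclidean_space \<Rightarrow> 'e) \<Rightarrow> (3 \<Rightarrow> 'e \<Rightarrow> 'e) \<Rightarrow> 'e \<Rightarrow> real" where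
  "frame_curv \<theta> \<epsilon> x =
     frechet_derivative (conn \<theta> \<epsilon> 1 2 2) (at x) (\<epsilon> 1 x) - frechet_derivative (conn \<theta> \<epsilon> 1 1 2) (at x) (\<epsilon> 2 x)
     + (\<Sum>j\<in>UNIV. conn \<theta> \<epsilon> 1 j 2 x * struc \<theta> \<epsilon> j 1 2 x)
     + (\<Sum>k\<in>UNIV. conn \<theta> \<epsilon> 1 1 k x * conn \<theta> \<epsilon> k 2 2 x - conn \<theta> \<epsilon> 1 2 k x * conn \<theta> \<epsilon> k 1 2 x)"

lemma struc_antisym: "struc \<theta> \<epsilon> i k j x = - struc \<theta> \<epsilon> i j k x"
  by (simp add: struc_def ext_deriv_def)

lemma conn_antisym: "conn \<theta> \<epsilon> k j i x = - conn \<theta> \<epsilon> i j k x"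
  unfolding conn_def using struc_antisym[of \<theta> \<epsilon> k i j] struc_antisym[of \<theta> \<epsilon> j i k]
    struc_antisym[of \<theta> \<epsilon> i k j] by (simp add: field_simps)

section \<open>Cartan's structure equations for the coordinate connection\<close>

locale coframe =
  fixes V :: "'e::euclidean_space set" and \<theta> \<epsilon> :: "'i::finite \<Rightarrow> 'e \<Rightarrow> 'e"
  assumes smooth_coframe: "smooth_on V (\<theta> i)" and smooth_frame: "smooth_on V (\<epsilon> i)"
    and dual: "x \<in> V \<Longrightarrow> \<theta> i x \<bullet> \<epsilon> j x = (if i = j then 1 else 0)"
    and expand: "x \<in> V \<Longrightarrow> (\<Sum>i\<in>UNIV. (\<theta> i x \<bullet> u) *\<^sub>R \<epsilon> i x) = u"
begin

abbreviation D\<theta> :: "'i \<Rightarrow> 'e \<Rightarrow> 'e \<Rightarrow> 'e \<Rightarrow> real" where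
  "D\<theta> i x u v \<equiv> frechet_derivative (\<theta> i) (at x) u \<bullet> v"

lemma open_domain: "open V"
  using smooth_coframe smooth_on_open by blast

lemma linear_D\<theta>: "x \<in> V \<Longrightarrow> linear (\<lambda>u. D\<theta> i x u v)"
  using bounded_linear_inner_left[THEN bounded_linear.linear]
  by (intro linear_compose[unfolded o_def, OF linear_frechet_derivative])
    (auto intro: smooth_on_differentiable smooth_coframe)

lemma smooth_on_struc: "smooth_on V (struc \<theta> \<epsilon> i j k)"
  unfolding struc_def[abs_def] ext_deriv_def
  by (intro smooth_on_diff smooth_on_inner smooth_on_frechet_derivative smooth_coframe smooth_frame)

lemma smooth_on_conn: "smooth_on V (conn \<theta> \<epsilon> i j k)"
  unfolding conn_def[abs_def]
  by (intro smooth_on_divide smooth_on_add smooth_on_uminus smooth_on_struc smooth_on_const open_domain) auto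

lemma ext_deriv_expand:
  assumes x: "x \<in> V"
  shows "ext_deriv (\<theta> i) x u v = (\<Sum>j\<in>UNIV. \<Sum>k\<in>UNIV. struc \<theta> \<epsilon> i j k x * (\<theta> j x \<bullet> u) * (\<theta> k x \<bullet> v))"
proof -
  have D: "D\<theta> i x u v = (\<Sum>j\<in>UNIV. \<Sum>k\<in>UNIV. D\<theta> i x (\<epsilon> j x) (\<epsilon> k x) * (\<theta> j x \<bullet> u) * (\<theta> k x \<bullet> v))" for u v
  proof -
    have "D\<theta> i x u v = D\<theta> i x (\<Sum>j\<in>UNIV. (\<theta> j x \<bullet> u) *\<^sub>R \<epsilon> j x) v" by (simp add: expand x)
    also have "\<dots> = (\<Sum>j\<in>UNIV. (\<theta> j x \<bullet> u) * D\<theta> i x (\<epsilon> j x) v)"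
      by (simp add: linear_sum[OF linear_D\<theta>[OF x]] linear_scale[OF linear_D\<theta>[OF x]])
    also have "\<dots> = (\<Sum>j\<in>UNIV. (\<theta> j x \<bullet> u) * D\<theta> i x (\<epsilon> j x) (\<Sum>k\<in>UNIV. (\<theta> k x \<bullet> v) *\<^sub>R \<epsilon> k x))"
      by (simp add: expand x)
    finally show ?thesis by (simp add: inner_sum_right sum_distrib_left mult_ac)
  qed
  have "(\<Sum>j\<in>UNIV. \<Sum>k\<in>UNIV. D\<theta> i x (\<epsilon> j x) (\<epsilon> k x) * (\<theta> j x \<bullet> v) * (\<theta> k x \<bullet> u))
    = (\<Sum>j\<in>UNIV. \<Sum>k\<in>UNIV. D\<theta> i x (\<epsilon> k x) (\<epsilon> j x) * (\<theta> j x \<bullet> u) * (\<theta> k x \<bullet> v))"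
    by (subst sum.swap) (simp add: mult_ac)
  then show ?thesis
    by (simp add: ext_deriv_def D[of u v] D[of v u] struc_def sum_subtractf[symmetric] algebra_simps)
qed

text \<open>Koszul's formula on arbitrary vectors. The three summands of \<open>conn\<close> give
  triple sums with permuted indices, each of which \<open>ext_deriv_expand\<close>
  collapses.\<close>

lemma conn_expand:
  assumes x: "x \<in> V"
  shows "2 * (\<Sum>i\<in>UNIV. (\<Sum>j\<in>UNIV. \<Sum>k\<in>UNIV. conn \<theta> \<epsilon> i j k x * (\<theta> j x \<bullet> u) * (\<theta> k x \<bullet> v)) * (\<theta> i x \<bullet> z))
    = (\<Sum>i\<in>UNIV. (\<theta> i x \<bullet> v) * ext_deriv (\<theta> i) x u z + (\<theta> i x \<bullet> u) * ext_deriv (\<theta> i) x v z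
        - (\<theta> i x \<bullet> z) * ext_deriv (\<theta> i) x u v)"
proof -
  let ?f = "\<lambda>i j k. struc \<theta> \<epsilon> i j k x"
  let ?t = "\<lambda>i j k. (\<theta> j x \<bullet> u) * (\<theta> k x \<bullet> v) * (\<theta> i x \<bullet> z)"
  have "2 * (\<Sum>i\<in>UNIV. (\<Sum>j\<in>UNIV. \<Sum>k\<in>UNIV. conn \<theta> \<epsilon> i j k x * (\<theta> j x \<bullet> u) * (\<theta> k x \<bullet> v)) * (\<theta> i x \<bullet> z))
    = (\<Sum>i\<in>UNIV. \<Sum>j\<in>UNIV. \<Sum>k\<in>UNIV. (2 * conn \<theta> \<epsilon> i j k x) * ?t i j k)"
    by (simp add: sum_distrib_left sum_distrib_right mult_ac)
  also have "\<dots> = (\<Sum>i\<in>UNIV. \<Sum>j\<in>UNIV. \<Sum>k\<in>UNIV. ?f k j i * ?t i j k)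
    + (\<Sum>i\<in>UNIV. \<Sum>j\<in>UNIV. \<Sum>k\<in>UNIV. ?f j k i * ?t i j k)
    - (\<Sum>i\<in>UNIV. \<Sum>j\<in>UNIV. \<Sum>k\<in>UNIV. ?f i j k * ?t i j k)"
    unfolding sum.distrib[symmetric] sum_subtractf[symmetric]
    by (intro sum.cong refl) (simp add: conn_def field_simps)
  also have "(\<Sum>i\<in>UNIV. \<Sum>j\<in>UNIV. \<Sum>k\<in>UNIV. ?f k j i * ?t i j k)
    = (\<Sum>k\<in>UNIV. (\<theta> k x \<bullet> v) * ext_deriv (\<theta> k) x u z)"
    unfolding ext_deriv_expand[OF x] sum_distrib_left
    by (subst (2) sum.swap, subst sum.swap, subst (2) sum.swap) (simp add: mult_ac)
  also have "(\<Sum>i\<in>UNIV. \<Sum>j\<in>UNIV. \<Sum>k\<in>UNIV. ?f j k i * ?t i j k)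
    = (\<Sum>j\<in>UNIV. (\<theta> j x \<bullet> u) * ext_deriv (\<theta> j) x v z)"
    unfolding ext_deriv_expand[OF x] sum_distrib_left
    by (subst sum.swap, subst (2) sum.swap) (simp add: mult_ac)
  also have "(\<Sum>i\<in>UNIV. \<Sum>j\<in>UNIV. \<Sum>k\<in>UNIV. ?f i j k * ?t i j k)
    = (\<Sum>i\<in>UNIV. (\<theta> i x \<bullet> z) * ext_deriv (\<theta> i) x u v)"
    unfolding ext_deriv_expand[OF x] sum_distrib_left by (simp add: mult_ac)
  finally show ?thesis by (simp add: sum.distrib sum_subtractf)
qed

lemma inner_coframe_sum:
  "x \<in> V \<Longrightarrow> \<theta> i x \<bullet> (\<Sum>j\<in>UNIV. c j *\<^sub>R \<epsilon> j x) = c i"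
  by (simp add: inner_sum_right dual if_distrib cong: if_cong)

lemma coframe_eqI:
  assumes "x \<in> V" "\<And>i. \<theta> i x \<bullet> u = \<theta> i x \<bullet> v"
  shows "u = v"
  using expand[OF assms(1), of u] expand[OF assms(1), of v] unfolding assms(2) by (rule subst)

lemma coframe_metric_derivative:
  assumes x: "x \<in> V"
  shows "frechet_derivative (\<lambda>y. coframe_metric \<theta> y v z) (at x) u =
    (\<Sum>i\<in>UNIV. (\<theta> i x \<bullet> v) * D\<theta> i x u z + D\<theta> i x u v * (\<theta> i x \<bullet> z))"
proof -
  have "((\<lambda>y. coframe_metric \<theta> y v z) has_derivative
    (\<lambda>u. \<Sum>i\<in>UNIV. (\<theta> i x \<bullet> v) * D\<theta> i x u z + D\<theta> i x u v * (\<theta> i x \<bullet> z))) (at x)"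
    unfolding coframe_metric_def
    by (intro has_derivative_sum has_derivative_mult has_derivative_inner_left
        smooth_on_has_derivative[OF smooth_coframe x])
  from fun_cong[OF frechet_derivative_at[OF this, symmetric]] show ?thesis .
qed

text \<open>The \<open>\<theta> i\<close>-component of the covariant derivative of the constant
  field \<open>v\<close> along \<open>u\<close>. With \<open>v\<close> written in the frame, the
  first term differentiates its coefficients, the second the frame vectors.\<close>

definition gam :: "'e \<Rightarrow> 'e \<Rightarrow> 'i \<Rightarrow> 'e \<Rightarrow> real" where
  "gam u v i x = D\<theta> i x u v + (\<Sum>j\<in>UNIV. \<Sum>k\<in>UNIV. conn \<theta> \<epsilon> i j k x * (\<theta> j x \<bullet> u) * (\<theta> k x \<bullet> v))"

text \<open>The derivatives of the metric in the defining equation of \<open>christoffel\<close> add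
  up to twice \<open>D\<theta> i x u v\<close> paired with \<open>z\<close>, plus exactly the
  exterior derivatives in \<open>conn_expand\<close>. Uniqueness follows by pairing with the frame
  vectors.\<close>

lemma coframe_christoffel:
  assumes x: "x \<in> V"
  shows "christoffel (coframe_metric \<theta>) x u v = (\<Sum>i\<in>UNIV. gam u v i x *\<^sub>R \<epsilon> i x)"
  unfolding christoffel_def
proof (rule the_equality)
  let ?L = "\<lambda>z. frechet_derivative (\<lambda>y. coframe_metric \<theta> y v z) (at x) u +
      frechet_derivative (\<lambda>y. coframe_metric \<theta> y u z) (at x) v -
      frechet_derivative (\<lambda>y. coframe_metric \<theta> y u v) (at x) z"
  let ?w = "\<Sum>i\<in>UNIV. gam u v i x *\<^sub>R \<epsilon> i x"
  show eq: "\<forall>z. 2 * coframe_metric \<theta> x ?w z = ?L z"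
  proof
    fix z
    have "2 * coframe_metric \<theta> x ?w z = (\<Sum>i\<in>UNIV. 2 * D\<theta> i x u v * (\<theta> i x \<bullet> z))
      + 2 * (\<Sum>i\<in>UNIV. (\<Sum>j\<in>UNIV. \<Sum>k\<in>UNIV. conn \<theta> \<epsilon> i j k x * (\<theta> j x \<bullet> u) * (\<theta> k x \<bullet> v)) * (\<theta> i x \<bullet> z))"
      unfolding coframe_metric_def inner_coframe_sum[OF x] gam_def
      by (simp add: sum.distrib[symmetric] sum_distrib_left algebra_simps)
    also have "\<dots> = ?L z"
      unfolding conn_expand[OF x] coframe_metric_derivative[OF x]
      by (simp add: sum.distrib[symmetric] sum_subtractf[symmetric] ext_deriv_def algebra_simps)
    finally show "2 * coframe_metric \<theta> x ?w z = ?L z" .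
  qed
  fix w assume w: "\<forall>z. 2 * coframe_metric \<theta> x w z = ?L z"
  have c: "coframe_metric \<theta> x a (\<epsilon> i x) = \<theta> i x \<bullet> a" for a i
    unfolding coframe_metric_def using x by (simp add: dual if_distrib cong: if_cong)
  show "w = ?w"
  proof (rule coframe_eqI[OF x])
    fix i
    have "2 * coframe_metric \<theta> x w (\<epsilon> i x) = 2 * coframe_metric \<theta> x ?w (\<epsilon> i x)"
      using w eq by simp
    then show "\<theta> i x \<bullet> w = \<theta> i x \<bullet> ?w" by (simp add: c)
  qed
qed

lemma smooth_on_gam: "smooth_on V (gam u v i)"
  unfolding gam_def[abs_def]
  by (intro smooth_on_add smooth_on_sum smooth_on_mult smooth_on_inner smooth_on_const open_domain
      smooth_on_frechet_derivative smooth_coframe smooth_on_conn)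

text \<open>By the Leibniz rule, taking the component and differentiating commute up to the
  derivative of \<open>\<theta> i\<close>, and that term cancels against the first summand of
  \<open>gam\<close>.\<close>

lemma levi_civita_coframe:
  assumes x: "x \<in> V"
  shows "\<theta> i x \<bullet> levi_civita (coframe_metric \<theta>) (\<lambda>_. u) (levi_civita (coframe_metric \<theta>) (\<lambda>_. a) (\<lambda>_. b)) x
    = frechet_derivative (gam a b i) (at x) u
      + (\<Sum>j\<in>UNIV. \<Sum>k\<in>UNIV. conn \<theta> \<epsilon> i j k x * (\<theta> j x \<bullet> u) * gam a b k x)"
proof -
  let ?W = "\<lambda>y. \<Sum>i\<in>UNIV. gam a b i y *\<^sub>R \<epsilon> i y"
  let ?L = "levi_civita (coframe_metric \<theta>) (\<lambda>_. a) (\<lambda>_. b)"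
  have L: "?L y = ?W y" if "y \<in> V" for y
    using that by (simp add: levi_civita_def coframe_christoffel)
  have W: "smooth_on V ?W"
    by (intro smooth_on_sum smooth_on_scaleR smooth_on_gam smooth_frame open_domain)
  have WL: "smooth_on V ?L" by (rule smooth_on_cong[OF W]) (simp add: L)
  have "((\<lambda>y. \<theta> i y \<bullet> ?L y) has_derivative
     (\<lambda>u. \<theta> i x \<bullet> frechet_derivative ?L (at x) u + D\<theta> i x u (?L x))) (at x)"
    by (intro has_derivative_inner smooth_on_has_derivative[OF _ x] WL smooth_coframe)
  then have "(gam a b i has_derivative
     (\<lambda>u. \<theta> i x \<bullet> frechet_derivative ?L (at x) u + D\<theta> i x u (?L x))) (at x)"
    by (rule has_derivative_transform_within_open[OF _ open_domain x])
      (simp add: L inner_coframe_sum)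
  then have "frechet_derivative (gam a b i) (at x) u = \<theta> i x \<bullet> frechet_derivative ?L (at x) u + D\<theta> i x u (?L x)"
    by (simp add: frechet_derivative_at[symmetric])
  then show ?thesis
    unfolding levi_civita_def[of _ "\<lambda>_. u" ?L] coframe_christoffel[OF x]
    by (simp add: inner_add_right inner_coframe_sum x L gam_def[of u])
qed

lemma gam_derivative:
  assumes x: "x \<in> V"
  shows "frechet_derivative (gam u v i) (at x) w =
    frechet_derivative (\<lambda>y. frechet_derivative (\<theta> i) (at y) u) (at x) w \<bullet> v
    + (\<Sum>j\<in>UNIV. \<Sum>k\<in>UNIV. conn \<theta> \<epsilon> i j k x * (\<theta> j x \<bullet> u) * D\<theta> k x w v
        + (conn \<theta> \<epsilon> i j k x * D\<theta> j x w u
        + frechet_derivative (conn \<theta> \<epsilon> i j k) (at x) w * (\<theta> j x \<bullet> u)) * (\<theta> k x \<bullet> v))"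
proof -
  have "(gam u v i has_derivative (\<lambda>w. frechet_derivative (\<lambda>y. frechet_derivative (\<theta> i) (at y) u) (at x) w \<bullet> v
    + (\<Sum>j\<in>UNIV. \<Sum>k\<in>UNIV. conn \<theta> \<epsilon> i j k x * (\<theta> j x \<bullet> u) * D\<theta> k x w v
        + (conn \<theta> \<epsilon> i j k x * D\<theta> j x w u
        + frechet_derivative (conn \<theta> \<epsilon> i j k) (at x) w * (\<theta> j x \<bullet> u)) * (\<theta> k x \<bullet> v)))) (at x)"
    unfolding gam_def[abs_def]
    by (intro has_derivative_add has_derivative_sum has_derivative_mult has_derivative_inner_left
        smooth_on_has_derivative[OF _ x] smooth_on_frechet_derivative_const smooth_coframe smooth_on_conn)
  from fun_cong[OF frechet_derivative_at[OF this, symmetric]] show ?thesis .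
qed

text \<open>The second structure equation: the curvature form d\<omega> + \<omega> \<and> \<omega>,
  evaluated on \<open>u\<close>, \<open>v\<close> and applied to \<open>v\<close>. Second
  derivatives of \<theta> cancel by symmetry, and the products of \<open>conn\<close> with first
  derivatives of \<theta> cancel between the differentiated and the quadratic part, except for those
  that form an exterior derivative.\<close>

lemma riemann_coframe:
  assumes x: "x \<in> V"
  shows "\<theta> i x \<bullet> riemann (coframe_metric \<theta>) (\<lambda>_. u) (\<lambda>_. v) (\<lambda>_. v) x =
   (\<Sum>j\<in>UNIV. \<Sum>k\<in>UNIV.
       (frechet_derivative (conn \<theta> \<epsilon> i j k) (at x) u * (\<theta> j x \<bullet> v)
        - frechet_derivative (conn \<theta> \<epsilon> i j k) (at x) v * (\<theta> j x \<bullet> u)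
        + conn \<theta> \<epsilon> i j k x * ext_deriv (\<theta> j) x u v) * (\<theta> k x \<bullet> v)
     + conn \<theta> \<epsilon> i j k x * (\<Sum>l\<in>UNIV. \<Sum>m\<in>UNIV. conn \<theta> \<epsilon> k l m x *
         ((\<theta> j x \<bullet> u) * (\<theta> l x \<bullet> v) - (\<theta> j x \<bullet> v) * (\<theta> l x \<bullet> u)) * (\<theta> m x \<bullet> v)))"
proof -
  let ?G = "coframe_metric \<theta>"
  \<comment> \<open>Constant fields have zero bracket, so the third term of \<open>riemann\<close>
    drops out.\<close>
  have "gam 0 v i x = 0" for i
    using linear_0[OF linear_D\<theta>[OF x]] by (simp add: gam_def)
  then have br: "levi_civita ?G (bracket (\<lambda>_. u) (\<lambda>_. v)) (\<lambda>_. v) x = 0"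
    by (simp add: levi_civita_def bracket_def[abs_def] coframe_christoffel[OF x])
  let ?S = "\<lambda>a b w. \<Sum>j\<in>UNIV. \<Sum>k\<in>UNIV. conn \<theta> \<epsilon> i j k x * (\<theta> j x \<bullet> w) * gam a b k x"
  have gam_prod: "conn \<theta> \<epsilon> i j k x * (\<theta> j x \<bullet> u) * gam v v k x - conn \<theta> \<epsilon> i j k x * (\<theta> j x \<bullet> v) * gam u v k x
    = conn \<theta> \<epsilon> i j k x * ((\<theta> j x \<bullet> u) * D\<theta> k x v v - (\<theta> j x \<bullet> v) * D\<theta> k x u v)
     + conn \<theta> \<epsilon> i j k x * (\<Sum>l\<in>UNIV. \<Sum>m\<in>UNIV. conn \<theta> \<epsilon> k l m x *
         ((\<theta> j x \<bullet> u) * (\<theta> l x \<bullet> v) - (\<theta> j x \<bullet> v) * (\<theta> l x \<bullet> u)) * (\<theta> m x \<bullet> v))" for j k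
    by (simp add: gam_def algebra_simps sum_distrib_left sum_subtractf)
  have "\<theta> i x \<bullet> riemann ?G (\<lambda>_. u) (\<lambda>_. v) (\<lambda>_. v) x =
     frechet_derivative (gam v v i) (at x) u - frechet_derivative (gam u v i) (at x) v + (?S v v u - ?S u v v)"
    unfolding riemann_def br inner_diff_right levi_civita_coframe[OF x] by simp
  also have "?S v v u - ?S u v v = (\<Sum>j\<in>UNIV. \<Sum>k\<in>UNIV.
     conn \<theta> \<epsilon> i j k x * ((\<theta> j x \<bullet> u) * D\<theta> k x v v - (\<theta> j x \<bullet> v) * D\<theta> k x u v)
     + conn \<theta> \<epsilon> i j k x * (\<Sum>l\<in>UNIV. \<Sum>m\<in>UNIV. conn \<theta> \<epsilon> k l m x *
         ((\<theta> j x \<bullet> u) * (\<theta> l x \<bullet> v) - (\<theta> j x \<bullet> v) * (\<theta> l x \<bullet> u)) * (\<theta> m x \<bullet> v)))"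
    unfolding sum_subtractf[symmetric] gam_prod ..
  also have "frechet_derivative (gam v v i) (at x) u - frechet_derivative (gam u v i) (at x) v =
    (\<Sum>j\<in>UNIV. \<Sum>k\<in>UNIV.
     (frechet_derivative (conn \<theta> \<epsilon> i j k) (at x) u * (\<theta> j x \<bullet> v)
        - frechet_derivative (conn \<theta> \<epsilon> i j k) (at x) v * (\<theta> j x \<bullet> u)
        + conn \<theta> \<epsilon> i j k x * ext_deriv (\<theta> j) x u v) * (\<theta> k x \<bullet> v)
      - conn \<theta> \<epsilon> i j k x * ((\<theta> j x \<bullet> u) * D\<theta> k x v v - (\<theta> j x \<bullet> v) * D\<theta> k x u v))"
    unfolding gam_derivative[OF x] second_derivative_symmetric[OF smooth_coframe x, where u = u and v = v]
      add_diff_cancel_left sum_subtractf[symmetric]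
    by (intro sum.cong refl) (simp add: ext_deriv_def algebra_simps)
  finally show ?thesis by (simp add: sum.distrib[symmetric])
qed

end

text \<open>For vectors killed by \<open>\<theta> 3\<close> the numerator of \<open>sec_curv\<close>
  is the squared determinant of their first two components times \<open>frame_curv\<close>, and the
  denominator is that squared determinant. Hence the quotient does not see the choice of
  basis.\<close>

lemma sec_curv_coframe:
  fixes \<theta> \<epsilon> :: "3 \<Rightarrow> 'e::euclidean_space \<Rightarrow> 'e"
  assumes "coframe V \<theta> \<epsilon>" and x: "x \<in> V"
    and u: "\<theta> 3 x \<bullet> u = 0" and v: "\<theta> 3 x \<bullet> v = 0"
    and ne: "(\<theta> 1 x \<bullet> u) * (\<theta> 2 x \<bullet> v) - (\<theta> 2 x \<bullet> u) * (\<theta> 1 x \<bullet> v) \<noteq> 0"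
  shows "sec_curv (coframe_metric \<theta>) x u v = frame_curv \<theta> \<epsilon> x"
proof -
  interpret coframe V \<theta> \<epsilon> by fact
  define u1 u2 v1 v2 where uv: "u1 = \<theta> 1 x \<bullet> u" "u2 = \<theta> 2 x \<bullet> u" "v1 = \<theta> 1 x \<bullet> v" "v2 = \<theta> 2 x \<bullet> v"
  let ?w = "\<lambda>i j k. conn \<theta> \<epsilon> i j k x"
  let ?dw = "\<lambda>i j k. frechet_derivative (conn \<theta> \<epsilon> i j k) (at x)"
  have dw: "?dw i j k z = (\<theta> 1 x \<bullet> z) * ?dw i j k (\<epsilon> 1 x) + (\<theta> 2 x \<bullet> z) * ?dw i j k (\<epsilon> 2 x)"
    if "\<theta> 3 x \<bullet> z = 0" for i j k z
  proof -
    have l: "linear (?dw i j k)"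
      using smooth_on_differentiable[OF smooth_on_conn x] linear_frechet_derivative by blast
    have "?dw i j k z = ?dw i j k (\<Sum>i\<in>UNIV. (\<theta> i x \<bullet> z) *\<^sub>R \<epsilon> i x)" by (simp add: expand x)
    then show ?thesis using that by (simp add: sum_3 linear_add[OF l] linear_scale[OF l])
  qed
  have w0: "?w i j i = 0" for i j using conn_antisym[of \<theta> \<epsilon> i j i x] by simp
  have dw0: "?dw i j i = (\<lambda>_. 0)" for i j
  proof -
    have "conn \<theta> \<epsilon> i j i = (\<lambda>_. 0)"
      using conn_antisym[of \<theta> \<epsilon> i j i] by (simp add: fun_eq_iff)
    then show ?thesis by simp
  qed
  have dw21: "?dw 2 j 1 z = - ?dw 1 j 2 z" for j z
  proof -
    have "conn \<theta> \<epsilon> 2 j 1 = (\<lambda>x. - conn \<theta> \<epsilon> 1 j 2 x)"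
      using conn_antisym[of \<theta> \<epsilon> 2 j 1] by (simp add: fun_eq_iff)
    then show ?thesis
      using has_derivative_minus[OF smooth_on_has_derivative[OF smooth_on_conn x, of 1 j 2]]
      by (simp add: frechet_derivative_at[symmetric])
  qed
  have F: "ext_deriv (\<theta> j) x u v = (u1 * v2 - u2 * v1) * struc \<theta> \<epsilon> j 1 2 x" for j
    unfolding ext_deriv_expand[OF x]
    using struc_antisym[of \<theta> \<epsilon> j 1 1 x] struc_antisym[of \<theta> \<epsilon> j 2 2 x] struc_antisym[of \<theta> \<epsilon> j 2 1 x]
    by (simp add: sum_3 u v uv algebra_simps)
  have anti: "?w 2 j 1 = - ?w 1 j 2" "?w 3 j 1 = - ?w 1 j 3" "?w 3 j 2 = - ?w 2 j 3" for j
    by (rule conn_antisym)+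
  have "coframe_metric \<theta> x (riemann (coframe_metric \<theta>) (\<lambda>_. u) (\<lambda>_. v) (\<lambda>_. v) x) u
    = (u1 * v2 - u2 * v1)\<^sup>2 * frame_curv \<theta> \<epsilon> x"
    unfolding coframe_metric_def[of \<theta> x _ u] riemann_coframe[OF x] frame_curv_def F
    unfolding sum_3 dw[OF u] dw[OF v] u v dw0 dw21 w0 anti uv[symmetric]
    by (simp add: power2_eq_square algebra_simps)
  moreover have "coframe_metric \<theta> x u u * coframe_metric \<theta> x v v - (coframe_metric \<theta> x u v)\<^sup>2
     = (u1 * v2 - u2 * v1)\<^sup>2"
    unfolding coframe_metric_def sum_3 u v uv[symmetric] by (simp add: power2_eq_square algebra_simps)
  ultimately show ?thesis
    using ne unfolding sec_curv_def uv[symmetric] by simp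
qed

subsection \<open>Rescaling\<close>

text \<open>The two functions satisfy \<open>has_derivative\<close> with the same maps, and
  \<open>frechet_derivative\<close> is a choice governed by that property alone; so the rule also
  covers points where no derivative exists.\<close>

lemma frechet_derivative_local:
  assumes "open V" "x \<in> V" "\<And>y. y \<in> V \<Longrightarrow> f y = g y"
  shows "frechet_derivative f (at x) = frechet_derivative g (at x)"
proof -
  have "(f has_derivative D) (at x) \<longleftrightarrow> (g has_derivative D) (at x)" for D
    using has_derivative_transform_within_open[OF _ assms(1,2), of f D UNIV g]
      has_derivative_transform_within_open[OF _ assms(1,2), of g D UNIV f] assms(3) by auto
  then show ?thesis by (simp add: frechet_derivative_def)
qed

context coframe
begin

lemma coframe_scale:
  assumes "\<And>i. smooth_on V (c i)" "\<And>i x. x \<in> V \<Longrightarrow> c i x \<noteq> 0"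
  shows "coframe V (\<lambda>i x. c i x *\<^sub>R \<theta> i x) (\<lambda>i x. inverse (c i x) *\<^sub>R \<epsilon> i x)"
proof
  show "smooth_on V (\<lambda>x. c i x *\<^sub>R \<theta> i x)" for i
    by (intro smooth_on_scaleR assms smooth_coframe)
  show "smooth_on V (\<lambda>x. inverse (c i x) *\<^sub>R \<epsilon> i x)" for i
    by (intro smooth_on_scaleR smooth_on_inverse assms smooth_frame)
  show "(c i x *\<^sub>R \<theta> i x) \<bullet> (inverse (c j x) *\<^sub>R \<epsilon> j x) = (if i = j then 1 else 0)" if "x \<in> V" for x i j
    using assms(2)[OF that] dual[OF that] by simp
  show "(\<Sum>i\<in>UNIV. ((c i x *\<^sub>R \<theta> i x) \<bullet> u) *\<^sub>R inverse (c i x) *\<^sub>R \<epsilon> i x) = u" if "x \<in> V" for x u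
    using assms(2)[OF that] expand[OF that, of u] by (simp add: field_simps)
qed

text \<open>In d(c \<theta>) = c d\<theta> + dc \<and> \<theta> the last term vanishes on
  \<open>\<epsilon> j\<close>, \<open>\<epsilon> k\<close> if \<open>\<theta> i\<close> kills both
  vectors or dc is zero at the point.\<close>

lemma struc_scale:
  assumes c: "\<And>i. smooth_on V (c i)" "\<And>i x. x \<in> V \<Longrightarrow> c i x \<noteq> 0" and x: "x \<in> V"
    and i: "i \<noteq> j \<and> i \<noteq> k \<or> frechet_derivative (c i) (at x) = (\<lambda>_. 0)"
  shows "struc (\<lambda>i x. c i x *\<^sub>R \<theta> i x) (\<lambda>i x. inverse (c i x) *\<^sub>R \<epsilon> i x) i j k x
    = c i x / (c j x * c k x) * struc \<theta> \<epsilon> i j k x"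
proof -
  let ?c = "frechet_derivative (c i) (at x)" and ?\<theta> = "frechet_derivative (\<theta> i) (at x)"
  have "((\<lambda>y. c i y *\<^sub>R \<theta> i y) has_derivative (\<lambda>u. c i x *\<^sub>R ?\<theta> u + ?c u *\<^sub>R \<theta> i x)) (at x)"
    by (intro has_derivative_scaleR smooth_on_has_derivative[OF _ x] c smooth_coframe)
  then have d: "frechet_derivative (\<lambda>y. c i y *\<^sub>R \<theta> i y) (at x) = (\<lambda>u. c i x *\<^sub>R ?\<theta> u + ?c u *\<^sub>R \<theta> i x)"
    by (rule frechet_derivative_at[symmetric])
  have l: "linear ?\<theta>"
    using smooth_on_differentiable[OF smooth_coframe x] linear_frechet_derivative by blast
  have z: "?c u * (\<theta> i x \<bullet> \<epsilon> j x) = 0" "?c u * (\<theta> i x \<bullet> \<epsilon> k x) = 0" for u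
    using i by (auto simp: dual[OF x])
  have z': "?c u = 0 \<or> \<theta> i x \<bullet> \<epsilon> j x = 0" "?c u = 0 \<or> \<theta> i x \<bullet> \<epsilon> k x = 0" for u
    using z[of u] by auto
  show ?thesis
    using c(2)[OF x] unfolding struc_def ext_deriv_def d linear_scale[OF l]
    using z'(1)[of "inverse (c k x) *\<^sub>R \<epsilon> k x"] z'(2)[of "inverse (c j x) *\<^sub>R \<epsilon> j x"]
    by (auto simp: inner_add_left field_simps)
qed

end

lemma coframe_metric_scale:
  "coframe_metric (\<lambda>i x. c i x *\<^sub>R \<theta> i x) x u v = (\<Sum>i\<in>UNIV. (c i x)\<^sup>2 * ((\<theta> i x \<bullet> u) * (\<theta> i x \<bullet> v)))"
  by (simp add: coframe_metric_def power2_eq_square mult_ac)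

text \<open>These are the coefficients \<open>Q\<close>, minus the determinant of the second fundamental form of the
  plane field spanned by the first two frame vectors, and \<open>C\<close>, which measures its non-integrability.\<close>

definition shape :: "(3 \<Rightarrow> 'e::euclidean_space \<Rightarrow> 'e) \<Rightarrow> (3 \<Rightarrow> 'e \<Rightarrow> 'e) \<Rightarrow> 'e \<Rightarrow> real" where
  "shape \<theta> \<epsilon> x = (struc \<theta> \<epsilon> 2 1 3 x + struc \<theta> \<epsilon> 1 2 3 x)\<^sup>2 / 4 - struc \<theta> \<epsilon> 1 1 3 x * struc \<theta> \<epsilon> 2 2 3 x"

definition twist :: "(3 \<Rightarrow> 'e::euclidean_space \<Rightarrow> 'e) \<Rightarrow> (3 \<Rightarrow> 'e \<Rightarrow> 'e) \<Rightarrow> 'e \<Rightarrow> real" where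
  "twist \<theta> \<epsilon> x = 3 / 4 * (struc \<theta> \<epsilon> 3 1 2 x)\<^sup>2"

text \<open>The derivative of \<open>c 3\<close> could show up only in structure functions of
  \<open>\<theta> 3\<close> with 3 among the lower indices, and \<open>frame_curv\<close> contains
  none. Its two differentiated coefficients involve only the indices 1 and 2, so they do not change
  at all.\<close>

lemma frame_curv_scale:
  fixes \<theta> \<epsilon> :: "3 \<Rightarrow> 'e::euclidean_space \<Rightarrow> 'e"
  assumes "coframe V \<theta> \<epsilon>" and c: "\<And>i. smooth_on V (c i)" "\<And>i x. x \<in> V \<Longrightarrow> c i x \<noteq> 0"
    and c1: "c 1 = (\<lambda>_. 1)" and c2: "c 2 = (\<lambda>_. 1)" and x: "x \<in> V"
  shows "frame_curv (\<lambda>i x. c i x *\<^sub>R \<theta> i x) (\<lambda>i x. inverse (c i x) *\<^sub>R \<epsilon> i x) x =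
    frame_curv \<theta> \<epsilon> x + (inverse ((c 3 x)\<^sup>2) - 1) * shape \<theta> \<epsilon> x - ((c 3 x)\<^sup>2 - 1) * twist \<theta> \<epsilon> x"
proof -
  interpret coframe V \<theta> \<epsilon> by fact
  let ?\<theta> = "\<lambda>i x. c i x *\<^sub>R \<theta> i x" and ?\<epsilon> = "\<lambda>i x. inverse (c i x) *\<^sub>R \<epsilon> i x"
  let ?f = "\<lambda>i j k. struc \<theta> \<epsilon> i j k x"
  define t where "t = c 3 x"
  have t: "t \<noteq> 0" using c(2)[OF x] by (simp add: t_def)
  note s = struc_scale[OF c]
  have ne: "(1::3) \<noteq> 3" "(2::3) \<noteq> 3" "(1::3) \<noteq> 2" "(3::3) \<noteq> 1" "(3::3) \<noteq> 2" "(2::3) \<noteq> 1" by simp_all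
  have w: "conn ?\<theta> ?\<epsilon> 1 2 2 y = conn \<theta> \<epsilon> 1 2 2 y" "conn ?\<theta> ?\<epsilon> 1 1 2 y = conn \<theta> \<epsilon> 1 1 2 y" if "y \<in> V" for y
    unfolding conn_def using that by (auto simp: s c1 c2 ne)
  have dw: "frechet_derivative (conn ?\<theta> ?\<epsilon> 1 2 2) (at x) = frechet_derivative (conn \<theta> \<epsilon> 1 2 2) (at x)"
    "frechet_derivative (conn ?\<theta> ?\<epsilon> 1 1 2) (at x) = frechet_derivative (conn \<theta> \<epsilon> 1 1 2) (at x)"
    by (rule frechet_derivative_local[OF open_domain x]; simp add: w)+
  have S: "struc ?\<theta> ?\<epsilon> i j k x = c i x / (c j x * c k x) * ?f i j k"
    if "i = 1 \<or> i = 2 \<or> i \<noteq> j \<and> i \<noteq> k" for i j k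
    using that by (intro s x) (auto simp: c1 c2)
  have anti: "?f i 1 1 = 0" "?f i 2 2 = 0" "?f i 3 3 = 0" "?f i 2 1 = - ?f i 1 2" "?f i 3 1 = - ?f i 1 3"
     "?f i 3 2 = - ?f i 2 3" for i
    using struc_antisym[of \<theta> \<epsilon> i 1 1 x] struc_antisym[of \<theta> \<epsilon> i 2 2 x] struc_antisym[of \<theta> \<epsilon> i 3 3 x]
      struc_antisym[of \<theta> \<epsilon> i 2 1 x] struc_antisym[of \<theta> \<epsilon> i 3 1 x] struc_antisym[of \<theta> \<epsilon> i 3 2 x] by auto
  let ?w' = "\<lambda>i j k. conn ?\<theta> ?\<epsilon> i j k x"
  have W: "?w' 1 1 2 = - ?f 1 1 2" "?w' 1 2 2 = - ?f 2 1 2" "?w' 1 3 2 = (- ?f 2 1 3 + ?f 1 2 3) / (2 * t) - t * ?f 3 1 2 / 2"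
    "?w' 1 1 3 = - ?f 1 1 3 / t" "?w' 2 2 3 = - ?f 2 2 3 / t"
    "?w' 1 2 3 = - (?f 1 2 3 + ?f 2 1 3) / (2 * t) - t * ?f 3 1 2 / 2"
    "?w' 2 1 3 = - (?f 1 2 3 + ?f 2 1 3) / (2 * t) + t * ?f 3 1 2 / 2"
  proof -
    have g: "struc ?\<theta> ?\<epsilon> i 1 2 x = ?f i 1 2" "struc ?\<theta> ?\<epsilon> i 2 1 x = - ?f i 1 2"
      "struc ?\<theta> ?\<epsilon> i 2 2 x = 0" "struc ?\<theta> ?\<epsilon> i 1 1 x = 0"
      "struc ?\<theta> ?\<epsilon> i 1 3 x = ?f i 1 3 / t" "struc ?\<theta> ?\<epsilon> i 3 1 x = - ?f i 1 3 / t"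
      "struc ?\<theta> ?\<epsilon> i 2 3 x = ?f i 2 3 / t" "struc ?\<theta> ?\<epsilon> i 3 2 x = - ?f i 2 3 / t"
      if "i = 1 \<or> i = 2" for i
      using that by (auto simp: S c1 c2 t_def anti)
    have h: "struc ?\<theta> ?\<epsilon> 3 1 2 x = t * ?f 3 1 2" "struc ?\<theta> ?\<epsilon> 3 2 1 x = - t * ?f 3 1 2"
       "struc ?\<theta> ?\<epsilon> 3 1 1 x = 0" "struc ?\<theta> ?\<epsilon> 3 2 2 x = 0"
      by (auto simp: S c1 c2 t_def anti)
    note gh = g[OF disjI1[OF refl]] g[OF disjI2[OF refl]] h
    show "?w' 1 1 2 = - ?f 1 1 2" unfolding conn_def gh by simp
    show "?w' 1 2 2 = - ?f 2 1 2" unfolding conn_def gh by simp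
    show "?w' 1 3 2 = (- ?f 2 1 3 + ?f 1 2 3) / (2 * t) - t * ?f 3 1 2 / 2"
      unfolding conn_def gh using t by (simp add: field_simps)
    show "?w' 1 1 3 = - ?f 1 1 3 / t" unfolding conn_def gh using t by (simp add: field_simps)
    show "?w' 2 2 3 = - ?f 2 2 3 / t" unfolding conn_def gh using t by (simp add: field_simps)
    show "?w' 1 2 3 = - (?f 1 2 3 + ?f 2 1 3) / (2 * t) - t * ?f 3 1 2 / 2"
      unfolding conn_def gh using t by (simp add: field_simps)
    show "?w' 2 1 3 = - (?f 1 2 3 + ?f 2 1 3) / (2 * t) + t * ?f 3 1 2 / 2"
      unfolding conn_def gh using t by (simp add: field_simps)
  qed
  have W0: "conn \<theta> \<epsilon> 1 1 2 x = - ?f 1 1 2" "conn \<theta> \<epsilon> 1 2 2 x = - ?f 2 1 2" 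
    "conn \<theta> \<epsilon> 1 3 2 x = (- ?f 2 1 3 + ?f 1 2 3) / 2 - ?f 3 1 2 / 2"
    "conn \<theta> \<epsilon> 1 1 3 x = - ?f 1 1 3" "conn \<theta> \<epsilon> 2 2 3 x = - ?f 2 2 3"
    "conn \<theta> \<epsilon> 1 2 3 x = - (?f 1 2 3 + ?f 2 1 3) / 2 - ?f 3 1 2 / 2"
    "conn \<theta> \<epsilon> 2 1 3 x = - (?f 1 2 3 + ?f 2 1 3) / 2 + ?f 3 1 2 / 2"
    by (simp_all add: conn_def anti field_simps)
  have anti': "conn \<theta>' \<epsilon>' 3 j 2 x = - conn \<theta>' \<epsilon>' 2 j 3 x" "conn \<theta>' \<epsilon>' i j i x = 0" for \<theta>' \<epsilon>' :: "3 \<Rightarrow> 'e \<Rightarrow> 'e" and i j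
    using conn_antisym[of \<theta>' \<epsilon>' 3 j 2 x] conn_antisym[of \<theta>' \<epsilon>' i j i x] by auto
  have S': "struc ?\<theta> ?\<epsilon> 1 1 2 x = ?f 1 1 2" "struc ?\<theta> ?\<epsilon> 2 1 2 x = ?f 2 1 2" "struc ?\<theta> ?\<epsilon> 3 1 2 x = t * ?f 3 1 2"
    by (simp_all add: S c1 c2 t_def)
  \<comment> \<open>The factor 3/4 in \<open>twist\<close> is 1/2 from the product of connection
    coefficient 1 3 2 with structure function 3 1 2, plus 1/4 from the product of the connection
    coefficients 1 2 3 and 2 1 3. The mixed terms of the first product do not depend on
    \<open>t\<close>.\<close>
  show ?thesis
    unfolding frame_curv_def sum_3 dw S' anti' W W0 shape_def twist_def t_def[symmetric]
    using t by (simp add: c1 c2 field_simps power2_eq_square)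
qed

subsection \<open>Change of coordinates\<close>

definition pull_form :: "('d::euclidean_space \<Rightarrow> 'e::euclidean_space) \<Rightarrow> ('e \<Rightarrow> 'e) \<Rightarrow> 'd \<Rightarrow> 'd" where
  "pull_form \<phi> a x = (\<Sum>b\<in>Basis. (a (\<phi> x) \<bullet> frechet_derivative \<phi> (at x) b) *\<^sub>R b)"

lemma inner_pull_form:
  assumes "\<phi> differentiable at x"
  shows "pull_form \<phi> a x \<bullet> u = a (\<phi> x) \<bullet> frechet_derivative \<phi> (at x) u"
  by (subst frechet_derivative_expand[OF assms, of u])
    (simp add: pull_form_def inner_sum_left inner_sum_right inner_commute[of u] mult.commute)

locale smooth_chart_change =
  fixes U W :: "'e::euclidean_space set" and \<phi> \<psi> :: "'e \<Rightarrow> 'e"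
  assumes smooth_\<phi>: "smooth_on U \<phi>" and smooth_\<psi>: "smooth_on W \<psi>"
    and maps: "\<phi> ` U = W" and inv: "\<And>x. x \<in> U \<Longrightarrow> \<psi> (\<phi> x) = x"
begin

abbreviation "D\<phi> x \<equiv> frechet_derivative \<phi> (at x)"
abbreviation "D\<psi> y \<equiv> frechet_derivative \<psi> (at y)"

lemma inv': "y \<in> W \<Longrightarrow> \<phi> (\<psi> y) = y" "y \<in> W \<Longrightarrow> \<psi> y \<in> U"
  using maps inv by force+

lemma deriv_inverse:
  assumes "x \<in> U" shows "D\<psi> (\<phi> x) (D\<phi> x u) = u" "D\<phi> x (D\<psi> (\<phi> x) u) = u"
proof -
  have p: "\<phi> x \<in> W" using maps assms by auto
  have "((\<lambda>x. \<psi> (\<phi> x)) has_derivative (\<lambda>u. D\<psi> (\<phi> x) (D\<phi> x u))) (at x)"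
    by (rule has_derivative_compose[OF smooth_on_has_derivative[OF smooth_\<phi> assms] smooth_on_has_derivative[OF smooth_\<psi> p]])
  then have "((\<lambda>x. x) has_derivative (\<lambda>u. D\<psi> (\<phi> x) (D\<phi> x u))) (at x)"
    by (rule has_derivative_transform_within_open[OF _ smooth_on_open[OF smooth_\<phi>] assms inv])
  from has_derivative_unique[OF this has_derivative_ident]
  show "D\<psi> (\<phi> x) (D\<phi> x u) = u" by (rule fun_cong)
  have "((\<lambda>y. \<phi> (\<psi> y)) has_derivative (\<lambda>u. D\<phi> (\<psi> (\<phi> x)) (D\<psi> (\<phi> x) u))) (at (\<phi> x))"
    by (rule has_derivative_compose[OF smooth_on_has_derivative[OF smooth_\<psi> p] smooth_on_has_derivative[OF smooth_\<phi> inv'(2)[OF p]]])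
  then have "((\<lambda>y. y) has_derivative (\<lambda>u. D\<phi> (\<psi> (\<phi> x)) (D\<psi> (\<phi> x) u))) (at (\<phi> x))"
    by (rule has_derivative_transform_within_open[OF _ smooth_on_open[OF smooth_\<psi>] p inv'(1)])
  from has_derivative_unique[OF this has_derivative_ident]
  show "D\<phi> x (D\<psi> (\<phi> x) u) = u" unfolding inv[OF assms] by (rule fun_cong)
qed

lemma smooth_on_pull_form:
  assumes "smooth_on W a" shows "smooth_on U (pull_form \<phi> a)"
  unfolding pull_form_def[abs_def]
  by (intro smooth_on_sum smooth_on_scaleR smooth_on_inner smooth_on_const smooth_on_open[OF smooth_\<phi>]
      smooth_on_frechet_derivative_const smooth_\<phi> smooth_on_compose[OF smooth_\<phi> assms]) (simp add: maps)

lemma inner_pull: "x \<in> U \<Longrightarrow> pull_form \<phi> a x \<bullet> u = a (\<phi> x) \<bullet> D\<phi> x u"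
  by (rule inner_pull_form) (rule smooth_on_differentiable[OF smooth_\<phi>])

text \<open>The second derivative of \<phi> is symmetric in \<open>u\<close> and \<open>v\<close>,
  so it disappears from the antisymmetrisation.\<close>

lemma ext_deriv_pull_form:
  assumes a: "smooth_on W a" and x: "x \<in> U"
  shows "ext_deriv (pull_form \<phi> a) x u v = ext_deriv a (\<phi> x) (D\<phi> x u) (D\<phi> x v)"
proof -
  have "frechet_derivative (pull_form \<phi> a) (at x) u \<bullet> v =
    a (\<phi> x) \<bullet> frechet_derivative (\<lambda>y. D\<phi> y v) (at x) u + frechet_derivative a (at (\<phi> x)) (D\<phi> x u) \<bullet> D\<phi> x v" for u v
  proof -
    have "\<phi> x \<in> W" using maps x by auto
    then have "((\<lambda>y. a (\<phi> y) \<bullet> D\<phi> y v) has_derivative (\<lambda>u. a (\<phi> x) \<bullet> frechet_derivative (\<lambda>y. D\<phi> y v) (at x) u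
       + frechet_derivative a (at (\<phi> x)) (D\<phi> x u) \<bullet> D\<phi> x v)) (at x)"
      by (intro has_derivative_inner smooth_on_has_derivative[OF smooth_on_frechet_derivative_const[OF smooth_\<phi>] x]
          has_derivative_compose[OF smooth_on_has_derivative[OF smooth_\<phi> x]] smooth_on_has_derivative[OF a])
    then have d: "((\<lambda>y. pull_form \<phi> a y \<bullet> v) has_derivative (\<lambda>u. a (\<phi> x) \<bullet> frechet_derivative (\<lambda>y. D\<phi> y v) (at x) u
       + frechet_derivative a (at (\<phi> x)) (D\<phi> x u) \<bullet> D\<phi> x v)) (at x)"
      by (rule has_derivative_transform_within_open[OF _ smooth_on_open[OF smooth_\<phi>] x]) (simp add: inner_pull)
    show ?thesis
      using fun_cong[OF has_derivative_unique[OF has_derivative_inner_left[OF smooth_on_has_derivative[OF smooth_on_pull_form[OF a] x]] d]] .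
  qed
  then show ?thesis
    using second_derivative_symmetric[OF smooth_\<phi> x, of u v] by (simp add: ext_deriv_def)
qed

definition pull_frame :: "('i \<Rightarrow> 'e \<Rightarrow> 'e) \<Rightarrow> 'i \<Rightarrow> 'e \<Rightarrow> 'e" where
  "pull_frame \<epsilon> i x = D\<psi> (\<phi> x) (\<epsilon> i (\<phi> x))"

lemma coframe_pull:
  assumes "coframe W \<theta> \<epsilon>"
  shows "coframe U (\<lambda>i. pull_form \<phi> (\<theta> i)) (pull_frame \<epsilon>)"
proof -
  interpret coframe W \<theta> \<epsilon> by fact
  show ?thesis
  proof
    show "smooth_on U (pull_form \<phi> (\<theta> i))" for i
      by (rule smooth_on_pull_form[OF smooth_coframe])
    show "smooth_on U (pull_frame \<epsilon> i)" for i
      unfolding pull_frame_def[abs_def]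
      by (rule smooth_on_fderiv[OF smooth_\<psi> smooth_\<phi> smooth_on_compose[OF smooth_\<phi> smooth_frame]]) (simp_all add: maps)
    show "pull_form \<phi> (\<theta> i) x \<bullet> pull_frame \<epsilon> j x = (if i = j then 1 else 0)" if "x \<in> U" for i j x
      using that maps by (auto simp: inner_pull pull_frame_def deriv_inverse dual)
    show "(\<Sum>i\<in>UNIV. (pull_form \<phi> (\<theta> i) x \<bullet> u) *\<^sub>R pull_frame \<epsilon> i x) = u" if "x \<in> U" for u x
    proof -
      have p: "\<phi> x \<in> W" using maps that by auto
      have l: "linear (D\<psi> (\<phi> x))"
        using smooth_on_differentiable[OF smooth_\<psi> p] linear_frechet_derivative by blast
      show ?thesis
        using deriv_inverse(1)[OF that, of u] expand[OF p, of "D\<phi> x u"]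
        by (simp add: inner_pull that pull_frame_def linear_scale[OF l, symmetric] linear_sum[OF l, symmetric])
    qed
  qed
qed

context
  fixes \<theta> \<epsilon> :: "'i::finite \<Rightarrow> 'e \<Rightarrow> 'e"
  assumes cof: "coframe W \<theta> \<epsilon>"
begin

lemma struc_pull: "x \<in> U \<Longrightarrow> struc (\<lambda>i. pull_form \<phi> (\<theta> i)) (pull_frame \<epsilon>) i j k x = struc \<theta> \<epsilon> i j k (\<phi> x)"
  unfolding struc_def pull_frame_def
  by (simp add: ext_deriv_pull_form[OF coframe.smooth_coframe[OF cof]] deriv_inverse)

lemma conn_pull: "x \<in> U \<Longrightarrow> conn (\<lambda>i. pull_form \<phi> (\<theta> i)) (pull_frame \<epsilon>) i j k x = conn \<theta> \<epsilon> i j k (\<phi> x)"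
  by (simp add: conn_def struc_pull)

lemma conn_derivative_pull:
  assumes x: "x \<in> U"
  shows "frechet_derivative (conn (\<lambda>i. pull_form \<phi> (\<theta> i)) (pull_frame \<epsilon>) i j k) (at x) (pull_frame \<epsilon> l x)
    = frechet_derivative (conn \<theta> \<epsilon> i j k) (at (\<phi> x)) (\<epsilon> l (\<phi> x))"
proof -
  have p: "\<phi> x \<in> W" using maps x by auto
  have "((\<lambda>y. conn \<theta> \<epsilon> i j k (\<phi> y)) has_derivative (\<lambda>u. frechet_derivative (conn \<theta> \<epsilon> i j k) (at (\<phi> x)) (D\<phi> x u))) (at x)"
    by (rule has_derivative_compose[OF smooth_on_has_derivative[OF smooth_\<phi> x]
        smooth_on_has_derivative[OF coframe.smooth_on_conn[OF cof] p]])
  then have "(conn (\<lambda>i. pull_form \<phi> (\<theta> i)) (pull_frame \<epsilon>) i j k has_derivative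
      (\<lambda>u. frechet_derivative (conn \<theta> \<epsilon> i j k) (at (\<phi> x)) (D\<phi> x u))) (at x)"
    by (rule has_derivative_transform_within_open[OF _ smooth_on_open[OF smooth_\<phi>] x]) (simp add: conn_pull)
  from frechet_derivative_at[OF this, symmetric] show ?thesis
    by (simp add: pull_frame_def deriv_inverse x)
qed

end

text \<open>Every ingredient is a structure function, a combination of such, or a derivative of one
  along a frame vector, and each of these is carried along by the coordinate change.\<close>

lemma frame_curv_pull:
  assumes "coframe W \<theta> \<epsilon>" "x \<in> U"
  shows "frame_curv (\<lambda>i. pull_form \<phi> (\<theta> i)) (pull_frame \<epsilon>) x = frame_curv \<theta> \<epsilon> (\<phi> x)"
  unfolding frame_curv_def conn_derivative_pull[OF assms] conn_pull[OF assms] struc_pull[OF assms] ..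

lemma coframe_metric_pull:
  "x \<in> U \<Longrightarrow> coframe_metric (\<lambda>i. pull_form \<phi> (\<theta> i)) x u v = coframe_metric \<theta> (\<phi> x) (D\<phi> x u) (D\<phi> x v)"
  by (simp add: coframe_metric_def inner_pull)

end

section \<open>Coframes on manifolds\<close>

text \<open>The coordinate expression of a metric agrees with a coframe metric only near a point.
  Since derivatives are local, the agreement passes to \<open>christoffel\<close> on all of
  \<open>V\<close>, and from there to the iterated connection at \<open>x\<close>.\<close>

lemma sec_curv_local:
  assumes V: "open V" "x \<in> V" and eq: "\<And>y u v. y \<in> V \<Longrightarrow> G y u v = H y u v"
  shows "sec_curv G x u v = sec_curv H x u v"
proof -
  have chr: "christoffel G y = christoffel H y" if "y \<in> V" for y
  proof -
    have "frechet_derivative (\<lambda>y. G y u v) (at y) = frechet_derivative (\<lambda>y. H y u v) (at y)" for u v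
      by (rule frechet_derivative_local[OF V(1) that eq])
    then show ?thesis by (simp add: christoffel_def fun_eq_iff eq that)
  qed
  have lc: "levi_civita G X Y y = levi_civita H X Y y" if "y \<in> V" for X Y y
    by (simp add: levi_civita_def chr that)
  have "levi_civita G (\<lambda>_. c) (levi_civita G X Y) x = levi_civita H (\<lambda>_. c) (levi_civita H X Y) x" for c X Y
    unfolding levi_civita_def[of _ "\<lambda>_. c"] chr[OF V(2)] lc[OF V(2)]
    using frechet_derivative_local[OF V lc] by simp
  then have "riemann G (\<lambda>_. u) (\<lambda>_. v) (\<lambda>_. v) x = riemann H (\<lambda>_. u) (\<lambda>_. v) (\<lambda>_. v) x"
    unfolding riemann_def by (simp add: lc V)
  then show ?thesis unfolding sec_curv_def by (simp add: eq V)
qed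

lemma independent_pair:
  fixes u v :: "'v::real_vector"
  shows "u \<noteq> v \<and> independent {u, v} \<longleftrightarrow> (\<forall>a b. a *\<^sub>R u + b *\<^sub>R v = 0 \<longrightarrow> a = 0 \<and> b = 0)"
proof (cases "u = v")
  case True
  have "1 *\<^sub>R u + (-1) *\<^sub>R v = 0" using True by simp
  then show ?thesis using True by (metis zero_neq_one)
next
  case False
  have "independent {u, v} \<longleftrightarrow> (\<forall>f. f u *\<^sub>R u + f v *\<^sub>R v = 0 \<longrightarrow> f u = (0::real) \<and> f v = 0)"
    using False dependent_finite[of "{u, v}"] by auto
  also have "\<dots> \<longleftrightarrow> (\<forall>a b. a *\<^sub>R u + b *\<^sub>R v = 0 \<longrightarrow> a = 0 \<and> b = 0)"
  proof (intro iffI allI impI)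
    fix a b assume h: "\<forall>f. f u *\<^sub>R u + f v *\<^sub>R v = 0 \<longrightarrow> f u = (0::real) \<and> f v = 0"
      and "a *\<^sub>R u + b *\<^sub>R v = 0"
    then show "a = 0 \<and> b = 0" using h[rule_format, of "\<lambda>w. if w = u then a else b"] False by auto
  qed auto
  finally show ?thesis using False by simp
qed

context coframe
begin

lemma coframe_subset: "open T \<Longrightarrow> T \<subseteq> V \<Longrightarrow> coframe T \<theta> \<epsilon>"
  using dual expand by unfold_locales (auto intro: smooth_on_subset smooth_coframe smooth_frame)

lemma smooth_on_coframe_metric: "smooth_on V (\<lambda>x. coframe_metric \<theta> x u v)"
  unfolding coframe_metric_def
  by (intro smooth_on_sum smooth_on_mult smooth_on_inner smooth_on_const smooth_coframe open_domain)

end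

lemma smooth_on_frame_curv:
  assumes "coframe V \<theta> \<epsilon>" shows "smooth_on V (frame_curv \<theta> \<epsilon>)"
proof -
  interpret coframe V \<theta> \<epsilon> by fact
  show ?thesis
    unfolding frame_curv_def[abs_def]
    by (intro smooth_on_add smooth_on_diff smooth_on_sum smooth_on_mult smooth_on_frechet_derivative
        smooth_on_conn smooth_on_struc smooth_frame open_domain)
qed

section \<open>Jacobians of charts, and curvature of plane fields on the manifold\<close>

abbreviation "inv_chart c \<equiv> inv_into (fst c) (snd c)"

definition jac :: "'a chart \<Rightarrow> 'a chart \<Rightarrow> 'a \<Rightarrow> real^3 \<Rightarrow> real^3" where
  "jac c d p = frechet_derivative (transition c d) (at (snd c p))"

text \<open>Index 3 is reserved for the conormal of \<xi>, so that indices 1 and 2 belong to the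
  plane measured by \<open>frame_curv\<close>.\<close>

definition local_coframe :: "'a atlas \<Rightarrow> ('a \<Rightarrow> real^3 \<Rightarrow> real^3 \<Rightarrow> real) \<Rightarrow> ('a \<Rightarrow> (real^3) set) \<Rightarrow> 'a chart \<Rightarrow>
    (real^3) set \<Rightarrow> (3 \<Rightarrow> real^3 \<Rightarrow> real^3) \<Rightarrow> (3 \<Rightarrow> real^3 \<Rightarrow> real^3) \<Rightarrow> bool" where
  "local_coframe A g \<xi> c V \<theta> \<epsilon> \<longleftrightarrow> c \<in> A \<and> V \<subseteq> snd c ` fst c \<and> coframe V \<theta> \<epsilon> \<and>
    (\<forall>p\<in>fst c. snd c p \<in> V \<longrightarrow>
      (\<forall>u v. g p (from_chart A c p u) (from_chart A c p v) = coframe_metric \<theta> (snd c p) u v) \<and>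
      (\<forall>u. from_chart A c p u \<in> \<xi> p \<longleftrightarrow> \<theta> 3 (snd c p) \<bullet> u = 0))"

locale smooth_manifold =
  fixes A :: "'a::topological_space atlas"
  assumes atlas: "smooth_atlas A"
begin

lemma chart_at: "chart_at A p \<in> A" "p \<in> fst (chart_at A p)"
proof -
  have "p \<in> (\<Union>c\<in>A. fst c)" using atlas by (simp add: smooth_atlas_def)
  then have "\<exists>c. c \<in> A \<and> p \<in> fst c" by blast
  from someI_ex[OF this] show "chart_at A p \<in> A" "p \<in> fst (chart_at A p)"
    by (simp_all add: chart_at_def)
qed

context
  fixes c assumes c: "c \<in> A"
begin

lemma chart_homeo: "homeomorphism (fst c) (snd c ` fst c) (snd c) (inv_chart c)"
  and open_chart: "open (fst c)" and open_chart_image: "open (snd c ` fst c)"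
  using atlas c by (auto simp: smooth_atlas_def is_chart_def)

lemma inv_chart: "p \<in> fst c \<Longrightarrow> inv_chart c (snd c p) = p"
  using chart_homeo by (simp add: homeomorphism_def)

lemma chart_inv: "x \<in> snd c ` fst c \<Longrightarrow> snd c (inv_chart c x) = x" "x \<in> snd c ` fst c \<Longrightarrow> inv_chart c x \<in> fst c"
  by (auto simp: f_inv_into_f inv_into_into)

lemma open_chart_preimage:
  assumes "open V" shows "open {p \<in> fst c. snd c p \<in> V}"
proof -
  have "continuous_on (fst c) (snd c)" using chart_homeo by (simp add: homeomorphism_def)
  from continuous_open_preimage[OF this open_chart assms] show ?thesis
    by (simp add: Int_def vimage_def)
qed

lemma open_image_chart:
  assumes "open N" "N \<subseteq> fst c" shows "open (snd c ` N)"
proof -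
  have "continuous_on (snd c ` fst c) (inv_chart c)" using chart_homeo by (simp add: homeomorphism_def)
  from continuous_open_preimage[OF this open_chart_image assms(1)]
  have "open (snd c ` fst c \<inter> inv_chart c -` N)" .
  also have "snd c ` fst c \<inter> inv_chart c -` N = snd c ` N"
    using assms(2) inv_chart by (auto simp: subset_iff)
  finally show ?thesis .
qed

lemma transition_chart: "p \<in> fst c \<Longrightarrow> transition c d (snd c p) = snd d p"
  by (simp add: transition_def inv_chart)

lemma smooth_on_transition: "d \<in> A \<Longrightarrow> smooth_on (snd c ` (fst c \<inter> fst d)) (transition c d)"
  using atlas c by (auto simp: smooth_atlas_def)

end

lemma chart_change:
  assumes c: "c \<in> A" and d: "d \<in> A" and N: "open N" "N \<subseteq> fst c \<inter> fst d"
  shows "smooth_chart_change (snd c ` N) (snd d ` N) (transition c d) (transition d c)"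
proof
  show "smooth_on (snd c ` N) (transition c d)"
    using N by (intro smooth_on_subset[OF smooth_on_transition[OF c d]] open_image_chart c) auto
  show "smooth_on (snd d ` N) (transition d c)"
    using N by (intro smooth_on_subset[OF smooth_on_transition[OF d c]] open_image_chart d) auto
  show "transition c d ` snd c ` N = snd d ` N"
    unfolding image_image by (rule image_cong[OF refl], rule transition_chart[OF c]) (use N in auto)
  show "transition d c (transition c d x) = x" if "x \<in> snd c ` N" for x
  proof -
    obtain p where p: "p \<in> N" "x = snd c p" using \<open>x \<in> snd c ` N\<close> by blast
    then have "p \<in> fst c" "p \<in> fst d" using N by auto
    then show ?thesis by (simp add: p(2) transition_chart c d)
  qed
qed

lemma jac_has_derivative:
  assumes "c \<in> A" "d \<in> A" "p \<in> fst c" "p \<in> fst d"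
  shows "(transition c d has_derivative jac c d p) (at (snd c p))"
  unfolding jac_def using assms by (intro smooth_on_has_derivative[OF smooth_on_transition]) auto

lemma linear_jac: "c \<in> A \<Longrightarrow> d \<in> A \<Longrightarrow> p \<in> fst c \<Longrightarrow> p \<in> fst d \<Longrightarrow> linear (jac c d p)"
  using jac_has_derivative has_derivative_linear by blast

text \<open>The chain rule for transition maps. \<open>from_chart\<close> and
  \<open>to_chart\<close> are Jacobians out of and into one chart, so the conversion rules below are
  all instances.\<close>

lemma jac_jac:
  assumes cdh: "c \<in> A" "d \<in> A" "h \<in> A" and p: "p \<in> fst c" "p \<in> fst d" "p \<in> fst h"
  shows "jac d h p (jac c d p u) = jac c h p u"
proof -
  have "((\<lambda>x. transition d h (transition c d x)) has_derivative (\<lambda>u. jac d h p (jac c d p u))) (at (snd c p))"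
    using jac_has_derivative[OF cdh(2,3) p(2,3)]
    by (intro has_derivative_compose[OF jac_has_derivative[OF cdh(1,2) p(1,2)]])
      (simp add: transition_chart[OF cdh(1) p(1)])
  moreover have "open (snd c ` (fst c \<inter> fst d))"
    by (intro open_image_chart cdh open_Int open_chart) auto
  ultimately have "(transition c h has_derivative (\<lambda>u. jac d h p (jac c d p u))) (at (snd c p))"
    by (rule has_derivative_transform_within_open) (use cdh p in \<open>auto simp: transition_chart\<close>)
  from fun_cong[OF has_derivative_unique[OF this jac_has_derivative[OF cdh(1,3) p(1,3)]]] show ?thesis .
qed

lemma jac_self:
  assumes "c \<in> A" "p \<in> fst c" shows "jac c c p u = u"
proof -
  have "((\<lambda>x. x) has_derivative (\<lambda>u. u)) (at (snd c p))" by (rule has_derivative_ident)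
  then have "(transition c c has_derivative (\<lambda>u. u)) (at (snd c p))"
    by (rule has_derivative_transform_within_open[OF _ open_chart_image[OF assms(1)]])
      (use assms in \<open>auto simp: transition_chart\<close>)
  from fun_cong[OF has_derivative_unique[OF this jac_has_derivative[OF assms(1,1,2,2)]]] show ?thesis ..
qed

lemma from_chart_jac: "c \<in> A \<Longrightarrow> d \<in> A \<Longrightarrow> p \<in> fst c \<Longrightarrow> p \<in> fst d \<Longrightarrow> from_chart A d p (jac c d p u) = from_chart A c p u"
  unfolding from_chart_def jac_def[symmetric] by (intro jac_jac chart_at)

lemma to_chart_from_chart: "c \<in> A \<Longrightarrow> d \<in> A \<Longrightarrow> p \<in> fst c \<Longrightarrow> p \<in> fst d \<Longrightarrow> to_chart A d p (from_chart A c p u) = jac c d p u"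
  unfolding from_chart_def to_chart_def jac_def[symmetric] by (intro jac_jac chart_at)

lemma from_chart_to_chart: "c \<in> A \<Longrightarrow> p \<in> fst c \<Longrightarrow> from_chart A c p (to_chart A c p u) = u"
  unfolding from_chart_def to_chart_def jac_def[symmetric]
  by (simp add: jac_jac jac_self chart_at)

lemma from_chart_at: "from_chart A (chart_at A p) p u = u"
  unfolding from_chart_def jac_def[symmetric] by (intro jac_self chart_at)

lemma linear_from_chart: "c \<in> A \<Longrightarrow> p \<in> fst c \<Longrightarrow> linear (from_chart A c p)"
  unfolding from_chart_def jac_def[symmetric] by (intro linear_jac chart_at)

lemma linear_to_chart: "c \<in> A \<Longrightarrow> p \<in> fst c \<Longrightarrow> linear (to_chart A c p)"
  unfolding to_chart_def jac_def[symmetric] by (intro linear_jac chart_at)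

text \<open>\<open>sectional_curvature\<close> is evaluated in \<open>chart_at A p\<close>, whereas
  smoothness is tested in a fixed chart. Pulling the coframe back along the transition map connects
  the two without changing its curvature.\<close>

lemma local_coframe_transport:
  assumes L: "local_coframe A g \<xi> c V \<theta> \<epsilon>" and p: "p \<in> fst c" "snd c p \<in> V" and d: "d \<in> A" "p \<in> fst d"
  shows "\<exists>V' \<theta>' \<epsilon>'. local_coframe A g \<xi> d V' \<theta>' \<epsilon>' \<and> snd d p \<in> V' \<and>
    frame_curv \<theta>' \<epsilon>' (snd d p) = frame_curv \<theta> \<epsilon> (snd c p)"
proof -
  have c: "c \<in> A" and V: "V \<subseteq> snd c ` fst c" and cof: "coframe V \<theta> \<epsilon>"
    using L by (auto simp: local_coframe_def)
  interpret V: coframe V \<theta> \<epsilon> by fact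
  define N where "N = fst d \<inter> {q \<in> fst c. snd c q \<in> V}"
  have N: "open N" "N \<subseteq> fst d \<inter> fst c"
    by (auto simp: N_def intro: open_Int open_chart open_chart_preimage c d V.open_domain)
  interpret smooth_chart_change "snd d ` N" "snd c ` N" "transition d c" "transition c d"
    by (rule chart_change[OF d(1) c N])
  have cN: "coframe (snd c ` N) \<theta> \<epsilon>"
    by (rule V.coframe_subset) (auto simp: N_def intro!: open_image_chart[OF c] N[unfolded N_def])
  have tr: "transition d c (snd d q) = snd c q" if "q \<in> N" for q
    using that N by (auto intro: transition_chart d)
  have "local_coframe A g \<xi> d (snd d ` N) (\<lambda>i. pull_form (transition d c) (\<theta> i)) (pull_frame \<epsilon>)"
    unfolding local_coframe_def
  proof (intro conjI ballI impI allI d(1) coframe_pull[OF cN])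
    show "snd d ` N \<subseteq> snd d ` fst d" using N by auto
    fix q u v assume q: "q \<in> fst d" "snd d q \<in> snd d ` N"
    then obtain q'' where "q'' \<in> N" "snd d q = snd d q''" by auto
    then have qN: "q \<in> N" using inv_chart[OF d(1)] N(2) q(1) by (metis IntD1 subsetD)
    then have q': "q \<in> fst c" "snd c q \<in> V" by (auto simp: N_def)
    have fr: "from_chart A d q u = from_chart A c q (frechet_derivative (transition d c) (at (snd d q)) u)" for u
      using from_chart_jac[OF d(1) c q(1) q'(1), of u] by (simp add: jac_def)
    show "g q (from_chart A d q u) (from_chart A d q v) =
      coframe_metric (\<lambda>i. pull_form (transition d c) (\<theta> i)) (snd d q) u v"
      using L q' by (simp add: fr coframe_metric_pull q tr qN local_coframe_def)
    show "(from_chart A d q u \<in> \<xi> q) = (pull_form (transition d c) (\<theta> 3) (snd d q) \<bullet> u = 0)"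
      using L q' by (simp add: fr inner_pull q tr qN local_coframe_def)
  qed
  moreover have "p \<in> N" using p d by (simp add: N_def)
  ultimately show ?thesis
    using frame_curv_pull[OF cN] tr[of p] by (metis imageI)
qed

text \<open>The description by \<open>THE\<close> is meaningful because every basis of the plane
  yields the same \<open>frame_curv\<close>, and because a basis exists, namely the first two frame
  vectors.\<close>

lemma sectional_curvature_eq:
  assumes L: "local_coframe A g \<xi> c V \<theta> \<epsilon>" and p: "p \<in> fst c" "snd c p \<in> V"
  shows "sectional_curvature A g \<xi> p = frame_curv \<theta> \<epsilon> (snd c p)"
proof -
  define d where "d = chart_at A p"
  have d: "d \<in> A" "p \<in> fst d" by (simp_all add: d_def chart_at)
  obtain V' \<theta>' \<epsilon>' where L': "local_coframe A g \<xi> d V' \<theta>' \<epsilon>'" and x: "snd d p \<in> V'"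
    and fc: "frame_curv \<theta>' \<epsilon>' (snd d p) = frame_curv \<theta> \<epsilon> (snd c p)"
    using local_coframe_transport[OF L p d] by blast
  interpret coframe V' \<theta>' \<epsilon>' using L' by (simp add: local_coframe_def)
  let ?x = "snd d p"
  have \<xi>: "u \<in> \<xi> p \<longleftrightarrow> \<theta>' 3 ?x \<bullet> u = 0" for u
  proof -
    have "from_chart A d p u \<in> \<xi> p \<longleftrightarrow> \<theta>' 3 ?x \<bullet> u = 0" using L' d x by (simp add: local_coframe_def)
    then show ?thesis using from_chart_at[of p u] by (simp add: d_def)
  qed
  have G: "metric_in_chart A d g y u v = coframe_metric \<theta>' y u v" if "y \<in> V'" for y u v
    using L' that chart_inv[OF d(1), of y]
    by (force simp: local_coframe_def metric_in_chart_def Let_def)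
  have sec: "sec_curv (metric_in_chart A d g) ?x u v = frame_curv \<theta> \<epsilon> (snd c p)"
    if b: "basis_of_plane (\<xi> p) u v" for u v
  proof -
    have ind: "\<And>a b. a *\<^sub>R u + b *\<^sub>R v = 0 \<Longrightarrow> a = 0 \<and> b = 0"
      using b independent_pair[of u v] unfolding basis_of_plane_def by blast
    have "u \<in> \<xi> p" "v \<in> \<xi> p"
      using b span_base[of _ "{u, v}"] by (auto simp: basis_of_plane_def)
    then have uv: "\<theta>' 3 ?x \<bullet> u = 0" "\<theta>' 3 ?x \<bullet> v = 0" by (simp_all add: \<xi>)
    have "(\<theta>' 1 ?x \<bullet> u) * (\<theta>' 2 ?x \<bullet> v) - (\<theta>' 2 ?x \<bullet> u) * (\<theta>' 1 ?x \<bullet> v) \<noteq> 0"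
    proof
      assume z: "(\<theta>' 1 ?x \<bullet> u) * (\<theta>' 2 ?x \<bullet> v) - (\<theta>' 2 ?x \<bullet> u) * (\<theta>' 1 ?x \<bullet> v) = 0"
      have three: "(\<forall>i::3. P i) \<longleftrightarrow> P 1 \<and> P 2 \<and> P 3" for P by (rule forall_3)
      \<comment> \<open>All three forms kill this combination, so it is zero, and independence makes
        its coefficients vanish.\<close>
      have "(\<theta>' 1 ?x \<bullet> v) *\<^sub>R u + (- (\<theta>' 1 ?x \<bullet> u)) *\<^sub>R v = 0"
        by (rule coframe_eqI[OF x], rule three[THEN iffD2, rule_format])
          (use z uv in \<open>auto simp: inner_diff_right algebra_simps\<close>)
      from ind[OF this] have 1: "\<theta>' 1 ?x \<bullet> u = 0" by simp
      have "(\<theta>' 2 ?x \<bullet> v) *\<^sub>R u + (- (\<theta>' 2 ?x \<bullet> u)) *\<^sub>R v = 0"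
        by (rule coframe_eqI[OF x], rule three[THEN iffD2, rule_format])
          (use z uv in \<open>auto simp: inner_diff_right algebra_simps\<close>)
      from ind[OF this] have 2: "\<theta>' 2 ?x \<bullet> u = 0" by simp
      have "u = 0"
        by (rule coframe_eqI[OF x], rule three[THEN iffD2, rule_format]) (use 1 2 uv in auto)
      then show False using ind[of 1 0] by simp
    qed
    from sec_curv_coframe[OF coframe_axioms x uv this] show ?thesis
      by (simp add: sec_curv_local[OF open_domain x G] fc)
  qed
  have basis: "basis_of_plane (\<xi> p) (\<epsilon>' 1 ?x) (\<epsilon>' 2 ?x)"
    unfolding basis_of_plane_def
  proof (intro conjI)
    have "a = 0 \<and> b = 0" if "a *\<^sub>R \<epsilon>' 1 ?x + b *\<^sub>R \<epsilon>' 2 ?x = 0" for a b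
    proof -
      have "\<theta>' 1 ?x \<bullet> (a *\<^sub>R \<epsilon>' 1 ?x + b *\<^sub>R \<epsilon>' 2 ?x) = a" "\<theta>' 2 ?x \<bullet> (a *\<^sub>R \<epsilon>' 1 ?x + b *\<^sub>R \<epsilon>' 2 ?x) = b"
        by (simp_all add: inner_add_right dual[OF x])
      then show ?thesis unfolding \<open>a *\<^sub>R \<epsilon>' 1 ?x + b *\<^sub>R \<epsilon>' 2 ?x = 0\<close> by simp
    qed
    then have "\<epsilon>' 1 ?x \<noteq> \<epsilon>' 2 ?x \<and> independent {\<epsilon>' 1 ?x, \<epsilon>' 2 ?x}" unfolding independent_pair by blast
    then show "\<epsilon>' 1 ?x \<noteq> \<epsilon>' 2 ?x" "independent {\<epsilon>' 1 ?x, \<epsilon>' 2 ?x}" by auto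
    show "span {\<epsilon>' 1 ?x, \<epsilon>' 2 ?x} = \<xi> p"
    proof (intro equalityI subsetI)
      fix w assume "w \<in> span {\<epsilon>' 1 ?x, \<epsilon>' 2 ?x}"
      then obtain a b where "w = a *\<^sub>R \<epsilon>' 1 ?x + b *\<^sub>R \<epsilon>' 2 ?x"
        by (auto simp: span_insert algebra_simps)
      then show "w \<in> \<xi> p" by (simp add: \<xi> inner_add_right dual[OF x])
    next
      fix w assume "w \<in> \<xi> p"
      then have "w = (\<theta>' 1 ?x \<bullet> w) *\<^sub>R \<epsilon>' 1 ?x + (\<theta>' 2 ?x \<bullet> w) *\<^sub>R \<epsilon>' 2 ?x"
        using expand[OF x, of w] by (simp add: \<xi> sum_3)
      then show "w \<in> span {\<epsilon>' 1 ?x, \<epsilon>' 2 ?x}"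
        by (metis insertI1 insertI2 span_add span_base span_scale)
    qed
  qed
  show ?thesis
    unfolding sectional_curvature_def Let_def d_def[symmetric]
    using sec basis by (intro the_equality) metis+
qed

text \<open>Although \<open>chart_at\<close> jumps, near each point the function is
  \<open>frame_curv\<close> of a single coframe living in the chart in which smoothness is
  tested.\<close>

lemma smooth_sectional_curvature:
  assumes "\<And>p. \<exists>c V \<theta> \<epsilon>. local_coframe A g \<xi> c V \<theta> \<epsilon> \<and> p \<in> fst c \<and> snd c p \<in> V"
  shows "smooth_function A (sectional_curvature A g \<xi>)"
  unfolding smooth_function_def
proof (intro ballI smooth_on_local)
  fix d x assume d: "d \<in> A" and "x \<in> snd d ` fst d"
  then obtain p where p: "p \<in> fst d" "x = snd d p" by auto
  obtain V \<theta> \<epsilon> where L: "local_coframe A g \<xi> d V \<theta> \<epsilon>" "snd d p \<in> V"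
    using assms[of p] local_coframe_transport d p by metis
  have V: "V \<subseteq> snd d ` fst d" using L by (simp add: local_coframe_def)
  have "smooth_on V (frame_curv \<theta> \<epsilon>)"
    using L by (intro smooth_on_frame_curv) (simp add: local_coframe_def)
  then have "smooth_on V (sectional_curvature A g \<xi> \<circ> inv_chart d)"
    by (rule smooth_on_cong) (use V in \<open>simp add: sectional_curvature_eq[OF L(1)] chart_inv d subset_iff\<close>)
  then show "\<exists>U. x \<in> U \<and> U \<subseteq> snd d ` fst d \<and> smooth_on U (sectional_curvature A g \<xi> \<circ> inv_chart d)"
    using V L(2) p(2) by auto
qed

lemma riemannian_metricI:
  assumes "\<And>p. inner_product (g p)"
    and "\<And>p. \<exists>c V \<theta> \<epsilon>. local_coframe A g \<xi> c V \<theta> \<epsilon> \<and> p \<in> fst c \<and> snd c p \<in> V"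
  shows "riemannian_metric A g"
  unfolding riemannian_metric_def
proof (intro conjI allI ballI assms(1) smooth_on_local)
  fix d u v x assume d: "d \<in> A" and "x \<in> snd d ` fst d"
  then obtain p where p: "p \<in> fst d" "x = snd d p" by auto
  obtain V \<theta> \<epsilon> where L: "local_coframe A g \<xi> d V \<theta> \<epsilon>" "snd d p \<in> V"
    using assms(2)[of p] local_coframe_transport d p by metis
  have V: "V \<subseteq> snd d ` fst d" using L by (simp add: local_coframe_def)
  have "smooth_on V (\<lambda>y. coframe_metric \<theta> y u v)"
    using L by (intro coframe.smooth_on_coframe_metric) (auto simp: local_coframe_def)
  then have "smooth_on V (\<lambda>y. metric_in_chart A d g y u v)"
    by (rule smooth_on_cong)
      (use L V in \<open>auto simp: local_coframe_def metric_in_chart_def Let_def chart_inv d subset_iff\<close>)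
  then show "\<exists>U. x \<in> U \<and> U \<subseteq> snd d ` fst d \<and> smooth_on U (\<lambda>y. metric_in_chart A d g y u v)"
    using V L(2) p(2) by auto
qed

end

section \<open>Existence of Riemannian metrics\<close>

context smooth_manifold
begin

text \<open>The Euclidean metric of the chart \<open>c\<close>, cut off outside the ball of radius
  \<open>r\<close> around \<open>x\<close>. The squared distance makes the argument of
  \<open>bump\<close> smooth also at the centre.\<close>

definition bump_metric :: "'a chart \<Rightarrow> real^3 \<Rightarrow> real \<Rightarrow> 'a \<Rightarrow> real^3 \<Rightarrow> real^3 \<Rightarrow> real" where
  "bump_metric c x r q u v = (if q \<in> fst c
     then bump (r\<^sup>2 - (snd c q - x) \<bullet> (snd c q - x)) * (to_chart A c q u \<bullet> to_chart A c q v) else 0)"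

lemma bilinear_bump_metric:
  assumes "c \<in> A"
  shows "bilinear (bump_metric c x r q)"
proof (cases "q \<in> fst c")
  case True
  note l = linear_to_chart[OF assms True]
  show ?thesis
    unfolding bilinear_def bump_metric_def using True
    by (auto intro!: linearI simp: linear_add[OF l] linear_scale[OF l] inner_add_left inner_add_right algebra_simps)
next
  case False
  then show ?thesis unfolding bilinear_def bump_metric_def by (auto intro!: linearI)
qed

lemma bump_metric_sym: "bump_metric c x r q u v = bump_metric c x r q v u"
  by (simp add: bump_metric_def inner_commute)

lemma bump_metric_nonneg: "bump_metric c x r q u u \<ge> 0"
  by (simp add: bump_metric_def bump_nonneg)

lemma bump_metric_pos:
  assumes c: "c \<in> A" and q: "q \<in> fst c" "snd c q \<in> ball x r" and u: "u \<noteq> 0"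
  shows "bump_metric c x r q u u > 0"
proof -
  have "to_chart A c q u \<noteq> 0"
    using from_chart_to_chart[OF c q(1), of u] u linear_0[OF linear_from_chart[OF c q(1)]] by metis
  moreover have "(snd c q - x) \<bullet> (snd c q - x) < r\<^sup>2"
    using q(2) by (simp add: dot_square_norm dist_norm norm_minus_commute power_strict_mono)
  ultimately show ?thesis using q(1) by (simp add: bump_metric_def bump_pos)
qed

end

text \<open>The delicate points are those outside the domain of \<open>c\<close>. The preimage of
  the closed ball is compact, hence closed by the Hausdorff property, and the cut-off form vanishes
  on its open complement.\<close>

lemma smooth_bump_metric:
  fixes A :: "'a::t2_space atlas"
  assumes "smooth_manifold A"
  assumes c: "c \<in> A" and r: "cball x r \<subseteq> snd c ` fst c" "r > 0" and d: "d \<in> A"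
  shows "smooth_on (snd d ` fst d) (\<lambda>y. metric_in_chart A d (smooth_manifold.bump_metric A c x r) y u v)"
proof -
  interpret smooth_manifold A by fact
  show ?thesis
  proof (rule smooth_on_local)
  fix y assume "y \<in> snd d ` fst d"
  then obtain q where q: "q \<in> fst d" "y = snd d q" by auto
  show "\<exists>U. y \<in> U \<and> U \<subseteq> snd d ` fst d \<and> smooth_on U (\<lambda>y. metric_in_chart A d (bump_metric c x r) y u v)"
  proof (cases "q \<in> fst c")
    case True
    let ?U = "snd d ` (fst d \<inter> fst c)" and ?\<phi> = "transition d c"
    let ?F = "\<lambda>y. bump (r\<^sup>2 - (?\<phi> y - x) \<bullet> (?\<phi> y - x)) *
      (frechet_derivative ?\<phi> (at y) u \<bullet> frechet_derivative ?\<phi> (at y) v)"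
    have \<phi>: "smooth_on ?U ?\<phi>" by (rule smooth_on_transition[OF d c])
    note o = smooth_on_open[OF \<phi>]
    have "smooth_on ?U ?F"
      by (intro smooth_on_mult smooth_on_inner smooth_on_frechet_derivative_const \<phi>
          smooth_on_compose[OF _ smooth_on_bump] smooth_on_diff smooth_on_const o) auto
    then have "smooth_on ?U (\<lambda>y. metric_in_chart A d (bump_metric c x r) y u v)"
    proof (rule smooth_on_cong)
      fix z assume "z \<in> ?U"
      then obtain p where p: "p \<in> fst d" "p \<in> fst c" "z = snd d p" by auto
      then show "?F z = metric_in_chart A d (bump_metric c x r) z u v"
        using inv_chart[OF d p(1)]
        by (simp add: metric_in_chart_def Let_def bump_metric_def to_chart_from_chart[OF d c]
            transition_chart[OF d] jac_def)
    qed
    moreover have "y \<in> ?U" "?U \<subseteq> snd d ` fst d" using q True by auto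
    ultimately show ?thesis by (intro exI[of _ ?U] conjI)
  next
    case False
    define K where "K = inv_chart c ` cball x r"
    have "compact K"
      unfolding K_def using chart_homeo[OF c] r(1)
      by (intro compact_continuous_image) (auto simp: homeomorphism_def intro: continuous_on_subset)
    then have oK: "open (fst d - K)" using compact_imp_closed open_chart[OF d] by blast
    let ?U = "snd d ` (fst d - K)"
    have o: "open ?U" by (intro open_image_chart[OF d oK]) auto
    have "q \<notin> K" using False r(1) chart_inv[OF c] by (auto simp: K_def)
    have "smooth_on ?U (\<lambda>y. metric_in_chart A d (bump_metric c x r) y u v)"
    proof (rule smooth_on_cong[OF smooth_on_const[OF o]])
      fix z assume "z \<in> ?U"
      then obtain p where p: "p \<in> fst d" "p \<notin> K" "z = snd d p" by auto
      have "bump_metric c x r p u' v' = 0" for u' v'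
      proof (cases "p \<in> fst c")
        case True
        have "snd c p \<notin> cball x r"
          using p(2) inv_chart[OF c True] by (force simp: K_def)
        then have "(snd c p - x) \<bullet> (snd c p - x) \<ge> r\<^sup>2"
          using r(2) by (simp add: dot_square_norm dist_norm norm_minus_commute power_mono)
        then show ?thesis by (simp add: bump_metric_def bump_def)
      qed (simp add: bump_metric_def)
      then show "0 = metric_in_chart A d (bump_metric c x r) z u v"
        using inv_chart[OF d p(1)] by (simp add: metric_in_chart_def Let_def p(3))
    qed
    moreover have "y \<in> ?U" "?U \<subseteq> snd d ` fst d" using q \<open>q \<notin> K\<close> by auto
    ultimately show ?thesis by (intro exI[of _ ?U] conjI)
  qed
  qed
qed

text \<open>Finitely many of the balls cover the manifold. A finite sum of semidefinite forms, one
  of them definite, is definite, so the cut-off metrics can be added without the normalisation of a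
  partition of unity.\<close>

lemma riemannian_metric_exists:
  fixes A :: "'a::t2_space atlas"
  assumes "smooth_atlas A" and comp: "compact (UNIV :: 'a set)"
  shows "\<exists>g. riemannian_metric A g"
proof -
  interpret smooth_manifold A by unfold_locales fact
  have "\<exists>r>0. cball (snd (chart_at A p) p) r \<subseteq> snd (chart_at A p) ` fst (chart_at A p)" for p
    using open_chart_image[OF chart_at(1)] chart_at(2)[of p] open_contains_cball by blast
  then obtain r where r: "\<And>p. r p > 0" "\<And>p. cball (snd (chart_at A p) p) (r p) \<subseteq> snd (chart_at A p) ` fst (chart_at A p)"
    by metis
  define m where "m p = bump_metric (chart_at A p) (snd (chart_at A p) p) (r p)" for p
  define B where "B p = {q \<in> fst (chart_at A p). snd (chart_at A p) q \<in> ball (snd (chart_at A p) p) (r p)}" for p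
  have "open (B p)" for p unfolding B_def by (intro open_chart_preimage chart_at) simp
  moreover have "p \<in> B p" for p using r(1)[of p] chart_at(2) by (simp add: B_def)
  then have "UNIV \<subseteq> (\<Union>p\<in>UNIV. B p)" by blast
  ultimately obtain P where P: "finite P" "UNIV \<subseteq> (\<Union>p\<in>P. B p)"
    using compactE_image[OF comp, of UNIV B] by metis
  define g where "g q u v = (\<Sum>p\<in>P. m p q u v)" for q u v
  have "riemannian_metric A g"
    unfolding riemannian_metric_def
  proof (intro conjI allI ballI)
    fix q
    have b: "bilinear (m p q)" for p unfolding m_def by (rule bilinear_bump_metric[OF chart_at(1)])
    show "inner_product (g q)"
      unfolding inner_product_def
    proof (intro conjI allI impI)
      show "bilinear (g q)"
        using b unfolding bilinear_def g_def by (auto intro!: linear_compose_sum)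
      show "g q u v = g q v u" for u v
        unfolding g_def m_def by (intro sum.cong refl bump_metric_sym)
      fix u :: "real^3" assume u: "u \<noteq> 0"
      obtain p where p: "p \<in> P" "q \<in> B p" using P by blast
      then have "m p q u u > 0"
        unfolding m_def B_def by (intro bump_metric_pos chart_at u) auto
      then show "g q u u > 0"
        unfolding g_def using P(1) p(1)
        by (intro sum_pos2[of P p]) (auto simp: m_def bump_metric_nonneg)
    qed
  next
    fix d u v assume d: "d \<in> A"
    have "metric_in_chart A d g = (\<lambda>y u v. \<Sum>p\<in>P. metric_in_chart A d (m p) y u v)"
      by (simp add: metric_in_chart_def g_def Let_def fun_eq_iff)
    then show "smooth_on (snd d ` fst d) (\<lambda>y. metric_in_chart A d g y u v)"
      unfolding m_def using r
      by (auto intro!: smooth_on_sum smooth_bump_metric open_chart_image chart_at d smooth_manifold_axioms)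
  qed
  then show ?thesis by blast
qed

section \<open>Frames adapted to a pair of transverse plane fields\<close>

lemma span_pair: "w \<in> span {u, v} \<longleftrightarrow> (\<exists>a b. w = a *\<^sub>R u + b *\<^sub>R v)"
proof
  assume "w \<in> span {u, v}"
  then obtain a b where "w = a *\<^sub>R u + b *\<^sub>R v" by (auto simp: span_insert algebra_simps)
  then show "\<exists>a b. w = a *\<^sub>R u + b *\<^sub>R v" by blast
next
  assume "\<exists>a b. w = a *\<^sub>R u + b *\<^sub>R v"
  then show "w \<in> span {u, v}" by (auto intro!: span_add[OF span_scale span_scale] intro: span_base)
qed

lemma plane_eq_span:
  fixes P :: "(real^3) set"
  assumes P: "subspace P" "dim P = 2" and uv: "u \<in> P" "v \<in> P"
    and ind: "\<And>a b. a *\<^sub>R u + b *\<^sub>R v = 0 \<Longrightarrow> a = 0 \<and> b = 0"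
  shows "P = span {u, v}"
proof
  have i: "u \<noteq> v \<and> independent {u, v}" unfolding independent_pair using ind by blast
  show "P \<subseteq> span {u, v}"
    by (rule card_ge_dim_independent) (use i uv P(2) in auto)
  show "span {u, v} \<subseteq> P" using uv P(1) by (simp add: span_minimal)
qed

lemma cross3_eq_0_iff_dependent:
  "cross3 s t = 0 \<longleftrightarrow> (\<exists>a b. (a \<noteq> 0 \<or> b \<noteq> 0) \<and> a *\<^sub>R s + b *\<^sub>R t = 0)"
proof
  assume "cross3 s t = 0"
  then consider "s = 0" | "t = 0" | c where "t = c *\<^sub>R s"
    unfolding cross_eq_0 collinear_lemma by auto
  then show "\<exists>a b. (a \<noteq> 0 \<or> b \<noteq> 0) \<and> a *\<^sub>R s + b *\<^sub>R t = 0"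
  proof cases
    case 1 then show ?thesis by (intro exI[of _ 1] exI[of _ 0]) simp
  next
    case 2 then show ?thesis by (intro exI[of _ 0] exI[of _ 1]) simp
  next
    case 3 then show ?thesis by (intro exI[of _ "- c"] exI[of _ 1]) simp
  qed
next
  assume "\<exists>a b. (a \<noteq> 0 \<or> b \<noteq> 0) \<and> a *\<^sub>R s + b *\<^sub>R t = 0"
  then obtain a b where ab: "a \<noteq> 0 \<or> b \<noteq> 0" and z: "a *\<^sub>R s + b *\<^sub>R t = 0" by blast
  have "a *\<^sub>R cross3 s t = cross3 (a *\<^sub>R s + b *\<^sub>R t) t" "b *\<^sub>R cross3 s t = cross3 s (a *\<^sub>R s + b *\<^sub>R t)"
    by (simp_all add: cross_add_left cross_add_right cross_mult_left cross_mult_right)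
  then show "cross3 s t = 0" using ab by (auto simp: z)
qed

lemma cross3_plane:
  assumes ne: "cross3 s t \<noteq> 0"
  shows "cross3 s t \<bullet> u = 0 \<longleftrightarrow> (\<exists>a b. u = a *\<^sub>R s + b *\<^sub>R t)"
proof
  let ?m = "cross3 s t"
  assume z: "?m \<bullet> u = 0"
  \<comment> \<open>Expansion of \<open>u\<close> in the basis \<open>s\<close>, \<open>t\<close>,
    \<open>?m\<close> by means of its reciprocal basis, multiplied by the determinant
    \<open>?m \<bullet> ?m\<close>.\<close>
  have "(?m \<bullet> ?m) *\<^sub>R u = (u \<bullet> cross3 t ?m) *\<^sub>R s + (u \<bullet> cross3 ?m s) *\<^sub>R t + (?m \<bullet> u) *\<^sub>R ?m"
    by (simp add: cross3_simps forall_3)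
  then have "(?m \<bullet> ?m) *\<^sub>R u = (u \<bullet> cross3 t ?m) *\<^sub>R s + (u \<bullet> cross3 ?m s) *\<^sub>R t" by (simp add: z)
  then have "u = (1 / (?m \<bullet> ?m)) *\<^sub>R ((u \<bullet> cross3 t ?m) *\<^sub>R s + (u \<bullet> cross3 ?m s) *\<^sub>R t)"
    using ne by (metis divide_self_if inner_eq_zero_iff scaleR_one scaleR_scaleR times_divide_eq_left mult_1)
  then show "\<exists>a b. u = a *\<^sub>R s + b *\<^sub>R t" by (metis scaleR_add_right scaleR_scaleR)
qed (auto simp: inner_add_right dot_cross_self)

text \<open>\<open>g0\<close> is an auxiliary metric that normalises frames and fixes complements;
  it is not the metric whose curvature is prescribed.\<close>

locale transverse_planes = smooth_manifold A for A :: "'a::topological_space atlas" +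
  fixes g0 :: "'a \<Rightarrow> real^3 \<Rightarrow> real^3 \<Rightarrow> real" and \<xi> \<eta> :: "'a \<Rightarrow> (real^3) set" and \<alpha> :: "'a \<Rightarrow> real^3 \<Rightarrow> real"
  assumes g0: "riemannian_metric A g0"
    and \<alpha>: "smooth_1form A \<alpha>" and \<xi>: "\<xi> p = {v. \<alpha> p v = 0}"
    and plane_\<xi>: "plane_distribution A \<xi>" and plane_\<eta>: "plane_distribution A \<eta>"
    and trans: "transverse \<xi> \<eta>"
begin

lemma ip: "inner_product (g0 p)" using g0 by (simp add: riemannian_metric_def)
lemma g0_linear: "linear (g0 p u)" "linear (\<lambda>u. g0 p u v)"
  using ip[of p] by (auto simp: inner_product_def bilinear_def)
lemma g0_sym: "g0 p u v = g0 p v u" using ip[of p] by (auto simp: inner_product_def)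
lemma g0_pos: "u \<noteq> 0 \<Longrightarrow> g0 p u u > 0" using ip[of p] by (auto simp: inner_product_def)
lemma linear_\<alpha>: "linear (\<alpha> p)" using \<alpha> by (simp add: smooth_1form_def)

lemmas lin_simps = linear_add[OF g0_linear(1)] linear_add[OF g0_linear(2)] linear_scale[OF g0_linear(1)]
  linear_scale[OF g0_linear(2)] linear_add[OF linear_\<alpha>] linear_scale[OF linear_\<alpha>]
  linear_diff[OF g0_linear(1)] linear_diff[OF linear_\<alpha>] linear_0[OF g0_linear(1)] linear_0[OF g0_linear(2)]
  linear_0[OF linear_\<alpha>] linear_neg[OF g0_linear(1)] linear_neg[OF g0_linear(2)] linear_neg[OF linear_\<alpha>]

definition adapted :: "'a \<Rightarrow> real^3 \<Rightarrow> real^3 \<Rightarrow> real^3 \<Rightarrow> bool" where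
  "adapted p X Y Z \<longleftrightarrow> \<alpha> p X = 0 \<and> X \<in> \<eta> p \<and> g0 p X X = 1 \<and> \<alpha> p Y = 0 \<and> g0 p X Y = 0 \<and> g0 p Y Y = 1 \<and>
    Z \<in> \<eta> p \<and> g0 p X Z = 0 \<and> \<alpha> p Z = 1"

text \<open>In an adapted frame this is the dual form of \<open>Y\<close>. The correction by
  \<alpha> makes it vanish on \<open>Z\<close>, which need not be orthogonal to
  \<open>Y\<close>.\<close>

definition dual2 :: "'a \<Rightarrow> real^3 \<Rightarrow> real^3 \<Rightarrow> real^3 \<Rightarrow> real" where
  "dual2 p Y Z u = g0 p Y u - \<alpha> p u * g0 p Y Z"

text \<open>The difference of the two sides lies in \<xi>, which is spanned by \<open>X\<close> and
  \<open>Y\<close>, and it is orthogonal to both.\<close>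

lemma adapted_expand:
  assumes a: "adapted p X Y Z"
  shows "u = g0 p X u *\<^sub>R X + dual2 p Y Z u *\<^sub>R Y + \<alpha> p u *\<^sub>R Z"
proof -
  define w where "w = u - (g0 p X u *\<^sub>R X + dual2 p Y Z u *\<^sub>R Y + \<alpha> p u *\<^sub>R Z)"
  have aw: "\<alpha> p w = 0" "g0 p X w = 0" "g0 p Y w = 0"
    using a g0_sym[of p Y X] unfolding w_def adapted_def dual2_def by (simp_all add: lin_simps)
  have ind: "x = 0 \<and> y = 0" if "x *\<^sub>R X + y *\<^sub>R Y = 0" for x y
  proof -
    have "g0 p X (x *\<^sub>R X + y *\<^sub>R Y) = x" "g0 p Y (x *\<^sub>R X + y *\<^sub>R Y) = y"
      using a g0_sym[of p Y X] by (simp_all add: lin_simps adapted_def)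
    then show ?thesis unfolding \<open>x *\<^sub>R X + y *\<^sub>R Y = 0\<close> by (simp add: lin_simps)
  qed
  have "\<xi> p = span {X, Y}"
    using plane_\<xi> a ind by (intro plane_eq_span) (auto simp: plane_distribution_def adapted_def \<xi>)
  moreover have "w \<in> \<xi> p" using aw by (simp add: \<xi>)
  ultimately have "w \<in> span {X, Y}" by simp
  then obtain x y where w: "w = x *\<^sub>R X + y *\<^sub>R Y" unfolding span_pair by blast
  then have "x = 0" "y = 0"
    using aw a g0_sym[of p Y X] by (simp_all add: lin_simps adapted_def)
  then have "w = 0" using w by simp
  then show ?thesis by (simp add: w_def)
qed

lemma adapted_\<eta>:
  assumes a: "adapted p X Y Z"
  shows "u \<in> \<eta> p \<longleftrightarrow> dual2 p Y Z u = 0"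
proof
  have ind: "x = 0 \<and> z = 0" if "x *\<^sub>R X + z *\<^sub>R Z = 0" for x z
  proof -
    have "g0 p X (x *\<^sub>R X + z *\<^sub>R Z) = x" "\<alpha> p (x *\<^sub>R X + z *\<^sub>R Z) = z"
      using a by (simp_all add: lin_simps adapted_def)
    then show ?thesis unfolding \<open>x *\<^sub>R X + z *\<^sub>R Z = 0\<close> by (simp add: lin_simps)
  qed
  have e: "\<eta> p = span {X, Z}"
    using plane_\<eta> a ind by (intro plane_eq_span) (auto simp: plane_distribution_def adapted_def)
  show "dual2 p Y Z u = 0" if "u \<in> \<eta> p"
  proof -
    obtain x z where "u = x *\<^sub>R X + z *\<^sub>R Z" using \<open>u \<in> \<eta> p\<close> unfolding e span_pair by blast
    then show ?thesis using a g0_sym[of p Y X] by (simp add: dual2_def lin_simps adapted_def)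
  qed
  show "u \<in> \<eta> p" if "dual2 p Y Z u = 0"
    using adapted_expand[OF a, of u] that unfolding e span_pair by (intro exI) auto
qed

text \<open>An adapted frame is unique up to the signs of \<open>X\<close> and \<open>Y\<close>, which cannot be chosen
  continuously on all of \<open>M\<close> in general, but do not affect the squares of the dual 1-forms.\<close>

lemma adapted_unique:
  assumes a: "adapted p X Y Z" and a': "adapted p X' Y' Z'"
  shows "X' = X \<or> X' = - X" "Y' = Y \<or> Y' = - Y" "Z' = Z"
proof -
  have sq: "k = 1 \<or> k = -1" if "k * k = 1" for k :: real
    using that by (metis square_eq_1_iff)
  have X': "X' = g0 p X X' *\<^sub>R X"
    using adapted_expand[OF a, of X'] adapted_\<eta>[OF a, of X'] a' by (simp add: adapted_def)
  have 1: "k * k = 1" if "g0 p V V = 1" "g0 p (k *\<^sub>R V) (k *\<^sub>R V) = 1" for k V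
    using that by (simp add: lin_simps)
  have "g0 p X X' * g0 p X X' = 1"
    by (rule 1[of X]) (use a a' X' in \<open>auto simp: adapted_def\<close>)
  from sq[OF this] show X: "X' = X \<or> X' = - X" using X' by auto
  have "g0 p X Y' = 0" "g0 p X Z' = 0" using X a' by (auto simp: adapted_def lin_simps)
  then have Y': "Y' = dual2 p Y Z Y' *\<^sub>R Y" and Z': "Z' = Z"
    using adapted_expand[OF a, of Y'] adapted_expand[OF a, of Z'] adapted_\<eta>[OF a, of Z'] a'
    by (simp_all add: adapted_def)
  have "dual2 p Y Z Y' * dual2 p Y Z Y' = 1"
    by (rule 1[of Y]) (use a a' Y' in \<open>auto simp: adapted_def\<close>)
  from sq[OF this] show "Y' = Y \<or> Y' = - Y" using Y' by auto
  show "Z' = Z" by fact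
qed

text \<open>The frame is picked pointwise with no regard to continuity.
  \<open>frame_metric_eq\<close> lets any adapted frame be put in its place, in particular a smooth
  local one.\<close>

definition frame_metric :: "real \<Rightarrow> ('a \<Rightarrow> real) \<Rightarrow> 'a \<Rightarrow> real^3 \<Rightarrow> real^3 \<Rightarrow> real" where
  "frame_metric s t p u v = (case (SOME (X, Y, Z). adapted p X Y Z) of (X, Y, Z) \<Rightarrow>
     g0 p X u * g0 p X v + dual2 p Y Z u * dual2 p Y Z v / s\<^sup>2 + \<alpha> p u * \<alpha> p v / (t p)\<^sup>2)"

lemma frame_metric_eq:
  assumes a: "adapted p X Y Z"
  shows "frame_metric s t p u v =
    g0 p X u * g0 p X v + dual2 p Y Z u * dual2 p Y Z v / s\<^sup>2 + \<alpha> p u * \<alpha> p v / (t p)\<^sup>2"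
proof -
  obtain X' Y' Z' where F: "(SOME (X, Y, Z). adapted p X Y Z) = (X', Y', Z')"
    by (metis prod_cases3)
  have "case (SOME (X, Y, Z). adapted p X Y Z) of (X, Y, Z) \<Rightarrow> adapted p X Y Z"
    by (rule someI[where x = "(X, Y, Z)"]) (simp add: a)
  then have a': "adapted p X' Y' Z'" by (simp add: F)
  have "dual2 p (- Y) Z w = - dual2 p Y Z w" for w by (simp add: dual2_def lin_simps)
  then show ?thesis
    unfolding frame_metric_def F using adapted_unique[OF a a'] by (auto simp: lin_simps)
qed

section \<open>Smooth local adapted coframes\<close>

definition chart_form :: "'a chart \<Rightarrow> real^3 \<Rightarrow> real^3" where
  "chart_form c x = (\<Sum>b\<in>Basis. \<alpha> (inv_chart c x) (from_chart A c (inv_chart c x) b) *\<^sub>R b)"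

definition chart_flat :: "'a chart \<Rightarrow> (real^3 \<Rightarrow> real^3) \<Rightarrow> real^3 \<Rightarrow> real^3" where
  "chart_flat c X x = (\<Sum>b\<in>Basis. metric_in_chart A c g0 x (X x) b *\<^sub>R b)"

lemma inner_chart_form:
  assumes c: "c \<in> A" and q: "q \<in> fst c"
  shows "chart_form c (snd c q) \<bullet> u = \<alpha> q (from_chart A c q u)"
proof -
  note l = linear_from_chart[OF assms]
  have "from_chart A c q u = (\<Sum>b\<in>Basis. (u \<bullet> b) *\<^sub>R from_chart A c q b)"
    by (subst euclidean_representation[of u, symmetric])
      (simp only: linear_sum[OF l] linear_scale[OF l])
  then show ?thesis
    by (simp add: chart_form_def inv_chart assms linear_sum[OF linear_\<alpha>] lin_simps inner_sum_left
        inner_commute[of u] mult.commute)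
qed

lemma inner_chart_flat:
  assumes c: "c \<in> A" and q: "q \<in> fst c"
  shows "chart_flat c X (snd c q) \<bullet> u = g0 q (from_chart A c q (X (snd c q))) (from_chart A c q u)"
proof -
  note l = linear_from_chart[OF assms]
  have "from_chart A c q u = (\<Sum>b\<in>Basis. (u \<bullet> b) *\<^sub>R from_chart A c q b)"
    by (subst euclidean_representation[of u, symmetric])
      (simp only: linear_sum[OF l] linear_scale[OF l])
  then show ?thesis
    by (simp add: chart_flat_def metric_in_chart_def Let_def inv_chart assms linear_sum[OF g0_linear(1)]
        lin_simps inner_sum_left inner_commute[of u] mult.commute)
qed

lemma smooth_on_chart_form: "c \<in> A \<Longrightarrow> smooth_on (snd c ` fst c) (chart_form c)"
  unfolding chart_form_def[abs_def] using \<alpha>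
  by (intro smooth_on_sum smooth_on_scaleR smooth_on_const open_chart_image)
    (auto simp: smooth_1form_def Let_def)

lemma smooth_on_chart_flat:
  assumes c: "c \<in> A" and V: "V \<subseteq> snd c ` fst c" and X: "smooth_on V X"
  shows "smooth_on V (chart_flat c X)"
proof (rule smooth_on_cong)
  let ?m = "metric_in_chart A c g0"
  note o = smooth_on_open[OF X]
  have "smooth_on V (\<lambda>x. ?m x u v)" for u v
    using g0 c by (intro smooth_on_subset[OF _ o V]) (auto simp: riemannian_metric_def)
  then show "smooth_on V (\<lambda>x. \<Sum>b\<in>Basis. (\<Sum>b'\<in>Basis. (X x \<bullet> b') * ?m x b' b) *\<^sub>R b)"
    by (intro smooth_on_sum smooth_on_scaleR smooth_on_mult smooth_on_inner smooth_on_const o X)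
  fix x assume "x \<in> V"
  then have x: "x \<in> snd c ` fst c" using V by auto
  note l = linear_from_chart[OF c chart_inv(2)[OF c x]]
  have "?m x (X x) b = ?m x (\<Sum>b'\<in>Basis. (X x \<bullet> b') *\<^sub>R b') b" for b by (simp add: euclidean_representation)
  also have "\<dots> b = (\<Sum>b'\<in>Basis. (X x \<bullet> b') * ?m x b' b)" for b
    unfolding metric_in_chart_def Let_def
    by (simp only: linear_sum[OF l] linear_scale[OF l] linear_sum[OF g0_linear(2)] lin_simps real_scaleR_def)
  finally show "(\<Sum>b\<in>Basis. (\<Sum>b'\<in>Basis. (X x \<bullet> b') * ?m x b' b) *\<^sub>R b) = chart_flat c X x"
    by (simp add: chart_flat_def)
qed

text \<open>Only \<xi> comes with a global defining form; for \<eta> a local conormal is obtained as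
  the cross product of two spanning sections in coordinates.\<close>

lemma \<eta>_chart_form:
  assumes c: "c \<in> A" and p: "p \<in> fst c"
  shows "\<exists>V m. smooth_on V m \<and> V \<subseteq> snd c ` fst c \<and> snd c p \<in> V \<and>
    (\<forall>q\<in>fst c. snd c q \<in> V \<longrightarrow> m (snd c q) \<noteq> 0 \<and> (\<forall>u. from_chart A c q u \<in> \<eta> q \<longleftrightarrow> m (snd c q) \<bullet> u = 0))"
proof -
  have "\<exists>W S T. open W \<and> p \<in> W \<and> smooth_field_on A W S \<and> smooth_field_on A W T \<and>
      (\<forall>q\<in>W. basis_of_plane (\<eta> q) (S q) (T q))"
    using plane_\<eta> unfolding plane_distribution_def by blast
  then obtain W S T where W: "open W" "p \<in> W" and S: "smooth_field_on A W S" and T: "smooth_field_on A W T"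
    and b: "\<And>q. q \<in> W \<Longrightarrow> basis_of_plane (\<eta> q) (S q) (T q)" by blast
  let ?V = "snd c ` (fst c \<inter> W)"
  let ?S = "field_in_chart A c S" and ?T = "field_in_chart A c T"
  let ?m = "\<lambda>x. cross3 (?S x) (?T x)"
  have "smooth_on ?V ?m"
    using S T c by (intro smooth_on_cross3) (auto simp: smooth_field_on_def)
  moreover have "?m (snd c q) \<noteq> 0 \<and> (\<forall>u. from_chart A c q u \<in> \<eta> q \<longleftrightarrow> ?m (snd c q) \<bullet> u = 0)"
    if q: "q \<in> fst c" "snd c q \<in> ?V" for q
  proof -
    obtain q' where q': "q' \<in> fst c" "q' \<in> W" "snd c q = snd c q'" using q by auto
    then have qW: "q \<in> W" using inv_chart[OF c] q(1) by metis
    note l = linear_from_chart[OF c q(1)]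
    have f: "from_chart A c q (?S (snd c q)) = S q" "from_chart A c q (?T (snd c q)) = T q"
      by (simp_all add: field_in_chart_def Let_def inv_chart from_chart_to_chart c q)
    have inj: "from_chart A c q u = from_chart A c q v \<longleftrightarrow> u = v" for u v
      using to_chart_from_chart[OF c c q(1) q(1)] jac_self[OF c q(1)] by metis
    have e: "\<eta> q = span {S q, T q}" and ind: "\<And>a b. a *\<^sub>R S q + b *\<^sub>R T q = 0 \<Longrightarrow> a = 0 \<and> b = 0"
      using b[OF qW] independent_pair[of "S q" "T q"] by (auto simp: basis_of_plane_def)
    have comb: "from_chart A c q (a *\<^sub>R ?S (snd c q) + b *\<^sub>R ?T (snd c q)) = a *\<^sub>R S q + b *\<^sub>R T q" for a b
      by (simp add: linear_add[OF l] linear_scale[OF l] f)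
    have ne: "?m (snd c q) \<noteq> 0"
    proof
      assume "?m (snd c q) = 0"
      then obtain a b where ab: "a \<noteq> 0 \<or> b \<noteq> 0" "a *\<^sub>R ?S (snd c q) + b *\<^sub>R ?T (snd c q) = 0"
        unfolding cross3_eq_0_iff_dependent by blast
      have "a *\<^sub>R S q + b *\<^sub>R T q = 0" using comb[of a b] linear_0[OF l] by (simp add: ab(2))
      then show False using ind ab(1) by blast
    qed
    have "from_chart A c q u \<in> \<eta> q \<longleftrightarrow> (\<exists>a b. u = a *\<^sub>R ?S (snd c q) + b *\<^sub>R ?T (snd c q))" for u
      unfolding e span_pair comb[symmetric] inj ..
    then show ?thesis using ne cross3_plane[OF ne] by simp
  qed
  ultimately show ?thesis using W p by (intro exI[of _ ?V] exI[of _ ?m]) auto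
qed

end

context transverse_planes
begin

lemma smooth_on_normalize:
  assumes c: "c \<in> A" and V: "V \<subseteq> snd c ` fst c" and X: "smooth_on V X" and ne: "\<And>x. x \<in> V \<Longrightarrow> X x \<noteq> 0"
  shows "\<exists>k. smooth_on V k \<and> (\<forall>x\<in>V. k x > 0) \<and>
    (\<forall>q\<in>fst c. snd c q \<in> V \<longrightarrow> g0 q (from_chart A c q (k (snd c q) *\<^sub>R X (snd c q))) (from_chart A c q (k (snd c q) *\<^sub>R X (snd c q))) = 1)"
proof -
  let ?n = "\<lambda>x. chart_flat c X x \<bullet> X x"
  have pos: "?n (snd c q) > 0" if "q \<in> fst c" "snd c q \<in> V" for q
  proof -
    note l = linear_from_chart[OF c that(1)]
    have "from_chart A c q (X (snd c q)) \<noteq> 0"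
      using to_chart_from_chart[OF c c that(1) that(1)] jac_self[OF c that(1)]
        linear_0[OF linear_to_chart[OF c that(1)]] ne[OF that(2)] by metis
    then show ?thesis by (simp add: inner_chart_flat[OF c that(1)] g0_pos)
  qed
  then have pos': "?n x > 0" if "x \<in> V" for x
    using V that by blast
  have sm: "smooth_on V (\<lambda>x. inverse (sqrt (?n x)))"
    by (intro smooth_on_inverse smooth_on_sqrt smooth_on_inner smooth_on_chart_flat c V X)
      (use pos' in \<open>auto simp: less_imp_neq[symmetric]\<close>)
  have "g0 q (from_chart A c q (inverse (sqrt (?n (snd c q))) *\<^sub>R X (snd c q)))
      (from_chart A c q (inverse (sqrt (?n (snd c q))) *\<^sub>R X (snd c q))) = 1"
    if "q \<in> fst c" "snd c q \<in> V" for q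
  proof -
    note l = linear_from_chart[OF c that(1)]
    have n: "?n (snd c q) = g0 q (from_chart A c q (X (snd c q))) (from_chart A c q (X (snd c q)))"
      by (rule inner_chart_flat[OF c that(1)])
    have "g0 q (from_chart A c q (k *\<^sub>R X (snd c q))) (from_chart A c q (k *\<^sub>R X (snd c q))) = k * k * ?n (snd c q)" for k
      by (simp add: linear_scale[OF l] lin_simps n)
    moreover have "inverse (sqrt r) * inverse (sqrt r) * r = 1" if "r > 0" for r :: real
      using that by (simp add: field_simps)
    ultimately show ?thesis using pos[OF that] by simp
  qed
  then show ?thesis using sm pos' by (intro exI[of _ "\<lambda>x. inverse (sqrt (?n x))"]) auto
qed

definition adapted_coframe ::
    "'a chart \<Rightarrow> (real^3) set \<Rightarrow> (3 \<Rightarrow> real^3 \<Rightarrow> real^3) \<Rightarrow> (3 \<Rightarrow> real^3 \<Rightarrow> real^3) \<Rightarrow> bool" where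
  "adapted_coframe c V \<theta> \<epsilon> \<longleftrightarrow> c \<in> A \<and> V \<subseteq> snd c ` fst c \<and> coframe V \<theta> \<epsilon> \<and>
    (\<forall>q\<in>fst c. snd c q \<in> V \<longrightarrow> adapted q (from_chart A c q (\<epsilon> 1 (snd c q)))
      (from_chart A c q (\<epsilon> 2 (snd c q))) (from_chart A c q (\<epsilon> 3 (snd c q))))"

lemma chart_form_nonzero:
  assumes c: "c \<in> A" and q: "q \<in> fst c"
  shows "chart_form c (snd c q) \<noteq> 0"
proof
  assume "chart_form c (snd c q) = 0"
  then have "\<alpha> q u = 0" for u
    using inner_chart_form[OF c q, of "to_chart A c q u"] from_chart_to_chart[OF c q, of u] by simp
  then have "\<xi> q = UNIV" by (simp add: \<xi>)
  moreover have "dim (\<xi> q) = 2" using plane_\<xi> by (simp add: plane_distribution_def)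
  ultimately show False by simp
qed

text \<open>The cross product of two covectors is a vector killed by both. With a and m the
  conormals of \<xi> and \<eta>, the vector \<open>X\<close> is a multiple of a x m; with e = g0(X,
  .), the vectors \<open>Y\<close> and \<open>Z\<close> are multiples of a x e and m x e. The first
  product is nonzero by transversality, the other two because e(X) = 1.\<close>

lemma adapted_coframe_exists:
  assumes c: "c \<in> A" and p: "p \<in> fst c"
  shows "\<exists>V \<theta> \<epsilon>. adapted_coframe c V \<theta> \<epsilon> \<and> snd c p \<in> V"
proof -
  obtain V m where m: "smooth_on V m" and V: "V \<subseteq> snd c ` fst c" and pV: "snd c p \<in> V"
    and m0: "\<And>q. q \<in> fst c \<Longrightarrow> snd c q \<in> V \<Longrightarrow> m (snd c q) \<noteq> 0"
    and m\<eta>: "\<And>q u. q \<in> fst c \<Longrightarrow> snd c q \<in> V \<Longrightarrow> from_chart A c q u \<in> \<eta> q \<longleftrightarrow> m (snd c q) \<bullet> u = 0"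
    using \<eta>_chart_form[OF c p] by blast
  have o: "open V" by (rule smooth_on_open[OF m])
  let ?a = "chart_form c"
  have a: "smooth_on V ?a" by (rule smooth_on_subset[OF smooth_on_chart_form[OF c] o V])
  \<comment> \<open>Proportional nonzero conormals would define the same plane, against
    transversality.\<close>
  have am: "cross3 (?a (snd c q)) (m (snd c q)) \<noteq> 0" if q: "q \<in> fst c" "snd c q \<in> V" for q
  proof
    assume "cross3 (?a (snd c q)) (m (snd c q)) = 0"
    then obtain s t where st: "s \<noteq> 0 \<or> t \<noteq> 0" "s *\<^sub>R ?a (snd c q) + t *\<^sub>R m (snd c q) = 0"
      unfolding cross3_eq_0_iff_dependent by blast
    have st0: "s \<noteq> 0" "t \<noteq> 0"
      using st m0[OF q] chart_form_nonzero[OF c q(1)] by auto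
    have "?a (snd c q) \<bullet> u = 0 \<longleftrightarrow> m (snd c q) \<bullet> u = 0" for u
    proof -
      have "s * (?a (snd c q) \<bullet> u) + t * (m (snd c q) \<bullet> u) = 0"
        using arg_cong[OF st(2), of "\<lambda>w. w \<bullet> u"] by (simp add: inner_add_left)
      then show ?thesis using st0 by (metis add.right_neutral add_0 mult_eq_0_iff)
    qed
    then have "from_chart A c q u \<in> \<xi> q \<longleftrightarrow> from_chart A c q u \<in> \<eta> q" for u
      by (simp add: m\<eta> q \<xi> inner_chart_form[OF c q(1), symmetric])
    then have "\<xi> q = \<eta> q" using from_chart_to_chart[OF c q(1)] by (metis set_eqI)
    then show False using trans by (simp add: transverse_def)
  qed
  let ?Xh = "\<lambda>x. cross3 (?a x) (m x)"
  have Xh: "smooth_on V ?Xh" by (intro smooth_on_cross3 a m)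
  have Xh0: "?Xh x \<noteq> 0" if "x \<in> V" for x
    using am that V by blast
  obtain kX where kX: "smooth_on V kX" "\<And>x. x \<in> V \<Longrightarrow> kX x > 0"
    and nX: "\<And>q. q \<in> fst c \<Longrightarrow> snd c q \<in> V \<Longrightarrow> g0 q (from_chart A c q (kX (snd c q) *\<^sub>R ?Xh (snd c q))) (from_chart A c q (kX (snd c q) *\<^sub>R ?Xh (snd c q))) = 1"
    using smooth_on_normalize[OF c V Xh Xh0] by blast
  define X where "X x = kX x *\<^sub>R ?Xh x" for x
  have X: "smooth_on V X" unfolding X_def[abs_def] by (intro smooth_on_scaleR kX Xh)
  let ?e = "chart_flat c X"
  have e: "smooth_on V ?e" by (rule smooth_on_chart_flat[OF c V X])
  have eX: "?e (snd c q) \<bullet> X (snd c q) = 1" if "q \<in> fst c" "snd c q \<in> V" for q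
    using nX[OF that] unfolding inner_chart_flat[OF c that(1)] X_def .
  have aX: "?a x \<bullet> X x = 0" "m x \<bullet> X x = 0" for x
    by (simp_all add: X_def dot_cross_self)
  let ?Yh = "\<lambda>x. cross3 (?a x) (?e x)"
  have Yh: "smooth_on V ?Yh" by (intro smooth_on_cross3 a e)
  have Yh0: "?Yh (snd c q) \<noteq> 0" if q: "q \<in> fst c" "snd c q \<in> V" for q
  proof
    assume "?Yh (snd c q) = 0"
    then obtain s t where st: "s \<noteq> 0 \<or> t \<noteq> 0" "s *\<^sub>R ?a (snd c q) + t *\<^sub>R ?e (snd c q) = 0"
      unfolding cross3_eq_0_iff_dependent by blast
    have "t = 0" using arg_cong[OF st(2), of "\<lambda>w. w \<bullet> X (snd c q)"] eX[OF q] aX by (simp add: inner_add_left)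
    then show False using st chart_form_nonzero[OF c q(1)] by simp
  qed
  then have Yh0': "?Yh x \<noteq> 0" if "x \<in> V" for x
    using that V by blast
  obtain kY where kY: "smooth_on V kY" "\<And>x. x \<in> V \<Longrightarrow> kY x > 0"
    and nY: "\<And>q. q \<in> fst c \<Longrightarrow> snd c q \<in> V \<Longrightarrow> g0 q (from_chart A c q (kY (snd c q) *\<^sub>R ?Yh (snd c q))) (from_chart A c q (kY (snd c q) *\<^sub>R ?Yh (snd c q))) = 1"
    using smooth_on_normalize[OF c V Yh Yh0'] by blast
  define Y where "Y x = kY x *\<^sub>R ?Yh x" for x
  have Y: "smooth_on V Y" unfolding Y_def[abs_def] by (intro smooth_on_scaleR kY Yh)
  have aY: "?a x \<bullet> Y x = 0" "?e x \<bullet> Y x = 0" for x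
    by (simp_all add: Y_def dot_cross_self)
  let ?Zh = "\<lambda>x. cross3 (m x) (?e x)"
  have Zh: "smooth_on V ?Zh" by (intro smooth_on_cross3 m e)
  have aZh: "?a (snd c q) \<bullet> ?Zh (snd c q) \<noteq> 0" if q: "q \<in> fst c" "snd c q \<in> V" for q
  proof -
    \<comment> \<open>Cyclic invariance of the triple product reduces this to e(X) = 1.\<close>
    have "?a (snd c q) \<bullet> ?Zh (snd c q) = ?e (snd c q) \<bullet> ?Xh (snd c q)"
      by (simp add: cross3_simps)
    moreover have "kX (snd c q) * (?e (snd c q) \<bullet> ?Xh (snd c q)) = 1"
      using eX[OF q] by (simp add: X_def)
    ultimately show ?thesis by auto
  qed
  then have aZh': "?a x \<bullet> ?Zh x \<noteq> 0" if "x \<in> V" for x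
    using that V by blast
  define Z where "Z x = inverse (?a x \<bullet> ?Zh x) *\<^sub>R ?Zh x" for x
  have Z: "smooth_on V Z"
    unfolding Z_def[abs_def] by (intro smooth_on_scaleR smooth_on_inverse smooth_on_inner a Zh aZh')
  have aZ: "?a x \<bullet> Z x = 1" if "x \<in> V" for x using aZh'[OF that] by (simp add: Z_def)
  have mZ: "m x \<bullet> Z x = 0" "?e x \<bullet> Z x = 0" for x
    by (simp_all add: Z_def dot_cross_self)
  \<comment> \<open>The second form is \<open>dual2\<close> in coordinates; the first and third are
    g0(X, .) and \<alpha>.\<close>
  define \<theta> where "\<theta> i x = (if i = 1 then ?e x else if i = 2 then chart_flat c Y x - (chart_flat c Y x \<bullet> Z x) *\<^sub>R ?a x else ?a x)" for i :: 3 and x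
  define \<epsilon> where "\<epsilon> i x = (if i = 1 then X x else if i = 2 then Y x else Z x)" for i :: 3 and x
  have ad: "adapted q (from_chart A c q (X (snd c q))) (from_chart A c q (Y (snd c q))) (from_chart A c q (Z (snd c q)))"
    if q: "q \<in> fst c" "snd c q \<in> V" for q
    unfolding adapted_def
    using aX aY aZ mZ nX[OF q] nY[OF q] q
    by (simp add: inner_chart_form[OF c q(1), symmetric] inner_chart_flat[OF c q(1), symmetric] m\<eta> X_def[symmetric] Y_def[symmetric])
  have \<theta>: "\<theta> 1 (snd c q) \<bullet> u = g0 q (from_chart A c q (X (snd c q))) (from_chart A c q u)"
    "\<theta> 2 (snd c q) \<bullet> u = dual2 q (from_chart A c q (Y (snd c q))) (from_chart A c q (Z (snd c q))) (from_chart A c q u)"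
    "\<theta> 3 (snd c q) \<bullet> u = \<alpha> q (from_chart A c q u)" if q: "q \<in> fst c" for q u
    by (simp_all add: \<theta>_def inner_diff_left inner_chart_form[OF c q] inner_chart_flat[OF c q] dual2_def)
  have "coframe V \<theta> \<epsilon>"
  proof
    show "smooth_on V (\<theta> i)" for i
      unfolding \<theta>_def[abs_def]
      by (cases "i = 1"; cases "i = 2")
        (auto intro!: e a Z smooth_on_diff smooth_on_scaleR smooth_on_inner smooth_on_chart_flat[OF c V Y])
    show "smooth_on V (\<epsilon> i)" for i
      unfolding \<epsilon>_def[abs_def] by (cases "i = 1"; cases "i = 2") (auto intro: X Y Z)
    fix x assume "x \<in> V"
    then obtain q where q: "q \<in> fst c" "x = snd c q" using V by blast
    have qV: "snd c q \<in> V" using \<open>x \<in> V\<close> q by simp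
    note A' = ad[OF q(1) qV]
    note l = linear_from_chart[OF c q(1)]
    have "\<forall>i j. \<theta> i x \<bullet> \<epsilon> j x = (if i = j then 1 else 0)"
      using A' g0_sym[of q "from_chart A c q (X (snd c q))" "from_chart A c q (Y (snd c q))"]
      unfolding forall_3 q(2) \<theta>[OF q(1)] by (simp add: \<epsilon>_def adapted_def dual2_def)
    then show "\<theta> i x \<bullet> \<epsilon> j x = (if i = j then 1 else 0)" for i j by blast
    fix u
    have "from_chart A c q (\<Sum>i\<in>UNIV. (\<theta> i x \<bullet> u) *\<^sub>R \<epsilon> i x) = from_chart A c q u"
      using adapted_expand[OF A', of "from_chart A c q u"]
      by (simp add: sum_3 linear_add[OF l] linear_scale[OF l] \<theta>[OF q(1)] q(2) \<epsilon>_def)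
    then show "(\<Sum>i\<in>UNIV. (\<theta> i x \<bullet> u) *\<^sub>R \<epsilon> i x) = u"
      using to_chart_from_chart[OF c c q(1) q(1)] jac_self[OF c q(1)] by metis
  qed
  then have "adapted_coframe c V \<theta> \<epsilon>"
    unfolding adapted_coframe_def using c V ad by (simp add: \<epsilon>_def)
  then show ?thesis using pV by blast
qed

context
  fixes c V \<theta> \<epsilon> q
  assumes ac: "adapted_coframe c V \<theta> \<epsilon>" and q: "q \<in> fst c" "snd c q \<in> V"
begin

lemma adapted_coframe_adapted: "adapted q (from_chart A c q (\<epsilon> 1 (snd c q)))
      (from_chart A c q (\<epsilon> 2 (snd c q))) (from_chart A c q (\<epsilon> 3 (snd c q)))"
  using ac q by (simp add: adapted_coframe_def)

lemma adapted_coframe_forms: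
  "g0 q (from_chart A c q (\<epsilon> 1 (snd c q))) (from_chart A c q u) = \<theta> 1 (snd c q) \<bullet> u"
  "dual2 q (from_chart A c q (\<epsilon> 2 (snd c q))) (from_chart A c q (\<epsilon> 3 (snd c q))) (from_chart A c q u) = \<theta> 2 (snd c q) \<bullet> u"
  "\<alpha> q (from_chart A c q u) = \<theta> 3 (snd c q) \<bullet> u"
proof -
  interpret coframe V \<theta> \<epsilon> using ac by (simp add: adapted_coframe_def)
  have c: "c \<in> A" using ac by (simp add: adapted_coframe_def)
  note l = linear_from_chart[OF c q(1)]
  note A' = adapted_coframe_adapted
  have u: "from_chart A c q u = (\<theta> 1 (snd c q) \<bullet> u) *\<^sub>R from_chart A c q (\<epsilon> 1 (snd c q))
    + (\<theta> 2 (snd c q) \<bullet> u) *\<^sub>R from_chart A c q (\<epsilon> 2 (snd c q)) + (\<theta> 3 (snd c q) \<bullet> u) *\<^sub>R from_chart A c q (\<epsilon> 3 (snd c q))"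
    by (subst expand[OF q(2), of u, symmetric]) (simp add: sum_3 linear_add[OF l] linear_scale[OF l])
  show "g0 q (from_chart A c q (\<epsilon> 1 (snd c q))) (from_chart A c q u) = \<theta> 1 (snd c q) \<bullet> u"
    unfolding u using A' by (simp add: lin_simps adapted_def)
  show "dual2 q (from_chart A c q (\<epsilon> 2 (snd c q))) (from_chart A c q (\<epsilon> 3 (snd c q))) (from_chart A c q u) = \<theta> 2 (snd c q) \<bullet> u"
    unfolding u using A' g0_sym[of q "from_chart A c q (\<epsilon> 1 (snd c q))" "from_chart A c q (\<epsilon> 2 (snd c q))"]
    by (simp add: lin_simps adapted_def dual2_def)
  show "\<alpha> q (from_chart A c q u) = \<theta> 3 (snd c q) \<bullet> u"
    unfolding u using A' by (simp add: lin_simps adapted_def)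
qed

lemma adapted_coframe_planes:
  "from_chart A c q u \<in> \<xi> q \<longleftrightarrow> \<theta> 3 (snd c q) \<bullet> u = 0"
  "from_chart A c q u \<in> \<eta> q \<longleftrightarrow> \<theta> 2 (snd c q) \<bullet> u = 0"
  using adapted_coframe_forms(2,3)[of u] adapted_\<eta>[OF adapted_coframe_adapted, of "from_chart A c q u"]
  by (auto simp: \<xi>)

end

text \<open>Multiplying the second form by \<open>1 / s\<close> makes \<open>shape\<close> positive for small \<open>s\<close> if
  \<open>\<eta>\<close> is contact; the third is then divided by \<open>t\<close> to prescribe the curvature.\<close>

definition scale2 :: "real \<Rightarrow> 3 \<Rightarrow> real^3 \<Rightarrow> real" where
  "scale2 s i x = (if i = 2 then inverse s else 1)"

abbreviation "sform s \<theta> \<equiv> (\<lambda>i x. scale2 s i x *\<^sub>R \<theta> i x)"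
abbreviation "sframe s \<epsilon> \<equiv> (\<lambda>i x. inverse (scale2 s i x) *\<^sub>R \<epsilon> i x)"

lemma smooth_on_scale2: "open V \<Longrightarrow> smooth_on V (scale2 s i)"
  unfolding scale2_def[abs_def] by (rule smooth_on_const)

lemma coframe_scale2: "coframe V \<theta> \<epsilon> \<Longrightarrow> s > 0 \<Longrightarrow> coframe V (sform s \<theta>) (sframe s \<epsilon>)"
  by (rule coframe.coframe_scale[OF _ smooth_on_scale2[OF coframe.open_domain]]) (auto simp: scale2_def)

lemma struc_scale2:
  assumes "coframe V \<theta> \<epsilon>" "s > 0" "x \<in> V"
  shows "struc (sform s \<theta>) (sframe s \<epsilon>) i j k x = scale2 s i x / (scale2 s j x * scale2 s k x) * struc \<theta> \<epsilon> i j k x"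
proof (rule coframe.struc_scale[OF assms(1) smooth_on_scale2[OF coframe.open_domain[OF assms(1)]]])
  show "i \<noteq> j \<and> i \<noteq> k \<or> frechet_derivative (scale2 s i) (at x) = (\<lambda>_. 0)"
    unfolding scale2_def[abs_def] by simp
qed (use assms in \<open>auto simp: scale2_def\<close>)

text \<open>Index 2 as the form contributes 1/s and as an argument contributes s. Thus only the
  structure function 2 1 3 is amplified as s tends to 0, while 1 1 3 and 2 2 3 are left
  alone.\<close>

lemma shape_scale2:
  assumes "coframe V \<theta> \<epsilon>" "s > 0" "x \<in> V"
  shows "shape (sform s \<theta>) (sframe s \<epsilon>) x =
    (struc \<theta> \<epsilon> 2 1 3 x / s + s * struc \<theta> \<epsilon> 1 2 3 x)\<^sup>2 / 4 - struc \<theta> \<epsilon> 1 1 3 x * struc \<theta> \<epsilon> 2 2 3 x"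
  unfolding shape_def struc_scale2[OF assms] using assms(2) by (simp add: scale2_def field_simps)

lemma twist_scale2:
  assumes "coframe V \<theta> \<epsilon>" "s > 0" "x \<in> V"
  shows "twist (sform s \<theta>) (sframe s \<epsilon>) x = 3 / 4 * (s * struc \<theta> \<epsilon> 3 1 2 x)\<^sup>2"
  unfolding twist_def struc_scale2[OF assms] using assms(2) by (simp add: scale2_def field_simps)

text \<open>The factors 1/s and 1/t are applied in two stages, because
  \<open>frame_curv_scale\<close> wants the factors 1 and 2 to be 1. With 1/t as third factor, its
  inverse square and square become t^2 and 1/t^2.\<close>

lemma frame_metric_coframe:
  assumes ac: "adapted_coframe c V \<theta> \<epsilon>" and s: "s > 0"
    and t: "smooth_function A t" "\<And>p. t p > 0"
  shows "\<exists>\<theta>' \<epsilon>'. local_coframe A (frame_metric s t) \<xi> c V \<theta>' \<epsilon>' \<and>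
    (\<forall>q\<in>fst c. snd c q \<in> V \<longrightarrow> frame_curv \<theta>' \<epsilon>' (snd c q) =
      frame_curv (sform s \<theta>) (sframe s \<epsilon>) (snd c q)
      + ((t q)\<^sup>2 - 1) * shape (sform s \<theta>) (sframe s \<epsilon>) (snd c q)
      - (1 / (t q)\<^sup>2 - 1) * twist (sform s \<theta>) (sframe s \<epsilon>) (snd c q))"
proof -
  have c: "c \<in> A" and V: "V \<subseteq> snd c ` fst c" and cof: "coframe V \<theta> \<epsilon>"
    using ac by (auto simp: adapted_coframe_def)
  have o: "open V" by (rule coframe.open_domain[OF cof])
  define k where "k i x = (if i = 3 then inverse (t (inv_chart c x)) else 1)" for i :: 3 and x
  have k: "smooth_on V (k i)" for i
  proof (cases "i = 3")
    case True
    have "smooth_on V (\<lambda>x. t (inv_chart c x))"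
      using t(1) c by (intro smooth_on_subset[OF _ o V]) (simp add: smooth_function_def o_def)
    then show ?thesis
      using True t(2) unfolding k_def[abs_def] by (auto intro!: smooth_on_inverse simp: less_imp_neq[symmetric])
  qed (simp add: k_def[abs_def] smooth_on_const o)
  have k0: "k i x \<noteq> 0" for i x using t(2)[of "inv_chart c x"] by (simp add: k_def)
  have k12: "k 1 = (\<lambda>_. 1)" "k 2 = (\<lambda>_. 1)" by (simp_all add: k_def fun_eq_iff)
  have k3: "k 3 (snd c q) = inverse (t q)" if "q \<in> fst c" for q
    by (simp add: k_def inv_chart c that)
  let ?\<theta> = "\<lambda>i x. k i x *\<^sub>R sform s \<theta> i x" and ?\<epsilon> = "\<lambda>i x. inverse (k i x) *\<^sub>R sframe s \<epsilon> i x"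
  note cs = coframe_scale2[OF cof s]
  have "local_coframe A (frame_metric s t) \<xi> c V ?\<theta> ?\<epsilon>"
    unfolding local_coframe_def
  proof (intro conjI ballI impI allI c V coframe.coframe_scale[OF cs k k0])
    fix q u v assume q: "q \<in> fst c" "snd c q \<in> V"
    note f = adapted_coframe_forms[OF ac q]
    show "frame_metric s t q (from_chart A c q u) (from_chart A c q v) = coframe_metric ?\<theta> (snd c q) u v"
      unfolding frame_metric_eq[OF adapted_coframe_adapted[OF ac q]] f coframe_metric_scale sum_3
      by (simp add: k12 k3 q scale2_def divide_inverse power2_eq_square mult_ac)
    show "(from_chart A c q u \<in> \<xi> q) = (?\<theta> 3 (snd c q) \<bullet> u = 0)"
      using k0[of 3 "snd c q"] by (simp add: adapted_coframe_planes[OF ac q] scale2_def)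
  qed
  moreover have "frame_curv ?\<theta> ?\<epsilon> (snd c q) = frame_curv (sform s \<theta>) (sframe s \<epsilon>) (snd c q)
      + ((t q)\<^sup>2 - 1) * shape (sform s \<theta>) (sframe s \<epsilon>) (snd c q)
      - (1 / (t q)\<^sup>2 - 1) * twist (sform s \<theta>) (sframe s \<epsilon>) (snd c q)" if q: "q \<in> fst c" "snd c q \<in> V" for q
    using frame_curv_scale[OF cs k k0 k12 q(2)] k3[OF q(1)] by (simp add: power_inverse divide_inverse)
  ultimately show ?thesis by blast
qed

lemma curvature_frame_metric:
  assumes ac: "adapted_coframe c V \<theta> \<epsilon>" and s: "s > 0" and q: "q \<in> fst c" "snd c q \<in> V"
    and t: "smooth_function A t" "\<And>p. t p > 0"
  shows "sectional_curvature A (frame_metric s t) \<xi> q = frame_curv (sform s \<theta>) (sframe s \<epsilon>) (snd c q)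
      + ((t q)\<^sup>2 - 1) * shape (sform s \<theta>) (sframe s \<epsilon>) (snd c q)
      - (1 / (t q)\<^sup>2 - 1) * twist (sform s \<theta>) (sframe s \<epsilon>) (snd c q)"
proof -
  obtain \<theta>' \<epsilon>' where L: "local_coframe A (frame_metric s t) \<xi> c V \<theta>' \<epsilon>'"
    and K: "\<forall>q\<in>fst c. snd c q \<in> V \<longrightarrow> frame_curv \<theta>' \<epsilon>' (snd c q) =
      frame_curv (sform s \<theta>) (sframe s \<epsilon>) (snd c q)
      + ((t q)\<^sup>2 - 1) * shape (sform s \<theta>) (sframe s \<epsilon>) (snd c q)
      - (1 / (t q)\<^sup>2 - 1) * twist (sform s \<theta>) (sframe s \<epsilon>) (snd c q)"
    using frame_metric_coframe[OF ac s t] by blast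
  show ?thesis unfolding sectional_curvature_eq[OF L q] by (rule K[rule_format, OF q])
qed

lemma frame_metric_local_coframe:
  assumes s: "s > 0" and t: "smooth_function A t" "\<And>p. t p > 0"
  shows "\<exists>c V \<theta> \<epsilon>. local_coframe A (frame_metric s t) \<xi> c V \<theta> \<epsilon> \<and> p \<in> fst c \<and> snd c p \<in> V"
proof -
  obtain V \<theta> \<epsilon> where ac: "adapted_coframe (chart_at A p) V \<theta> \<epsilon>" "snd (chart_at A p) p \<in> V"
    using adapted_coframe_exists[OF chart_at] by blast
  then show ?thesis using frame_metric_coframe[OF ac(1) s t] chart_at(2) by blast
qed

lemma adapted_exists: "\<exists>X Y Z. adapted p X Y Z"
proof -
  obtain V \<theta> \<epsilon> where "adapted_coframe (chart_at A p) V \<theta> \<epsilon>" "snd (chart_at A p) p \<in> V"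
    using adapted_coframe_exists[OF chart_at] by blast
  from adapted_coframe_adapted[OF this(1) chart_at(2) this(2)] show ?thesis by blast
qed

lemma riemannian_frame_metric:
  assumes s: "s > 0" and t: "smooth_function A t" "\<And>p. t p > 0"
  shows "riemannian_metric A (frame_metric s t)"
proof (rule riemannian_metricI[OF _ frame_metric_local_coframe[OF assms]])
  fix p
  obtain X Y Z where a: "adapted p X Y Z" using adapted_exists by blast
  note tp = t(2)[of p]
  have e: "frame_metric s t p u v =
    g0 p X u * g0 p X v + dual2 p Y Z u * dual2 p Y Z v / s\<^sup>2 + \<alpha> p u * \<alpha> p v / (t p)\<^sup>2" for u v
    by (rule frame_metric_eq[OF a])
  have d: "dual2 p Y Z (u + v) = dual2 p Y Z u + dual2 p Y Z v" "dual2 p Y Z (r *\<^sub>R u) = r * dual2 p Y Z u" for u v r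
    by (simp_all add: dual2_def lin_simps algebra_simps)
  show "inner_product (frame_metric s t p)"
    unfolding inner_product_def
  proof (intro conjI allI impI)
    show "bilinear (frame_metric s t p)"
      unfolding bilinear_def e by (auto intro!: linearI simp: d lin_simps algebra_simps add_divide_distrib)
    show "frame_metric s t p u v = frame_metric s t p v u" for u v by (simp add: e mult.commute)
    fix v :: "real^3" assume v: "v \<noteq> 0"
    \<comment> \<open>By \<open>adapted_expand\<close> only the zero vector is killed by all three
      dual forms.\<close>
    have "g0 p X v \<noteq> 0 \<or> dual2 p Y Z v \<noteq> 0 \<or> \<alpha> p v \<noteq> 0"
      using adapted_expand[OF a, of v] v by auto
    moreover have "x * x + y * y / s\<^sup>2 + z * z / (t p)\<^sup>2 > 0" if "x \<noteq> 0 \<or> y \<noteq> 0 \<or> z \<noteq> 0" for x y z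
    proof -
      have "x * x + y * y / s\<^sup>2 + z * z / (t p)\<^sup>2 = x\<^sup>2 + (y / s)\<^sup>2 + (z / t p)\<^sup>2"
        by (simp add: power2_eq_square)
      moreover have "x \<noteq> 0 \<or> y / s \<noteq> 0 \<or> z / t p \<noteq> 0" using that s tp by auto
      ultimately show ?thesis
        by (smt (verit) zero_le_power2 zero_less_power2)
    qed
    ultimately show "frame_metric s t p v v > 0" unfolding e by blast
  qed
qed

end

section \<open>Contact structures\<close>

text \<open>Differentiating the identity \<theta>(\<epsilon>) = 0 trades derivatives of the frame
  for derivatives of the form. This is d\<theta>(X, Y) = -\<theta>([X, Y]) for a form that vanishes
  on both fields.\<close>

lemma (in coframe) inner_bracket:
  assumes x: "x \<in> V" and ne: "i \<noteq> j" "i \<noteq> k"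
  shows "\<theta> i x \<bullet> bracket (\<epsilon> j) (\<epsilon> k) x = - struc \<theta> \<epsilon> i j k x"
proof -
  have z: "\<theta> i x \<bullet> frechet_derivative (\<epsilon> l) (at x) u = - (frechet_derivative (\<theta> i) (at x) u \<bullet> \<epsilon> l x)"
    if "i \<noteq> l" for l u
  proof -
    have "((\<lambda>y. \<theta> i y \<bullet> \<epsilon> l y) has_derivative (\<lambda>u. \<theta> i x \<bullet> frechet_derivative (\<epsilon> l) (at x) u
        + frechet_derivative (\<theta> i) (at x) u \<bullet> \<epsilon> l x)) (at x)"
      by (intro has_derivative_inner smooth_on_has_derivative[OF _ x] smooth_coframe smooth_frame)
    then have "((\<lambda>y. 0) has_derivative (\<lambda>u. \<theta> i x \<bullet> frechet_derivative (\<epsilon> l) (at x) u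
        + frechet_derivative (\<theta> i) (at x) u \<bullet> \<epsilon> l x)) (at x)"
      by (rule has_derivative_transform_within_open[OF _ open_domain x]) (simp add: dual \<open>i \<noteq> l\<close>)
    from fun_cong[OF has_derivative_unique[OF this has_derivative_const], of u] show ?thesis by simp
  qed
  show ?thesis by (simp add: bracket_def inner_diff_right z ne struc_def ext_deriv_def)
qed

text \<open>The frame fields other than the one with index \<open>i\<close> are sections of \<zeta>;
  a vanishing structure function would put their bracket into \<zeta>. The index stays free because
  i = 3 serves \<xi> and i = 2 serves \<eta>. The chart is \<open>chart_at A p\<close>, as it is
  there that \<open>lie_bracket\<close> is evaluated.\<close>

lemma (in smooth_manifold) contact_struc_nonzero:
  fixes \<theta> \<epsilon> :: "3 \<Rightarrow> real^3 \<Rightarrow> real^3"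
  assumes ct: "contact_structure A \<zeta>" and cof: "coframe V \<theta> \<epsilon>"
    and c: "c = chart_at A p" and V: "V \<subseteq> snd c ` fst c" and x: "snd c p \<in> V"
    and pl: "\<And>q u. q \<in> fst c \<Longrightarrow> snd c q \<in> V \<Longrightarrow> from_chart A c q u \<in> \<zeta> q \<longleftrightarrow> \<theta> i (snd c q) \<bullet> u = 0"
    and ne: "i \<noteq> j" "i \<noteq> k" "j \<noteq> k"
  shows "struc \<theta> \<epsilon> i j k (snd c p) \<noteq> 0"
proof
  interpret coframe V \<theta> \<epsilon> by fact
  assume z: "struc \<theta> \<epsilon> i j k (snd c p) = 0"
  have cA: "c \<in> A" and p: "p \<in> fst c" using c chart_at by auto
  define W where "W = {q \<in> fst c. snd c q \<in> V}"
  define F where "F l q = from_chart A c q (\<epsilon> l (snd c q))" for l q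
  have W: "open W" unfolding W_def by (rule open_chart_preimage[OF cA open_domain])
  \<comment> \<open>Smoothness has to be checked in every chart of the atlas; in the chart
    \<open>d\<close> the field is the image of \<open>\<epsilon> l\<close> under the derivative of
    the transition map.\<close>
  have F: "smooth_field_on A W (F l)" for l
    unfolding smooth_field_on_def
  proof
    fix d assume d: "d \<in> A"
    have N: "open (fst d \<inter> W)" "fst d \<inter> W \<subseteq> fst d \<inter> fst c"
      using W open_chart[OF d] by (auto simp: W_def)
    interpret smooth_chart_change "snd d ` (fst d \<inter> W)" "snd c ` (fst d \<inter> W)" "transition d c" "transition c d"
      by (rule chart_change[OF d cA N])
    have \<epsilon>: "smooth_on (snd c ` (fst d \<inter> W)) (\<epsilon> l)"
      by (rule smooth_on_subset[OF smooth_frame smooth_on_open[OF smooth_\<psi>]]) (auto simp: W_def)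
    have "smooth_on (snd d ` (fst d \<inter> W)) (\<lambda>y. frechet_derivative (transition c d) (at (transition d c y)) (\<epsilon> l (transition d c y)))"
      using maps by (intro smooth_on_fderiv[OF smooth_\<psi> smooth_\<phi>] smooth_on_compose[OF smooth_\<phi> \<epsilon>]) auto
    then show "smooth_on (snd d ` (fst d \<inter> W)) (field_in_chart A d (F l))"
    proof (rule smooth_on_cong)
      fix y assume "y \<in> snd d ` (fst d \<inter> W)"
      then obtain q where q: "q \<in> fst d" "q \<in> fst c" "y = snd d q" by (auto simp: W_def)
      then show "frechet_derivative (transition c d) (at (transition d c y)) (\<epsilon> l (transition d c y)) = field_in_chart A d (F l) y"
        by (simp add: field_in_chart_def Let_def inv_chart d F_def to_chart_from_chart cA jac_def transition_chart)
    qed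
  qed
  have sec: "section_on A \<zeta> W (F l)" if "i \<noteq> l" for l
    unfolding section_on_def using F that by (auto simp: F_def W_def pl dual)
  have ind: "F j q \<noteq> F k q \<and> independent {F j q, F k q}" if q: "q \<in> W" for q
    unfolding independent_pair
  proof (intro allI impI)
    fix a b assume ab: "a *\<^sub>R F j q + b *\<^sub>R F k q = 0"
    have q': "q \<in> fst c" "snd c q \<in> V" using q by (auto simp: W_def)
    note l = linear_from_chart[OF cA q'(1)]
    have "from_chart A c q (a *\<^sub>R \<epsilon> j (snd c q) + b *\<^sub>R \<epsilon> k (snd c q)) = 0"
      using ab by (simp add: F_def linear_add[OF l] linear_scale[OF l])
    then have w: "a *\<^sub>R \<epsilon> j (snd c q) + b *\<^sub>R \<epsilon> k (snd c q) = 0"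
      using to_chart_from_chart[OF cA cA q'(1) q'(1)] jac_self[OF cA q'(1)]
        linear_0[OF linear_to_chart[OF cA q'(1)]] by metis
    have "\<theta> l (snd c q) \<bullet> (a *\<^sub>R \<epsilon> j (snd c q) + b *\<^sub>R \<epsilon> k (snd c q)) = 0" for l
      unfolding w by simp
    from this[of j] this[of k] show "a = 0 \<and> b = 0"
      using ne(3) by (simp add: inner_add_right dual[OF q'(2)])
  qed
  have pW: "p \<in> W" using p x by (simp add: W_def)
  have "lie_bracket A (F j) (F k) p \<notin> \<zeta> p"
    using ct W sec[OF ne(1)] sec[OF ne(2)] ind pW unfolding contact_structure_def by blast
  moreover have fc: "field_in_chart A c (F l) y = \<epsilon> l y" if "y \<in> V" for l y
  proof -
    obtain q where q: "q \<in> fst c" "y = snd c q" using V \<open>y \<in> V\<close> by blast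
    then show ?thesis
      by (simp add: field_in_chart_def Let_def inv_chart cA F_def to_chart_from_chart jac_self)
  qed
  have fd: "frechet_derivative (field_in_chart A c (F l)) (at (snd c p)) = frechet_derivative (\<epsilon> l) (at (snd c p))" for l
    by (rule frechet_derivative_local[OF open_domain x fc])
  have "bracket (field_in_chart A c (F j)) (field_in_chart A c (F k)) (snd c p) = bracket (\<epsilon> j) (\<epsilon> k) (snd c p)"
    unfolding bracket_def fd fc[OF x] ..
  then have "lie_bracket A (F j) (F k) p = bracket (\<epsilon> j) (\<epsilon> k) (snd c p)"
    by (simp add: lie_bracket_def c[symmetric] Let_def)
  moreover have "from_chart A c p (bracket (\<epsilon> j) (\<epsilon> k) (snd c p)) \<in> \<zeta> p"
    unfolding pl[OF p x] inner_bracket[OF x ne(1,2)] using z by simp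
  ultimately show False using from_chart_at[of p] by (simp add: c[symmetric])
qed

context transverse_planes
begin

text \<open>One adapted coframe is enough, since \<open>shape\<close> turns out to take the same
  value in all of them.\<close>

definition pos_shape :: "real \<Rightarrow> 'a \<Rightarrow> bool" where
  "pos_shape s q \<longleftrightarrow> (\<exists>c V \<theta> \<epsilon>. adapted_coframe c V \<theta> \<epsilon> \<and> q \<in> fst c \<and> snd c q \<in> V \<and>
    shape (sform s \<theta>) (sframe s \<epsilon>) (snd c q) > 0)"

lemma pos_shape_local:
  assumes ct: "contact_structure A \<eta>"
  shows "\<exists>U s0. open U \<and> p \<in> U \<and> s0 > 0 \<and> (\<forall>q\<in>U. \<forall>s. 0 < s \<and> s \<le> s0 \<longrightarrow> pos_shape s q)"
proof -
  define c where "c = chart_at A p"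
  have c: "c \<in> A" "p \<in> fst c" unfolding c_def by (rule chart_at)+
  obtain V \<theta> \<epsilon> where ac: "adapted_coframe c V \<theta> \<epsilon>" and x: "snd c p \<in> V"
    using adapted_coframe_exists[OF c] by blast
  have cof: "coframe V \<theta> \<epsilon>" and V: "V \<subseteq> snd c ` fst c" using ac by (auto simp: adapted_coframe_def)
  interpret coframe V \<theta> \<epsilon> by fact
  let ?f = "\<lambda>i j k. struc \<theta> \<epsilon> i j k"
  \<comment> \<open>The part of the rescaled \<open>shape\<close> that is free of s. What remains is
    the square of structure function 2 1 3 divided by 4 s^2, and a nonnegative term.\<close>
  define h where "h x = ?f 2 1 3 x * ?f 1 2 3 x / 2 - ?f 1 1 3 x * ?f 2 2 3 x" for x
  have "?f 2 1 3 (snd c p) \<noteq> 0"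
    by (rule contact_struc_nonzero[OF ct cof c_def V x]) (auto simp: adapted_coframe_planes[OF ac])
  then have f0: "(?f 2 1 3 (snd c p))\<^sup>2 > 0" by simp
  \<comment> \<open>Half the square at \<open>p\<close>, and a number whose negative lies strictly
    below \<open>h\<close> there, so that both bounds persist on a neighbourhood.\<close>
  define r n where "r = (?f 2 1 3 (snd c p))\<^sup>2 / 2" and "n = \<bar>h (snd c p)\<bar> + 1"
  have r: "r > 0" using f0 by (simp add: r_def)
  have n: "n > 0" by (simp add: n_def)
  have cf: "continuous_on V (?f i j k)" for i j k by (rule smooth_on_continuous_on[OF smooth_on_struc])
  have "continuous_on V (\<lambda>x. (?f 2 1 3 x)\<^sup>2)" "continuous_on V h"
    unfolding h_def[abs_def] by (intro continuous_intros cf; simp)+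
  then have "open (V \<inter> (\<lambda>x. (?f 2 1 3 x)\<^sup>2) -` {r<..})" "open (V \<inter> h -` {-n<..})"
    using open_domain by (auto intro: continuous_open_preimage)
  then have "open (V \<inter> (\<lambda>x. (?f 2 1 3 x)\<^sup>2) -` {r<..} \<inter> (V \<inter> h -` {-n<..}))" by (rule open_Int)
  then have U: "open {q \<in> fst c. snd c q \<in> V \<inter> (\<lambda>x. (?f 2 1 3 x)\<^sup>2) -` {r<..} \<inter> (V \<inter> h -` {-n<..})}" (is "open ?U")
    by (rule open_chart_preimage[OF c(1)])
  have pU: "p \<in> ?U"
    using c x f0 by (auto simp: r_def n_def)
  \<comment> \<open>The solution of r / (4 s^2) = n; up to this value of s the singular term
    outweighs \<open>h\<close>.\<close>
  define s0 where "s0 = sqrt (r / (4 * n))"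
  have s0: "s0 > 0" using r n by (simp add: s0_def)
  have "pos_shape s q" if q: "q \<in> ?U" and s: "0 < s" "s \<le> s0" for q s
  proof -
    let ?x = "snd c q"
    have "s\<^sup>2 \<le> r / (4 * n)"
      using s r n real_sqrt_le_iff[of "s\<^sup>2" "r / (4 * n)"] by (simp add: s0_def)
    then have 1: "n \<le> r / (4 * s\<^sup>2)" using s n by (simp add: field_simps)
    have 2: "r / (4 * s\<^sup>2) < (?f 2 1 3 ?x)\<^sup>2 / (4 * s\<^sup>2)"
      using q s by (intro divide_strict_right_mono) auto
    have 3: "h ?x > - n" using q by auto
    have "(?f 2 1 3 ?x / s + s * ?f 1 2 3 ?x)\<^sup>2 / 4 - ?f 1 1 3 ?x * ?f 2 2 3 ?x
      = (?f 2 1 3 ?x)\<^sup>2 / (4 * s\<^sup>2) + h ?x + (s * ?f 1 2 3 ?x)\<^sup>2 / 4"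
      using s by (simp add: h_def field_simps power2_eq_square)
    moreover have "(s * ?f 1 2 3 ?x)\<^sup>2 / 4 \<ge> 0" by simp
    ultimately have "(?f 2 1 3 ?x / s + s * ?f 1 2 3 ?x)\<^sup>2 / 4 - ?f 1 1 3 ?x * ?f 2 2 3 ?x > 0"
      using 1 2 3 by linarith
    moreover have qV: "q \<in> fst c" "?x \<in> V" using q by auto
    ultimately have "shape (sform s \<theta>) (sframe s \<epsilon>) ?x > 0" by (simp only: shape_scale2[OF cof s(1) qV(2)])
    then show ?thesis unfolding pos_shape_def using ac qV by blast
  qed
  then show ?thesis using U pU s0 by (intro exI[of _ ?U] exI[of _ s0] conjI ballI allI impI) auto
qed

text \<open>The local statement covers all smaller s as well, so the minimum over a finite subcover
  works everywhere.\<close>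

lemma pos_shape_exists:
  assumes ct: "contact_structure A \<eta>" and comp: "compact (UNIV :: 'a set)"
  shows "\<exists>s>0. \<forall>q. pos_shape s q"
proof -
  obtain U s0 where U: "\<And>p. open (U p)" "\<And>p. p \<in> U p" and s0: "\<And>p. s0 p > 0"
    and sh: "\<And>p q s. q \<in> U p \<Longrightarrow> 0 < s \<Longrightarrow> s \<le> s0 p \<Longrightarrow> pos_shape s q"
    using pos_shape_local[OF ct] by metis
  have "UNIV \<subseteq> (\<Union>p\<in>UNIV. U p)" using U(2) by blast
  then obtain P where P: "finite P" "UNIV \<subseteq> (\<Union>p\<in>P. U p)"
    using compactE_image[OF comp, of UNIV U] U(1) by metis
  then have "P \<noteq> {}" by auto
  define s where "s = Min (s0 ` P)"
  have "s > 0" using P(1) \<open>P \<noteq> {}\<close> s0 by (simp add: s_def)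
  moreover have "s \<le> s0 p" if "p \<in> P" for p using P(1) that by (simp add: s_def)
  ultimately show ?thesis using sh P(2) by (meson UNIV_I UN_E subsetD)
qed

end

section \<open>Solving for the prescribed curvature\<close>

lemma quadratic_root:
  fixes S T k :: real
  assumes "S > 0" "T > 0"
  defines "w \<equiv> (sqrt (k\<^sup>2 + 4 * S * T) - k) / (2 * S)"
  shows "w > 0" "S * w - T / w + k = 0"
proof -
  let ?r = "sqrt (k\<^sup>2 + 4 * S * T)"
  have ST: "S * T > 0" using assms by simp
  have r2: "?r * ?r = k\<^sup>2 + 4 * S * T" using ST by (simp add: real_sqrt_mult_self)
  \<comment> \<open>The discriminant exceeds k^2, so this root is positive whatever the sign of
    \<open>k\<close>.\<close>
  have "\<bar>k\<bar> < ?r" using ST by (intro real_less_rsqrt) (simp add: power2_eq_square)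
  then show w: "w > 0" using assms(1) by (simp add: w_def)
  have "2 * S * w = ?r - k" using assms(1) by (simp add: w_def)
  then have "(2 * S * w + k) * (2 * S * w + k) = k\<^sup>2 + 4 * S * T" using r2 by simp
  then have "4 * S * (S * w * w + k * w - T) = 0" by (simp add: power2_eq_square algebra_simps)
  then have "S * w * w + k * w - T = 0" using assms(1) by simp
  then show "S * w - T / w + k = 0" using w by (simp add: field_simps)
qed

theorem theorem5p1:
  fixes A :: "'a::{t2_space, second_countable_topology} atlas"
    and \<xi> :: "'a \<Rightarrow> (real^3) set"
    and f :: "'a \<Rightarrow> real"
  assumes "smooth_atlas A"
    and "compact (UNIV :: 'a set)"
    and "orientable A"
    and "contact_structure A \<xi>"
    and "transversally_orientable A \<xi>"
    and "\<exists>\<eta>. contact_structure A \<eta> \<and> transverse \<xi> \<eta>"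
    and "smooth_function A f"
  shows "\<exists>g. riemannian_metric A g \<and> sectional_curvature A g \<xi> = f"
proof -
  obtain \<eta> where \<eta>: "contact_structure A \<eta>" "transverse \<xi> \<eta>" using assms(6) by blast
  obtain \<alpha> where \<alpha>: "smooth_1form A \<alpha>" "\<And>p. \<xi> p = {v. \<alpha> p v = 0}"
    using assms(5) unfolding transversally_orientable_def by blast
  obtain g0 where g0: "riemannian_metric A g0" using riemannian_metric_exists assms(1,2) by blast
  interpret transverse_planes A g0 \<xi> \<eta> \<alpha>
    using assms(1,4) \<eta> \<alpha> g0 by unfold_locales (auto simp: contact_structure_def)
  obtain s where s: "s > 0" and shape: "\<And>q. pos_shape s q"
    using pos_shape_exists[OF \<eta>(1) assms(2)] by blast
  \<comment> \<open>Curvatures for constant t. They are global functions, although the coframes that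
    compute them are local.\<close>
  define K where "K r = sectional_curvature A (frame_metric s (\<lambda>_. r)) \<xi>" for r
  have const: "smooth_function A (\<lambda>_. r)" for r
    by (simp add: smooth_function_def o_def smooth_on_const open_chart_image)
  have smooth_K: "smooth_function A (K r)" if "r > 0" for r
    unfolding K_def using frame_metric_local_coframe[OF s const] that
    by (intro smooth_sectional_curvature) blast
  \<comment> \<open>For curvature of the form K0 + t^2 S - T/t^2 one has K 2 - K 1 = 3 S + 3/4 T and
    K (1/2) - K 1 = -3/4 S - 3 T. The weights 4, 1 eliminate T and leave 45/4 S; the weights 1, 4
    eliminate S and leave -45/4 T.\<close>
  define S T where "S q = 4 / 45 * (4 * (K 2 q - K 1 q) + (K (1/2) q - K 1 q))"
    and "T q = - (4 / 45) * ((K 2 q - K 1 q) + 4 * (K (1/2) q - K 1 q))" for q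
  have ST: "S q = shape (sform s \<theta>) (sframe s \<epsilon>) (snd c q)" "T q = twist (sform s \<theta>) (sframe s \<epsilon>) (snd c q)"
     "K 1 q = frame_curv (sform s \<theta>) (sframe s \<epsilon>) (snd c q)"
    if "adapted_coframe c V \<theta> \<epsilon>" "q \<in> fst c" "snd c q \<in> V" for c V \<theta> \<epsilon> q
    unfolding S_def T_def K_def curvature_frame_metric[OF that(1) s that(2,3) const zero_less_one]
      curvature_frame_metric[OF that(1) s that(2,3) const zero_less_numeral]
      curvature_frame_metric[OF that(1) s that(2,3) const half_gt_zero[OF zero_less_one]]
    by (simp_all add: power2_eq_square algebra_simps)
  have S: "S q > 0" for q using shape[of q] unfolding pos_shape_def by (auto simp: ST(1))
  have T: "T q > 0" for q
  proof -
    obtain V \<theta> \<epsilon> where ac: "adapted_coframe (chart_at A q) V \<theta> \<epsilon>" and x: "snd (chart_at A q) q \<in> V"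
      using adapted_coframe_exists[OF chart_at] by blast
    have cof: "coframe V \<theta> \<epsilon>" and V: "V \<subseteq> snd (chart_at A q) ` fst (chart_at A q)"
      using ac by (auto simp: adapted_coframe_def)
    \<comment> \<open>Here the contact condition on \<xi> enters; that on \<eta> has given S >
      0.\<close>
    have "struc \<theta> \<epsilon> 3 1 2 (snd (chart_at A q) q) \<noteq> 0"
      by (rule contact_struc_nonzero[OF assms(4) cof refl V x]) (auto simp: adapted_coframe_planes[OF ac])
    then show ?thesis
      unfolding ST(2)[OF ac chart_at(2) x] twist_scale2[OF cof s x] using s by simp
  qed
  \<comment> \<open>K 1 - S + T is the part of the curvature free of t. With w = t^2 the equation to
    be solved becomes S w - T / w + k = 0.\<close>
  define k where "k q = K 1 q - S q + T q - f q" for q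
  define w where "w q = (sqrt ((k q)\<^sup>2 + 4 * S q * T q) - k q) / (2 * S q)" for q
  define t where "t q = sqrt (w q)" for q
  have w: "w q > 0" "S q * w q - T q / w q + k q = 0" for q
    unfolding w_def by (rule quadratic_root[OF S T])+
  then have t: "t q > 0" "(t q)\<^sup>2 = w q" for q by (simp_all add: t_def less_imp_le)
  have smooth_t: "smooth_function A t"
    unfolding smooth_function_def
  proof
    fix c assume c: "c \<in> A"
    let ?V = "snd c ` fst c"
    have o: "open ?V" by (rule open_chart_image[OF c])
    have sK: "smooth_on ?V (\<lambda>x. K r (inv_chart c x))" if "r > 0" for r
      using smooth_K[OF that] c by (simp add: smooth_function_def o_def)
    have sf: "smooth_on ?V (\<lambda>x. f (inv_chart c x))"
      using assms(7) c by (simp add: smooth_function_def o_def)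
    have sS: "smooth_on ?V (\<lambda>x. S (inv_chart c x))" and sT: "smooth_on ?V (\<lambda>x. T (inv_chart c x))"
      unfolding S_def T_def by (intro smooth_on_mult smooth_on_add smooth_on_diff smooth_on_const o sK; simp)+
    have sk: "smooth_on ?V (\<lambda>x. k (inv_chart c x))"
      unfolding k_def by (intro smooth_on_add smooth_on_diff sS sT sf sK) simp
    \<comment> \<open>A positive radicand keeps the square root smooth, and S > 0 does the same for
      the quotient.\<close>
    have "(k q)\<^sup>2 + 4 * S q * T q > 0" for q
      using S[of q] T[of q] by (simp add: add_nonneg_pos)
    then have "smooth_on ?V (\<lambda>x. w (inv_chart c x))"
      unfolding w_def power2_eq_square
      by (intro smooth_on_divide smooth_on_diff smooth_on_sqrt smooth_on_add smooth_on_mult smooth_on_const o sS sT sk)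
        (use S in \<open>auto simp: less_imp_neq[symmetric]\<close>)
    then show "smooth_on ?V (t \<circ> inv_chart c)"
      unfolding t_def o_def by (rule smooth_on_sqrt) (rule w)
  qed
  have "sectional_curvature A (frame_metric s t) \<xi> q = f q" for q
  proof -
    obtain V \<theta> \<epsilon> where ac: "adapted_coframe (chart_at A q) V \<theta> \<epsilon>" and x: "snd (chart_at A q) q \<in> V"
      using adapted_coframe_exists[OF chart_at] by blast
    have "sectional_curvature A (frame_metric s t) \<xi> q = K 1 q + (w q - 1) * S q - (1 / w q - 1) * T q"
      using curvature_frame_metric[OF ac s chart_at(2) x smooth_t t(1)] ST[OF ac chart_at(2) x] by (simp add: t(2))
    then show ?thesis using w(2)[of q] by (simp add: k_def algebra_simps)
  qed
  then show ?thesis using riemannian_frame_metric[OF s smooth_t t(1)] by blast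
qed

end
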